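(* Let $T>0$, $I=(0,T)$, and suppose that $b\in L^\infty(I\times\mathbb{R};\mathbb{R})$ is nearly incompressible. Then for any initial condition $\bar u\in L^1_{\mathrm{loc}}(\mathbb{R})$ the Cauchy problem $$\partial_t u+\partial_x(ub)=0\ \text{ in } I\times\mathbb{R},\qquad u|_{t=0}=\bar u\ \text{ in }\mathbb{R},$$ has a unique weak solution $u\in L^1_{\mathrm{loc}}(I\times\mathbb{R})$ (uniqueness is up to equality almost everywhere on $I\times\mathbb{R}$).
   Context: Nearly incompressible: a vector field $b\in L^\infty(I\times\mathbb{R};\mathbb{R})$ is called nearly incompressible with density $\rho\colon I\times\mathbb{R}\to\mathbb{R}$ (a measurable function) if there exists $C>0$ such that $1/C\le\rho(t,x)\le C$ for a.e. $(t,x)\in I\times\mathbb{R}$ and $\partial_t\rho+\partial_x(\rho b)=0$ in the sense of distributions on $I\times\mathbb{R}$. It is called nearly incompressible if such a $\rho$ exists. Weak solution: a function $u\in L^1_{\mathrm{loc}}(I\times\mathbb{R})$ is a weak solution of the Cauchy problem with initial condition $\bar u$ if $$\int_0^T\!\!\int_{\mathbb{R}}u(t,x)\big(\partial_t\varphi(t,x)+b(t,x)\,\partial_x\varphi(t,x)\big)\,dx\,dt+\int_{\mathbb{R}}\bar u(x)\varphi(0,x)\,dx=0$$ for every $\varphi\in C^1_c([0,T)\times\mathbb{R})$ (the support of $\varphi$ may touch $t=0$). It is part of the definition that the integrands are Lebesgue integrable for every such $\varphi$. *)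

theory Defs
  imports "HOL-Analysis.Analysis"
begin

text \<open>
  Points of the space-time plane are pairs \<open>(t, x)\<close>. Functions on a set \<open>A\<close> are represented by
  total functions whose values outside \<open>A\<close> play no role: measurability, integrals and
  almost-everywhere statements refer to the measure \<^term>\<open>lebesgue_on A\<close>.
\<close>

abbreviation spacetime :: "real \<Rightarrow> (real \<times> real) set" where
  "spacetime T \<equiv> {0<..<T} \<times> UNIV"

abbreviation spacetime0 :: "real \<Rightarrow> (real \<times> real) set" where
  "spacetime0 T \<equiv> {0..<T} \<times> UNIV"

definition L_infty_on :: "'a::euclidean_space set \<Rightarrow> ('a \<Rightarrow> real) \<Rightarrow> bool" where
  "L_infty_on A f \<longleftrightarrow>
     f \<in> borel_measurable (lebesgue_on A) \<and> (\<exists>M. AE p in lebesgue_on A. \<bar>f p\<bar> \<le> M)"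

definition L1_loc_on :: "'a::euclidean_space set \<Rightarrow> ('a \<Rightarrow> real) \<Rightarrow> bool" where
  "L1_loc_on A f \<longleftrightarrow> (\<forall>K. compact K \<and> K \<subseteq> A \<longrightarrow> integrable (lebesgue_on K) f)"

text \<open>
  \<open>\<phi>\<close> is \<open>C\<^sup>1\<close> on \<open>A\<close> with partial derivatives \<open>\<phi>t\<close> and \<open>\<phi>x\<close>. Differentiability is relative to
  \<open>A\<close>, so at the points \<open>(0, x)\<close> of \<^term>\<open>spacetime0 T\<close> the time derivative is one-sided.
  On \<^term>\<open>spacetime T\<close> and \<^term>\<open>spacetime0 T\<close> the partial derivatives are determined by \<open>\<phi>\<close>.
\<close>

definition C1_on ::
  "(real \<times> real) set \<Rightarrow> (real \<times> real \<Rightarrow> real) \<Rightarrow> (real \<times> real \<Rightarrow> real) \<Rightarrow> (real \<times> real \<Rightarrow> real) \<Rightarrow> bool"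
where
  "C1_on A \<phi> \<phi>t \<phi>x \<longleftrightarrow>
     continuous_on A \<phi>t \<and> continuous_on A \<phi>x \<and>
     (\<forall>p\<in>A. (\<phi> has_derivative (\<lambda>h. \<phi>t p * fst h + \<phi>x p * snd h)) (at p within A))"

text \<open>\<open>D i j\<close> is the mixed partial derivative of order \<open>i\<close> in time and \<open>j\<close> in space.\<close>

definition C_infty_on :: "(real \<times> real) set \<Rightarrow> (real \<times> real \<Rightarrow> real) \<Rightarrow> bool" where
  "C_infty_on A \<phi> \<longleftrightarrow>
     (\<exists>D :: nat \<Rightarrow> nat \<Rightarrow> real \<times> real \<Rightarrow> real. D 0 0 = \<phi> \<and>
        (\<forall>i j. C1_on A (D i j) (D (Suc i) j) (D i (Suc j))))"

definition compactly_supported_in :: "(real \<times> real) set \<Rightarrow> (real \<times> real \<Rightarrow> real) \<Rightarrow> bool" where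
  "compactly_supported_in A \<phi> \<longleftrightarrow>
     compact (closure (support_on A \<phi>)) \<and> closure (support_on A \<phi>) \<subseteq> A"

text \<open>\<open>\<partial>\<^sub>t \<rho> + \<partial>\<^sub>x (\<rho> b) = 0\<close> in the sense of distributions on the open strip.\<close>

definition distributional_continuity_eq ::
  "real \<Rightarrow> (real \<times> real \<Rightarrow> real) \<Rightarrow> (real \<times> real \<Rightarrow> real) \<Rightarrow> bool"
where
  "distributional_continuity_eq T b \<rho> \<longleftrightarrow>
     (\<forall>\<phi> \<phi>t \<phi>x. C_infty_on (spacetime T) \<phi> \<and> compactly_supported_in (spacetime T) \<phi> \<and>
        C1_on (spacetime T) \<phi> \<phi>t \<phi>x \<longrightarrow>
        (LINT p|lebesgue_on (spacetime T). \<rho> p * (\<phi>t p + b p * \<phi>x p)) = 0)"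

definition nearly_incompressible_with ::
  "real \<Rightarrow> (real \<times> real \<Rightarrow> real) \<Rightarrow> (real \<times> real \<Rightarrow> real) \<Rightarrow> bool"
where
  "nearly_incompressible_with T b \<rho> \<longleftrightarrow>
     \<rho> \<in> borel_measurable (lebesgue_on (spacetime T)) \<and>
     (\<exists>C>0. AE p in lebesgue_on (spacetime T). 1 / C \<le> \<rho> p \<and> \<rho> p \<le> C) \<and>
     distributional_continuity_eq T b \<rho>"

definition nearly_incompressible :: "real \<Rightarrow> (real \<times> real \<Rightarrow> real) \<Rightarrow> bool" where
  "nearly_incompressible T b \<longleftrightarrow> (\<exists>\<rho>. nearly_incompressible_with T b \<rho>)"

text \<open>
  The Bochner integral of a non-integrable function is \<open>0\<close> by convention, hence the explicit
  integrability conditions.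
\<close>

definition weak_solution ::
  "real \<Rightarrow> (real \<times> real \<Rightarrow> real) \<Rightarrow> (real \<Rightarrow> real) \<Rightarrow> (real \<times> real \<Rightarrow> real) \<Rightarrow> bool"
where
  "weak_solution T b ubar u \<longleftrightarrow>
     L1_loc_on (spacetime T) u \<and>
     (\<forall>\<phi> \<phi>t \<phi>x. C1_on (spacetime0 T) \<phi> \<phi>t \<phi>x \<and> compactly_supported_in (spacetime0 T) \<phi> \<longrightarrow>
        integrable (lebesgue_on (spacetime T)) (\<lambda>p. u p * (\<phi>t p + b p * \<phi>x p)) \<and>
        integrable lebesgue (\<lambda>x. ubar x * \<phi> (0, x)) \<and>
        (LINT p|lebesgue_on (spacetime T). u p * (\<phi>t p + b p * \<phi>x p)) +
          (LINT x|lebesgue. ubar x * \<phi> (0, x)) = 0)"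

end

theory Submission
  imports Defs "HOL-Probability.Sinc_Integral" "HOL-Complex_Analysis.Great_Picard"
begin
text \<open>
  Put \<open>J = \<rho> b\<close>. The equation \<open>\<partial>\<^sub>t \<rho> + \<partial>\<^sub>x J = 0\<close> says that the one-form \<open>\<rho> dx - J dt\<close> is closed. In one
  space dimension it is therefore the differential of a Lipschitz function \<open>H\<close>, and \<open>H (t, \<cdot>)\<close> is
  bi-Lipschitz because \<open>\<rho>\<close> is bounded away from \<open>0\<close> and \<open>\<infinity>\<close>. The level lines of \<open>H\<close> are the
  characteristics of \<open>b\<close>: in the coordinates \<open>\<Phi> (t, x) = (t, H (t, x))\<close> the operator
  \<open>\<partial>\<^sub>t + b \<partial>\<^sub>x\<close> becomes \<open>\<partial>\<^sub>t\<close>, since \<open>\<partial>\<^sub>t H + b \<partial>\<^sub>x H = - J + b \<rho> = 0\<close>, and the measure \<open>\<rho> dt dx\<close>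
  becomes \<open>dt dy\<close> (lemma \<open>distr_\<Phi>\<close>). So \<open>u\<close> is a weak solution exactly when \<open>u / \<rho>\<close>, read in the
  coordinates \<open>(t, y)\<close>, does not depend on \<open>t\<close>; its value on the line \<open>y\<close> is dictated by the initial
  condition.

  The obstacle is that \<open>\<psi> \<circ> \<Phi>\<close> is only Lipschitz and hence not an admissible test function. Instead of
  differentiating \<open>H\<close> almost everywhere, the proof mollifies \<open>\<rho>\<close> and \<open>J\<close>. The mollified fields \<open>R n\<close> and
  \<open>Jn n\<close> are still divergence-free and have smooth potentials \<open>Hn n\<close>, which converge to \<open>H\<close> along a
  subsequence (\<open>smooth_potentials_exist\<close>, \<open>convergent_subsequence\<close>). The error
  \<open>\<partial>\<^sub>t Hn + b \<partial>\<^sub>x Hn = b R - Jn\<close> is bounded and tends to \<open>0\<close> almost everywhere, so dominated convergence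
  makes functions of \<open>Hn\<close> as good as functions of \<open>H\<close>.

  Uniqueness: testing the difference \<open>v\<close> of two solutions with \<open>G(t) h(Hn)\<close> and passing to the limit gives
  \<open>\<integral> v G'(t) h(H) = 0\<close> (\<open>vanishing_weak_solution_orthogonal\<close>). Thus \<open>v\<close> has integral \<open>0\<close> over the preimage
  under \<open>\<Phi>\<close> of every rectangle, hence of every Borel set, and \<open>v = 0\<close> because \<open>\<Phi>\<close> is invertible
  (\<open>vanishing_weak_solution_zero\<close>).

  Existence: the solution is \<open>u = \<rho> w(H)\<close>, where \<open>w\<close> is the density of the image under \<open>H (0, \<cdot>)\<close> of the
  signed measure with density \<open>ubar\<close> (\<open>initial_density\<close>). The field \<open>h(Hn) (R, Jn)\<close> is divergence-free,
  and in the limit Green's identity for it says that for almost every \<open>y\<close> the integral of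
  \<open>\<partial>\<^sub>t \<phi> + b \<partial>\<^sub>x \<phi>\<close> along the characteristic through \<open>(0, X (0, y))\<close> equals \<open>- \<phi> (0, X (0, y))\<close>
  (\<open>characteristic_identity\<close>). Integrating this against \<open>w\<close> is the weak equation for \<open>u\<close>.
\<close>

section \<open>Smooth bump functions\<close>

text \<open>
  The functions \<open>p(1/x) exp (- 1/x)\<close> with a polynomial \<open>p\<close> form a class closed under differentiation, which
  yields all derivatives of \<open>exp (- 1/x)\<close> at once, including at \<open>0\<close>.
\<close>

definition flat_poly :: "real poly \<Rightarrow> real \<Rightarrow> real" where
  "flat_poly p x = (if x > 0 then poly p (1 / x) * exp (- (1 / x)) else 0)"

lemma poly_mult_exp_neg_tendsto_0: "((\<lambda>y::real. poly p y * exp (- y)) \<longlongrightarrow> 0) at_top"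
proof -
  have "((\<lambda>y::real. \<Sum>i\<le>degree p. coeff p i * (y ^ i / exp y)) \<longlongrightarrow> (\<Sum>i\<le>degree p. coeff p i * 0)) at_top"
    by (intro tendsto_intros tendsto_power_div_exp_0)
  then show ?thesis
    by (simp add: poly_altdef sum_distrib_right exp_minus divide_inverse mult.assoc)
qed

lemma flat_poly_has_derivative:
  "(flat_poly p has_real_derivative flat_poly (pCons 0 (pCons 0 (p - pderiv p))) x) (at x)"
proof -
  consider "x > 0" | "x < 0" | "x = 0" by linarith
  then show ?thesis
  proof cases
    case 1
    have "((\<lambda>x. poly p (1 / x) * exp (- (1 / x))) has_real_derivative
        flat_poly (pCons 0 (pCons 0 (p - pderiv p))) x) (at x)"
    proof -
      have inv: "((\<lambda>x. 1 / x) has_real_derivative - (1 / x ^ 2)) (at x)"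
        using 1 by (auto intro!: derivative_eq_intros simp: power2_eq_square)
      have "((\<lambda>x. poly p (1 / x)) has_real_derivative poly (pderiv p) (1 / x) * - (1 / x ^ 2)) (at x)"
        by (rule DERIV_chain2[OF poly_DERIV inv])
      moreover have "((\<lambda>x. exp (- (1 / x))) has_real_derivative exp (- (1 / x)) * - (- (1 / x ^ 2))) (at x)"
        by (rule DERIV_chain2[OF DERIV_exp DERIV_minus[OF inv]])
      ultimately have "((\<lambda>x. poly p (1 / x) * exp (- (1 / x))) has_real_derivative
          poly (pderiv p) (1 / x) * - (1 / x ^ 2) * exp (- (1 / x))
          + exp (- (1 / x)) * - (- (1 / x ^ 2)) * poly p (1 / x)) (at x)"
        by (rule DERIV_mult)
      moreover have "poly (pderiv p) (1 / x) * - (1 / x ^ 2) * exp (- (1 / x))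
          + exp (- (1 / x)) * - (- (1 / x ^ 2)) * poly p (1 / x)
          = flat_poly (pCons 0 (pCons 0 (p - pderiv p))) x"
        using 1 by (simp add: flat_poly_def power2_eq_square algebra_simps)
      ultimately show ?thesis by simp
    qed
    moreover have "\<forall>\<^sub>F y in nhds x. poly p (1 / y) * exp (- (1 / y)) = flat_poly p y"
      using eventually_nhds_in_open[of "{0<..}" x] 1 by (auto elim!: eventually_mono simp: flat_poly_def)
    ultimately show ?thesis by (subst (asm) DERIV_cong_ev[OF refl _ refl]) auto
  next
    case 2
    have "((\<lambda>x. 0) has_real_derivative flat_poly (pCons 0 (pCons 0 (p - pderiv p))) x) (at x)"
      using 2 by (simp add: flat_poly_def)
    moreover have "\<forall>\<^sub>F y in nhds x. 0 = flat_poly p y"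
      using eventually_nhds_in_open[of "{..<0}" x] 2 by (auto elim!: eventually_mono simp: flat_poly_def)
    ultimately show ?thesis by (subst (asm) DERIV_cong_ev[OF refl _ refl]) auto
  next
    case 3
    have "((\<lambda>y. flat_poly p y / y) \<longlongrightarrow> 0) (at_right 0)"
    proof -
      have "((\<lambda>y. poly (pCons 0 p) (inverse y) * exp (- (inverse y))) \<longlongrightarrow> 0) (at_right (0::real))"
        by (rule filterlim_compose[OF poly_mult_exp_neg_tendsto_0 filterlim_inverse_at_top_right])
      moreover have "\<forall>\<^sub>F y in at_right 0. poly (pCons 0 p) (inverse y) * exp (- (inverse y)) = flat_poly p y / y"
        using eventually_at_right_less[of "0::real"]
        by (auto elim!: eventually_mono simp: flat_poly_def divide_simps)
      ultimately show ?thesis by (rule Lim_transform_eventually)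
    qed
    moreover have "((\<lambda>y. flat_poly p y / y) \<longlongrightarrow> 0) (at_left 0)"
      by (rule Lim_transform_eventually[OF tendsto_const])
        (auto simp: eventually_at_filter flat_poly_def)
    ultimately have "((\<lambda>y. flat_poly p y / y) \<longlongrightarrow> 0) (at 0)"
      by (simp add: filterlim_split_at)
    then show ?thesis using 3 by (simp add: DERIV_def flat_poly_def)
  qed
qed

text \<open>
  If \<open>f n\<close> and \<open>g n\<close> are the \<open>n\<close>-th derivatives of two functions, this is the \<open>n\<close>-th derivative of their
  product. The recursion distributes one derivative at a time and makes binomial coefficients superfluous.
\<close>

primrec leibniz :: "nat \<Rightarrow> (nat \<Rightarrow> real \<Rightarrow> real) \<Rightarrow> (nat \<Rightarrow> real \<Rightarrow> real) \<Rightarrow> real \<Rightarrow> real" where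
  "leibniz 0 f g = (\<lambda>x. f 0 x * g 0 x)"
| "leibniz (Suc n) f g = (\<lambda>x. leibniz n (\<lambda>k. f (Suc k)) g x + leibniz n f (\<lambda>k. g (Suc k)) x)"

lemma leibniz_has_derivative:
  assumes "\<And>n x. (f n has_real_derivative f (Suc n) x) (at x)"
    and "\<And>n x. (g n has_real_derivative g (Suc n) x) (at x)"
  shows "(leibniz n f g has_real_derivative leibniz (Suc n) f g x) (at x)"
  using assms
proof (induction n arbitrary: f g)
  case 0
  show ?case using DERIV_mult[OF 0(1)[of 0 x] 0(2)[of 0 x]] by (simp add: algebra_simps)
next
  case (Suc n)
  show ?case
    using DERIV_add[OF Suc.IH[of "\<lambda>k. f (Suc k)" g] Suc.IH[of f "\<lambda>k. g (Suc k)"]] Suc.prems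
    by simp
qed

lemma leibniz_eq_0: "(\<forall>k. f k x = 0) \<or> (\<forall>k. g k x = 0) \<Longrightarrow> leibniz n f g x = 0"
proof (induction n arbitrary: f g)
  case (Suc n)
  show ?case
    using Suc.IH[of "\<lambda>k. f (Suc k)" g] Suc.IH[of f "\<lambda>k. g (Suc k)"] Suc.prems by auto
qed auto

text \<open>The whole sequence of derivatives is carried along, with \<open>D 0\<close> the bump itself.\<close>

definition smooth_bump :: "real \<Rightarrow> real \<Rightarrow> (nat \<Rightarrow> real \<Rightarrow> real) \<Rightarrow> bool" where
  "smooth_bump a b D \<longleftrightarrow> (\<forall>n x. (D n has_real_derivative D (Suc n) x) (at x)) \<and>
     (\<forall>n x. x \<notin> {a..b} \<longrightarrow> D n x = 0) \<and> (\<forall>x. D 0 x \<ge> 0) \<and> integral\<^sup>L lborel (D 0) = 1"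

lemma smooth_bump_exists:
  assumes "a < b"
  shows "\<exists>D. smooth_bump a b D"
proof -
  define ps :: "nat \<Rightarrow> real poly" where "ps n = ((\<lambda>p. pCons 0 (pCons 0 (p - pderiv p))) ^^ n) 1" for n
  define f where "f n x = flat_poly (ps n) (x - a)" for n x
  define g where "g n x = (-1) ^ n * flat_poly (ps n) (b - x)" for n x
  have df: "(f n has_real_derivative f (Suc n) x) (at x)" for n x
    unfolding f_def[abs_def]
    by (rule DERIV_shift[THEN iffD1, of "flat_poly (ps n)" "flat_poly (ps (Suc n)) (x - a)" x "- a", simplified])
      (use flat_poly_has_derivative[of "ps n" "x - a"] in \<open>simp add: ps_def\<close>)
  have dg: "(g n has_real_derivative g (Suc n) x) (at x)" for n x
  proof -
    have "((\<lambda>x. flat_poly (ps n) (b - x)) has_real_derivative flat_poly (ps (Suc n)) (b - x) * (- 1)) (at x)"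
      by (rule DERIV_chain2[where f="flat_poly (ps n)" and g="\<lambda>x. b - x"])
        (use flat_poly_has_derivative[of "ps n" "b - x"] in \<open>auto intro!: derivative_eq_intros simp: ps_def\<close>)
    from DERIV_cmult[OF this, of "(-1) ^ n"] show ?thesis by (simp add: g_def[abs_def])
  qed
  define E where "E n = leibniz n f g" for n
  have dE: "(E n has_real_derivative E (Suc n) x) (at x)" for n x
    unfolding E_def by (rule leibniz_has_derivative) (rule df dg)+
  have E0: "E n x = 0" if "x \<notin> {a..b}" for n x
    unfolding E_def by (rule leibniz_eq_0) (use that in \<open>auto simp: f_def g_def flat_poly_def\<close>)
  have E0eq: "E 0 x = (if a < x \<and> x < b then exp (- (1 / (x - a))) * exp (- (1 / (b - x))) else 0)" for x
    by (auto simp: E_def f_def g_def flat_poly_def ps_def)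
  have nonneg: "E 0 x \<ge> 0" for x by (simp add: E0eq)
  have contE: "continuous_on UNIV (E 0)"
    using dE by (intro continuous_at_imp_continuous_on ballI DERIV_isCont) blast
  have intE: "integrable lborel (E 0)"
  proof -
    have "set_integrable lborel {a..b} (E 0)"
      by (rule borel_integrable_atLeastAtMost') (rule continuous_on_subset[OF contE], simp)
    then show ?thesis unfolding set_integrable_def
      by (subst (asm) Bochner_Integration.integrable_cong[OF refl, of _ _ "E 0"]) (use E0 in \<open>auto simp: indicator_def\<close>)
  qed
  have "integral\<^sup>L lborel (E 0) \<noteq> 0"
  proof
    assume "integral\<^sup>L lborel (E 0) = 0"
    then have "AE x in lborel. E 0 x = 0"
      using integral_nonneg_eq_0_iff_AE[OF intE] nonneg by auto
    then have "AE x in lborel. x \<notin> {a<..<b}"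
      by eventually_elim (auto simp: E0eq split: if_splits)
    then have "{a<..<b} \<in> null_sets lborel"
      by (subst (asm) AE_iff_null_sets[symmetric]) simp_all
    then show False using assms by (simp add: null_sets_def)
  qed
  moreover have "integral\<^sup>L lborel (E 0) \<ge> 0" by (rule integral_nonneg_AE) (simp add: nonneg)
  ultimately have pos: "integral\<^sup>L lborel (E 0) > 0" by linarith
  define D where "D n x = E n x / integral\<^sup>L lborel (E 0)" for n x
  have "(D n has_real_derivative D (Suc n) x) (at x)" for n x
    unfolding D_def[abs_def] by (rule DERIV_cdivide[OF dE])
  moreover have "integral\<^sup>L lborel (D 0) = 1"
    unfolding D_def[abs_def] using pos by simp
  ultimately have "smooth_bump a b D"
    unfolding smooth_bump_def using pos nonneg E0 by (simp add: D_def)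
  then show ?thesis by blast
qed

lemma smooth_bump_D:
  assumes "smooth_bump a b D"
  shows "\<And>n x. (D n has_real_derivative D (Suc n) x) (at x)" "\<And>n x. x \<notin> {a..b} \<Longrightarrow> D n x = 0"
    "\<And>x. D 0 x \<ge> 0" "integral\<^sup>L lborel (D 0) = 1" "\<And>n. continuous_on UNIV (D n)"
proof -
  show *: "\<And>n x. (D n has_real_derivative D (Suc n) x) (at x)"
    using assms unfolding smooth_bump_def by blast
  show "\<And>n. continuous_on UNIV (D n)"
    using * by (intro continuous_at_imp_continuous_on ballI DERIV_isCont) blast
qed (use assms in \<open>auto simp: smooth_bump_def\<close>)

section \<open>Mollification of bounded functions\<close>

lemma integrable_bounded_support:
  fixes g :: "'a::euclidean_space \<Rightarrow> real"
  assumes "g \<in> borel_measurable borel" "\<And>p. \<bar>g p\<bar> \<le> K" "\<And>p. p \<notin> cbox a b \<Longrightarrow> g p = 0"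
  shows "integrable lborel g"
proof (rule Bochner_Integration.integrable_bound)
  show "integrable lborel (\<lambda>p. K * indicator (cbox a b) p :: real)"
    by (intro integrable_mult_right integrable_real_indicator) (auto simp: emeasure_lborel_cbox_eq)
  show "AE p in lborel. norm (g p) \<le> norm (K * indicator (cbox a b) p :: real)"
  proof (rule AE_I2)
    fix p show "norm (g p) \<le> norm (K * indicator (cbox a b) p :: real)"
      using assms(2)[of p] assms(3)[of p] by (cases "p \<in> cbox a b") auto
  qed
qed (use assms(1) in simp)

lemma integrable_tensor:
  fixes f :: "'a::euclidean_space \<Rightarrow> real" and g :: "'b::euclidean_space \<Rightarrow> real"
  assumes f: "integrable lborel f" and g: "integrable lborel g"
  shows "integrable (lborel \<Otimes>\<^sub>M lborel) (\<lambda>(x, y). f x * g y)"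
    and "(\<integral>(x, y). f x * g y \<partial>(lborel \<Otimes>\<^sub>M lborel)) = integral\<^sup>L lborel f * integral\<^sup>L lborel g"
proof -
  have [measurable]: "f \<in> borel_measurable borel" "g \<in> borel_measurable borel"
    using borel_measurable_integrable[OF f] borel_measurable_integrable[OF g] by simp_all
  show int: "integrable (lborel \<Otimes>\<^sub>M lborel) (\<lambda>(x, y). f x * g y)"
  proof (rule lborel_pair.Fubini_integrable)
    show "integrable lborel (\<lambda>x. \<integral>y. norm (case (x, y) of (x, y) \<Rightarrow> f x * g y) \<partial>lborel)"
      using integrable_abs[OF f] by (simp add: abs_mult)
    show "AE x in lborel. integrable lborel (\<lambda>y. case (x, y) of (x, y) \<Rightarrow> f x * g y)"
      using g by auto
  qed measurable
  show "(\<integral>(x, y). f x * g y \<partial>(lborel \<Otimes>\<^sub>M lborel)) = integral\<^sup>L lborel f * integral\<^sup>L lborel g"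
    using lborel_pair.integral_fst[OF int] by simp
qed

lemma lborel_integral_translate:
  fixes f :: "'a::euclidean_space \<Rightarrow> real"
  assumes "f \<in> borel_measurable borel"
  shows "(\<integral>p. f (p + z) \<partial>lborel) = integral\<^sup>L lborel f"
    and "integrable lborel (\<lambda>p. f (p + z)) \<longleftrightarrow> integrable lborel f"
proof -
  have "integral\<^sup>L lborel f = integral\<^sup>L (distr lborel borel ((+) z)) f"
    by (simp add: lborel_distr_plus)
  also have "\<dots> = (\<integral>p. f (z + p) \<partial>lborel)"
    by (rule integral_distr) (use assms in auto)
  finally show "(\<integral>p. f (p + z) \<partial>lborel) = integral\<^sup>L lborel f" by (simp add: add.commute)
  have "integrable lborel f \<longleftrightarrow> integrable (distr lborel borel ((+) z)) f"
    by (simp add: lborel_distr_plus)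
  also have "\<dots> \<longleftrightarrow> integrable lborel (\<lambda>p. f (z + p))"
    by (rule integrable_distr_eq) (use assms in auto)
  finally show "integrable lborel (\<lambda>p. f (p + z)) \<longleftrightarrow> integrable lborel f" by (simp add: add.commute)
qed

text \<open>
  The kernel is not reflected: the value at \<open>q\<close> averages \<open>f\<close> over \<open>q + supp k\<close>, so that a kernel supported
  in \<open>t > 0\<close> only looks forward in time and the initial time \<open>t = 0\<close> can be reached from inside the strip.
\<close>

definition mollify :: "(real \<times> real \<Rightarrow> real) \<Rightarrow> (real \<times> real \<Rightarrow> real) \<Rightarrow> real \<times> real \<Rightarrow> real" where
  "mollify k f q = (\<integral>p. f p * k (p - q) \<partial>lborel)"

lemma continuous_compact_support_bounded:
  fixes k :: "'a::euclidean_space \<Rightarrow> real"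
  assumes "continuous_on UNIV k" "\<And>z. z \<notin> cbox A B \<Longrightarrow> k z = 0"
  shows "\<exists>K>0. \<forall>z. \<bar>k z\<bar> \<le> K"
proof -
  have "bounded (k ` cbox A B)"
    by (intro compact_imp_bounded compact_continuous_image continuous_on_subset[OF assms(1)]) auto
  then obtain K where "K > 0" "\<forall>y\<in>k ` cbox A B. norm y \<le> K" unfolding bounded_pos by blast
  have "\<bar>k z\<bar> \<le> K" for z
    using assms(2)[of z] \<open>\<forall>y\<in>k ` cbox A B. norm y \<le> K\<close> \<open>K > 0\<close> by (cases "z \<in> cbox A B") auto
  then show ?thesis using \<open>K > 0\<close> by blast
qed

lemma gradient_bound_lipschitz:
  fixes k :: "real \<times> real \<Rightarrow> real"
  assumes "\<And>p. (k has_derivative (\<lambda>h. kt p * fst h + kx p * snd h)) (at p)"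
    and "\<And>p. \<bar>kt p\<bar> \<le> K" "\<And>p. \<bar>kx p\<bar> \<le> K" 
  shows "\<bar>k p - k q\<bar> \<le> 2 * K * norm (p - q)" and "\<bar>kt p * fst h + kx p * snd h\<bar> \<le> 2 * K * norm h"
proof -
  show *: "\<bar>kt p * fst h + kx p * snd h\<bar> \<le> 2 * K * norm h" for p h
  proof -
    have "\<bar>kt p * fst h + kx p * snd h\<bar> \<le> \<bar>kt p\<bar> * \<bar>fst h\<bar> + \<bar>kx p\<bar> * \<bar>snd h\<bar>"
      by (metis abs_mult abs_triangle_ineq)
    also have "\<dots> \<le> K * norm h + K * norm h"
      using norm_fst_le[of "fst h" "snd h"] norm_snd_le[of "snd h" "fst h"] assms(2,3)
      by (intro add_mono mult_mono) (auto intro: order_trans[OF abs_ge_zero])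
    finally show ?thesis by simp
  qed
  show "\<bar>k p - k q\<bar> \<le> 2 * K * norm (p - q)"
    using differentiable_bound[of UNIV k "\<lambda>p h. kt p * fst h + kx p * snd h" "2 * K" p q]
      assms(1) * by (simp add: onorm_le)
qed

text \<open>
  The difference quotients of the kernel are dominated by its Lipschitz constant times the indicator of a
  fixed box, and they converge pointwise; no regularity of \<open>f\<close> is involved.
\<close>

lemma mollify_has_derivative:
  assumes f: "f \<in> borel_measurable borel" "\<And>p. \<bar>f p\<bar> \<le> M"
    and dk: "\<And>p. (k has_derivative (\<lambda>h. kt p * fst h + kx p * snd h)) (at p)"
    and cont: "continuous_on UNIV kt" "continuous_on UNIV kx"
    and supp: "\<And>z. z \<notin> cbox A B \<Longrightarrow> k z = 0" "\<And>z. z \<notin> cbox A B \<Longrightarrow> kt z = 0" "\<And>z. z \<notin> cbox A B \<Longrightarrow> kx z = 0"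
  shows "(mollify k f has_derivative (\<lambda>h. - mollify kt f q * fst h - mollify kx f q * snd h)) (at q)"
proof -
  note [measurable] = f(1)
  have contk: "continuous_on UNIV k"
    using dk by (meson continuous_at_imp_continuous_on has_derivative_continuous)
  have [measurable]: "k \<in> borel_measurable borel" "kt \<in> borel_measurable borel" "kx \<in> borel_measurable borel"
    by (intro borel_measurable_continuous_onI contk cont)+
  obtain K1 where K1: "\<And>z. \<bar>kt z\<bar> \<le> K1" using continuous_compact_support_bounded[OF cont(1) supp(2)] by blast
  obtain K2 where K2: "\<And>z. \<bar>kx z\<bar> \<le> K2" using continuous_compact_support_bounded[OF cont(2) supp(3)] by blast
  obtain K3 where K3: "\<And>z. \<bar>k z\<bar> \<le> K3" using continuous_compact_support_bounded[OF contk supp(1)] by blast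
  define K where "K = max K1 (max K2 K3)"
  have K: "\<bar>kt z\<bar> \<le> K" "\<bar>kx z\<bar> \<le> K" "\<bar>k z\<bar> \<le> K" for z
    unfolding K_def using K1[of z] K2[of z] K3[of z] by linarith+
  have M0: "M \<ge> 0" using f(2)[of 0] by linarith
  have int: "integrable lborel (\<lambda>p. f p * g (p - c))"
    if "g \<in> borel_measurable borel" "\<And>z. \<bar>g z\<bar> \<le> K" "\<And>z. z \<notin> cbox A B \<Longrightarrow> g z = 0" for g :: "real \<times> real \<Rightarrow> real" and c
  proof (rule integrable_bounded_support)
    show "\<bar>f p * g (p - c)\<bar> \<le> M * K" for p
      unfolding abs_mult using f(2) that(2) M0 by (intro mult_mono) auto
    show "f p * g (p - c) = 0" if "p \<notin> cbox (A + c) (B + c)" for p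
    proof -
      have "p - c \<notin> cbox A B" using that by (auto simp: mem_box inner_diff_left inner_add_left algebra_simps)
      then show ?thesis using \<open>\<And>z. z \<notin> cbox A B \<Longrightarrow> g z = 0\<close> by simp
    qed
  qed (use that(1) in measurable)
  have intk: "integrable lborel (\<lambda>p. f p * k (p - c))" for c by (rule int) (use K supp in auto)
  have intt: "integrable lborel (\<lambda>p. f p * kt (p - c))" for c by (rule int) (use K supp in auto)
  have intx: "integrable lborel (\<lambda>p. f p * kx (p - c))" for c by (rule int) (use K supp in auto)
  define rem where "rem h p = (k (p - (q + h)) - k (p - q) + (kt (p - q) * fst h + kx (p - q) * snd h)) / norm h" for h p
  have eq: "(mollify k f (q + h) - mollify k f q - (- mollify kt f q * fst h - mollify kx f q * snd h)) / norm h
      = (\<integral>p. f p * rem h p \<partial>lborel)" for h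
  proof -
    have "(\<integral>p. f p * rem h p \<partial>lborel) = (\<integral>p. (f p * k (p - (q + h)) - f p * k (p - q)
        + (f p * kt (p - q) * fst h + f p * kx (p - q) * snd h)) / norm h \<partial>lborel)"
      by (intro Bochner_Integration.integral_cong refl) (simp add: rem_def field_simps)
    also have "\<dots> = (mollify k f (q + h) - mollify k f q - (- mollify kt f q * fst h - mollify kx f q * snd h)) / norm h"
      unfolding mollify_def using intk intt intx
      by (simp add: Bochner_Integration.integral_add Bochner_Integration.integral_diff)
    finally show ?thesis by simp
  qed
  have "((\<lambda>h. \<integral>p. f p * rem h p \<partial>lborel) \<longlongrightarrow> 0) (at 0)"
    unfolding tendsto_at_iff_sequentially
  proof (intro allI impI)
    fix X :: "nat \<Rightarrow> real \<times> real"
    assume X: "\<forall>i. X i \<in> UNIV - {0}" "X \<longlonglongrightarrow> 0"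
    obtain R where R: "\<And>i. norm (X i) \<le> R"
      using convergent_imp_Bseq[OF convergentI[OF X(2)]] unfolding Bseq_def by blast
    let ?C = "cbox (A + q - (R, R)) (B + q + (R, R))"
    have "(\<lambda>i. \<integral>p. f p * rem (X i) p \<partial>lborel) \<longlonglongrightarrow> (\<integral>p. 0 \<partial>(lborel :: (real \<times> real) measure))"
    proof (rule integral_dominated_convergence[where w="\<lambda>p. M * (4 * K) * indicator ?C p"])
      show "(\<lambda>p. f p * rem (X i) p) \<in> borel_measurable lborel" for i
        unfolding rem_def by measurable
      show "integrable lborel (\<lambda>p. M * (4 * K) * indicator ?C p :: real)"
        by (intro integrable_mult_right integrable_real_indicator) (auto simp: emeasure_lborel_cbox_eq)
      show "AE p in lborel. (\<lambda>i. f p * rem (X i) p) \<longlonglongrightarrow> 0"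
      proof (rule AE_I2)
        fix p
        have "((\<lambda>h. norm (k (p - q + h) - k (p - q) - (kt (p - q) * fst h + kx (p - q) * snd h)) / norm h) \<longlongrightarrow> 0) (at 0)"
          using dk[of "p - q"] by (simp add: has_derivative_at)
        from tendsto_at_iff_sequentially[THEN iffD1, OF this, rule_format, of "\<lambda>i. - X i"]
        have "(\<lambda>i. norm (k (p - q - X i) - k (p - q) - (kt (p - q) * - fst (X i) + kx (p - q) * - snd (X i))) / norm (X i)) \<longlonglongrightarrow> 0"
          using X tendsto_minus[OF X(2)] by (simp add: o_def)
        then have "(\<lambda>i. norm (rem (X i) p)) \<longlonglongrightarrow> 0"
          by (rule Lim_transform_eventually) (auto simp: rem_def algebra_simps)
        then have "(\<lambda>i. rem (X i) p) \<longlonglongrightarrow> 0" by (rule tendsto_norm_zero_cancel)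
        then show "(\<lambda>i. f p * rem (X i) p) \<longlonglongrightarrow> 0" by (rule tendsto_mult_right_zero)
      qed
      show "AE p in lborel. norm (f p * rem (X i) p) \<le> M * (4 * K) * indicator ?C p" for i
      proof (rule AE_I2)
        fix p
        have "\<bar>k (p - (q + X i)) - k (p - q)\<bar> \<le> 2 * K * norm (X i)"
          using gradient_bound_lipschitz(1)[OF dk K(1,2), of "p - (q + X i)" "p - q"] by simp
        moreover have "\<bar>kt (p - q) * fst (X i) + kx (p - q) * snd (X i)\<bar> \<le> 2 * K * norm (X i)"
          by (rule gradient_bound_lipschitz(2)[OF dk K(1,2)])
        ultimately have "\<bar>k (p - (q + X i)) - k (p - q) + (kt (p - q) * fst (X i) + kx (p - q) * snd (X i))\<bar> \<le> (4 * K) * norm (X i)"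
          by linarith
        then have r: "\<bar>rem (X i) p\<bar> \<le> 4 * K"
          using X(1)[rule_format, of i] by (simp add: rem_def divide_le_eq)
        show "norm (f p * rem (X i) p) \<le> M * (4 * K) * indicator ?C p"
        proof (cases "p \<in> ?C")
          case True
          then show ?thesis using r f(2)[of p] M0 by (auto simp: abs_mult intro!: mult_mono)
        next
          case False
          have "R \<ge> 0" using R[of 0] norm_ge_zero[of "X 0"] by linarith
          moreover have "\<bar>fst (X i)\<bar> \<le> R" "\<bar>snd (X i)\<bar> \<le> R"
            using R[of i] norm_fst_le[of "fst (X i)" "snd (X i)"] norm_snd_le[of "snd (X i)" "fst (X i)"] by auto
          ultimately have "p - (q + X i) \<notin> cbox A B" "p - q \<notin> cbox A B"
            using False
            by (auto simp: cbox_def Basis_prod_def inner_prod_def algebra_simps)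
          then show ?thesis using supp False by (simp add: rem_def)
        qed
      qed
    qed simp
    then show "((\<lambda>h. \<integral>p. f p * rem h p \<partial>lborel) \<circ> X) \<longlonglongrightarrow> 0" by (simp add: o_def)
  qed
  then have "((\<lambda>h. norm (\<integral>p. f p * rem h p \<partial>lborel)) \<longlongrightarrow> 0) (at 0)" by (rule tendsto_norm_zero)
  then have "((\<lambda>h. norm (mollify k f (q + h) - mollify k f q - (- mollify kt f q * fst h - mollify kx f q * snd h)) / norm h) \<longlongrightarrow> 0) (at 0)"
    unfolding eq[symmetric] by simp
  then show ?thesis
    unfolding has_derivative_at
    by (auto intro!: bounded_linear_sub bounded_linear_minus bounded_linear_mult_right[THEN bounded_linear_compose, unfolded o_def]
      bounded_linear_fst bounded_linear_snd bounded_linear_const_mult)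
qed

text \<open>
  An integrable weight comparable with its translates. It turns convergence in \<open>L\<^sup>1\<close> on every bounded set into
  a single statement on the plane, so that one subsequence converges almost everywhere.
\<close>

definition weight :: "real \<times> real \<Rightarrow> real" where
  "weight p = inverse (1 + (fst p)\<^sup>2) * inverse (1 + (snd p)\<^sup>2)"

lemma weight_pos: "weight p > 0"
  unfolding weight_def by (intro mult_pos_pos positive_imp_inverse_positive add_pos_nonneg) auto

lemma weight_measurable [measurable]: "weight \<in> borel_measurable borel"
  unfolding weight_def by (simp add: borel_prod[symmetric])

lemma integrable_weight: "integrable lborel weight"
proof -
  have *: "integrable lborel (\<lambda>x::real. inverse (1 + x\<^sup>2))"
    using integrable_inverse_1_plus_square by (simp add: set_integrable_def)
  show ?thesis
    using integrable_tensor(1)[OF * *] by (simp add: lborel_prod weight_def[abs_def] split_beta')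
qed

lemma weight_translate_le:
  assumes "norm z \<le> 1"
  shows "weight (p - z) \<le> 9 * weight p"
proof -
  have one: "inverse (1 + (x - y)\<^sup>2) \<le> 3 * inverse (1 + x\<^sup>2)" if "\<bar>y\<bar> \<le> 1" for x y :: real
  proof -
    have "y\<^sup>2 \<le> 1" using that by (simp add: abs_square_le_1)
    moreover have "x\<^sup>2 \<le> 2 * (x - y)\<^sup>2 + 2 * y\<^sup>2"
      using zero_le_power2[of "x - 2 * y"] by (simp add: power2_eq_square algebra_simps)
    ultimately have "1 + x\<^sup>2 \<le> 3 * (1 + (x - y)\<^sup>2)" by (smt (verit) zero_le_power2)
    moreover have "1 + x\<^sup>2 > 0" "1 + (x - y)\<^sup>2 > 0" by (simp_all add: add_pos_nonneg)
    ultimately show ?thesis by (simp add: divide_simps)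
  qed
  have "\<bar>fst z\<bar> \<le> 1" "\<bar>snd z\<bar> \<le> 1"
    using assms norm_fst_le[of "fst z" "snd z"] norm_snd_le[of "snd z" "fst z"] by auto
  then have "weight (p - z) \<le> (3 * inverse (1 + (fst p)\<^sup>2)) * (3 * inverse (1 + (snd p)\<^sup>2))"
    unfolding weight_def fst_diff snd_diff by (intro mult_mono one) auto
  then show ?thesis by (simp add: weight_def)
qed

lemma integrable_times_weight:
  assumes [measurable]: "f \<in> borel_measurable borel" and "\<And>p. \<bar>f p\<bar> \<le> M"
  shows "integrable lborel (\<lambda>p. f p * weight p)"
proof (rule Bochner_Integration.integrable_bound)
  show "integrable lborel (\<lambda>p. M * weight p)" using integrable_weight by simp
  show "AE p in lborel. norm (f p * weight p) \<le> norm (M * weight p)"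
  proof (rule AE_I2)
    fix p show "norm (f p * weight p) \<le> norm (M * weight p)"
      unfolding norm_mult using assms(2)[of p] by (intro mult_right_mono) auto
  qed
qed measurable

text \<open>
  Measurable functions are almost everywhere limits of continuous ones; truncation at the level \<open>M\<close> makes
  dominated convergence applicable.
\<close>

lemma bounded_approx_continuous:
  assumes f: "f \<in> borel_measurable borel" "\<And>p. \<bar>f p\<bar> \<le> M" and "e > 0"
  shows "\<exists>g :: real \<times> real \<Rightarrow> real. continuous_on UNIV g \<and> (\<forall>p. \<bar>g p\<bar> \<le> M) \<and>
           (\<integral>p. \<bar>f p - g p\<bar> * weight p \<partial>lborel) < e"
proof -
  have M0: "M \<ge> 0" using f(2)[of 0] by linarith
  have "f \<in> borel_measurable lebesgue" using f(1) by (simp add: measurable_completion)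
  then have "f measurable_on UNIV" by (rule lebesgue_measurable_imp_measurable_on_real) simp
  then obtain N g where N: "negligible N" and g: "\<And>n. continuous_on UNIV (g n)"
    and lim: "\<And>x. x \<notin> N \<Longrightarrow> (\<lambda>n. g n x) \<longlonglongrightarrow> f x"
    unfolding measurable_on_def by auto
  define h where "h n p = max (- M) (min M (g n p))" for n :: nat and p
  have h: "continuous_on UNIV (h n)" "\<bar>h n p\<bar> \<le> M" for n p
    unfolding h_def using M0 by (auto intro!: continuous_intros g)
  have [measurable]: "f \<in> borel_measurable borel" "h n \<in> borel_measurable borel" for n
    using f(1) h(1) by (auto intro: borel_measurable_continuous_onI)
  have "(\<lambda>n. \<integral>p. \<bar>f p - h n p\<bar> * weight p \<partial>lborel) \<longlonglongrightarrow> (\<integral>p. 0 \<partial>(lborel :: (real \<times> real) measure))"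
  proof (rule integral_dominated_convergence[where w="\<lambda>p. 2 * M * weight p"])
    show "integrable lborel (\<lambda>p. 2 * M * weight p)" using integrable_weight by simp
    have "AE p in lebesgue. p \<notin> N" 
      using N by (simp add: negligible_iff_null_sets AE_not_in)
    then have "AE p in lborel. p \<notin> N" by (simp add: AE_completion_iff)
    then show "AE p in lborel. (\<lambda>n. \<bar>f p - h n p\<bar> * weight p) \<longlonglongrightarrow> 0"
    proof eventually_elim
      case (elim p)
      have "(\<lambda>n. \<bar>f p - max (- M) (min M (g n p))\<bar> * weight p) \<longlonglongrightarrow> \<bar>f p - max (- M) (min M (f p))\<bar> * weight p"
        by (intro tendsto_intros lim elim)
      moreover have "max (- M) (min M (f p)) = f p" using f(2)[of p] by (auto simp: max_def min_def)
      ultimately show ?case by (simp add: h_def)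
    qed
    show "AE p in lborel. norm (\<bar>f p - h n p\<bar> * weight p) \<le> 2 * M * weight p" for n
    proof (rule AE_I2)
      fix p
      have "\<bar>f p - h n p\<bar> \<le> 2 * M" using f(2)[of p] h(2)[of n p] by linarith
      then show "norm (\<bar>f p - h n p\<bar> * weight p) \<le> 2 * M * weight p"
        using weight_pos[of p] by (simp add: abs_mult)
    qed
  qed auto
  then have "eventually (\<lambda>n. (\<integral>p. \<bar>f p - h n p\<bar> * weight p \<partial>lborel) < e) sequentially"
    using \<open>e > 0\<close> by (intro order_tendstoD) simp_all
  then obtain n where "(\<integral>p. \<bar>f p - h n p\<bar> * weight p \<partial>lborel) < e"
    by (auto simp: eventually_sequentially)
  then show ?thesis using h by blast
qed

text \<open>
  True for continuous bounded functions by dominated convergence, and stable under weighted \<open>L\<^sup>1\<close>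
  approximation because \<open>weight_translate_le\<close> bounds the cost of translating the approximation error.
\<close>

lemma translation_continuous_L1:
  assumes f: "f \<in> borel_measurable borel" "\<And>p. \<bar>f p\<bar> \<le> M"
  shows "((\<lambda>z. \<integral>q. \<bar>f (q + z) - f q\<bar> * weight q \<partial>lborel) \<longlongrightarrow> 0) (at 0)"
proof (rule tendstoI)
  fix e :: real assume e: "e > 0"
  obtain g where g: "continuous_on UNIV g" "\<And>p. \<bar>g p\<bar> \<le> M"
    and fg: "(\<integral>p. \<bar>f p - g p\<bar> * weight p \<partial>lborel) < e / 20"
    using bounded_approx_continuous[OF f, of "e / 20"] e by auto
  have [measurable]: "f \<in> borel_measurable borel" "g \<in> borel_measurable borel"
    using f(1) g(1) by (auto intro: borel_measurable_continuous_onI)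
  have bdint: "integrable lborel (\<lambda>p. \<bar>u p - v p\<bar> * weight p)"
    if [measurable]: "u \<in> borel_measurable borel" "v \<in> borel_measurable borel"
      and uv: "\<And>p. \<bar>u p\<bar> \<le> M" "\<And>p. \<bar>v p\<bar> \<le> M" for u v
  proof (rule integrable_times_weight[where M="2 * M"])
    show "\<bar>\<bar>u p - v p\<bar>\<bar> \<le> 2 * M" for p using uv(1)[of p] uv(2)[of p] by linarith
  qed measurable
  have "((\<lambda>z. \<integral>q. \<bar>g (q + z) - g q\<bar> * weight q \<partial>lborel) \<longlongrightarrow> 0) (at 0)"
    unfolding tendsto_at_iff_sequentially
  proof (intro allI impI)
    fix X :: "nat \<Rightarrow> real \<times> real"
    assume X: "\<forall>i. X i \<in> UNIV - {0}" "X \<longlonglongrightarrow> 0"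
    have "(\<lambda>i. \<integral>q. \<bar>g (q + X i) - g q\<bar> * weight q \<partial>lborel) \<longlonglongrightarrow> (\<integral>q. 0 \<partial>(lborel :: (real \<times> real) measure))"
    proof (rule integral_dominated_convergence[where w="\<lambda>p. 2 * M * weight p"])
      show "integrable lborel (\<lambda>p. 2 * M * weight p)" using integrable_weight by simp
      show "AE q in lborel. (\<lambda>i. \<bar>g (q + X i) - g q\<bar> * weight q) \<longlonglongrightarrow> 0"
      proof (rule AE_I2)
        fix q
        have "(\<lambda>i. q + X i) \<longlonglongrightarrow> q + 0" by (intro tendsto_intros X)
        then have "(\<lambda>i. g (q + X i)) \<longlonglongrightarrow> g q"
          using continuous_on_tendsto_compose[OF g(1), of "\<lambda>i. q + X i" q sequentially] by simp
        then have "(\<lambda>i. \<bar>g (q + X i) - g q\<bar> * weight q) \<longlonglongrightarrow> \<bar>g q - g q\<bar> * weight q" by (intro tendsto_intros)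
        then show "(\<lambda>i. \<bar>g (q + X i) - g q\<bar> * weight q) \<longlonglongrightarrow> 0" by simp
      qed
      show "AE q in lborel. norm (\<bar>g (q + X i) - g q\<bar> * weight q) \<le> 2 * M * weight q" for i
      proof (rule AE_I2)
        fix q
        have "\<bar>g (q + X i) - g q\<bar> \<le> 2 * M" using g(2)[of q] g(2)[of "q + X i"] by linarith
        then show "norm (\<bar>g (q + X i) - g q\<bar> * weight q) \<le> 2 * M * weight q"
          using weight_pos[of q] by (simp add: abs_mult)
      qed
    qed auto
    then show "((\<lambda>z. \<integral>q. \<bar>g (q + z) - g q\<bar> * weight q \<partial>lborel) \<circ> X) \<longlonglongrightarrow> 0" by (simp add: o_def)
  qed
  then have "\<forall>\<^sub>F z in at 0. (\<integral>q. \<bar>g (q + z) - g q\<bar> * weight q \<partial>lborel) < e / 2"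
    using e by (intro order_tendstoD(2)[where y="0::real"]) auto
  moreover have "\<forall>\<^sub>F z in at 0. norm (z :: real \<times> real) \<le> 1"
    unfolding eventually_at by (intro exI[of _ 1]) (auto simp: dist_norm)
  ultimately show "\<forall>\<^sub>F z in at 0. dist (\<integral>q. \<bar>f (q + z) - f q\<bar> * weight q \<partial>lborel) 0 < e"
  proof eventually_elim
    case (elim z)
    let ?d = "\<lambda>p. \<bar>f p - g p\<bar>"
    have dw: "integrable lborel (\<lambda>q. ?d q * weight q)" by (rule bdint) (use f g in auto)
    have le: "?d q * weight (q - z) \<le> 9 * (?d q * weight q)" for q
      using mult_left_mono[OF weight_translate_le[OF elim(2)], of "?d q" q] by simp
    have shift_int: "integrable lborel (\<lambda>q. ?d q * weight (q - z))"
    proof (rule Bochner_Integration.integrable_bound[where f="\<lambda>q. 9 * (?d q * weight q)"])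
      show "AE q in lborel. norm (?d q * weight (q - z)) \<le> norm (9 * (?d q * weight q))"
        by (rule AE_I2) (use le weight_pos in \<open>simp add: abs_mult less_imp_le\<close>)
    qed (use dw in auto)
    have "(\<integral>q. ?d (q + z) * weight q \<partial>lborel) = (\<integral>q. ?d q * weight (q - z) \<partial>lborel)"
      using lborel_integral_translate(1)[of "\<lambda>q. ?d q * weight (q - z)" z] by simp
    also have "\<dots> \<le> (\<integral>q. 9 * (?d q * weight q) \<partial>lborel)"
      by (rule integral_mono[OF shift_int _ le]) (use dw in simp)
    also have "\<dots> \<le> 9 * (e / 20)" using fg by simp
    finally have A: "(\<integral>q. ?d (q + z) * weight q \<partial>lborel) \<le> 9 * (e / 20)" .
    have i1: "integrable lborel (\<lambda>q. ?d (q + z) * weight q)" by (rule bdint) (use f g in auto)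
    have i2: "integrable lborel (\<lambda>q. \<bar>g (q + z) - g q\<bar> * weight q)" by (rule bdint) (use f g in auto)
    have "(\<integral>q. \<bar>f (q + z) - f q\<bar> * weight q \<partial>lborel)
        \<le> (\<integral>q. ?d (q + z) * weight q + (\<bar>g (q + z) - g q\<bar> * weight q + ?d q * weight q) \<partial>lborel)"
    proof (rule integral_mono)
      show "integrable lborel (\<lambda>q. \<bar>f (q + z) - f q\<bar> * weight q)"
        by (rule bdint) (use f in auto)
      show "integrable lborel (\<lambda>q. ?d (q + z) * weight q + (\<bar>g (q + z) - g q\<bar> * weight q + ?d q * weight q))"
        by (intro Bochner_Integration.integrable_add i1 i2 dw)
      show "\<bar>f (q + z) - f q\<bar> * weight q
          \<le> ?d (q + z) * weight q + (\<bar>g (q + z) - g q\<bar> * weight q + ?d q * weight q)" for q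
      proof -
        have "\<bar>f (q + z) - f q\<bar> \<le> ?d (q + z) + (\<bar>g (q + z) - g q\<bar> + ?d q)" by linarith
        from mult_right_mono[OF this, of "weight q"] weight_pos[of q] show ?thesis by (simp add: algebra_simps)
      qed
    qed
    also have "\<dots> = (\<integral>q. ?d (q + z) * weight q \<partial>lborel)
        + ((\<integral>q. \<bar>g (q + z) - g q\<bar> * weight q \<partial>lborel) + (\<integral>q. ?d q * weight q \<partial>lborel))"
      using i1 i2 dw by (simp add: Bochner_Integration.integral_add)
    also have "\<dots> < e" using A elim(1) fg by simp
    finally have "(\<integral>q. \<bar>f (q + z) - f q\<bar> * weight q \<partial>lborel) < e" .
    moreover have "(\<integral>q. \<bar>f (q + z) - f q\<bar> * weight q \<partial>lborel) \<ge> 0"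
      by (rule integral_nonneg_AE) (use weight_pos in \<open>auto intro!: AE_I2 simp: less_imp_le\<close>)
    ultimately show ?case by simp
  qed
qed

lemma mollify_translate:
  assumes [measurable]: "f \<in> borel_measurable borel" "k \<in> borel_measurable borel"
  shows "mollify k f q = (\<integral>z. f (q + z) * k z \<partial>lborel)"
  unfolding mollify_def
  using lborel_integral_translate(1)[of "\<lambda>p. f p * k (p - q)" q] by (simp add: add.commute)

lemma mollify_measurable:
  assumes [measurable]: "f \<in> borel_measurable borel" "k \<in> borel_measurable borel"
  shows "mollify k f \<in> borel_measurable borel"
  unfolding mollify_def[abs_def] by measurable

text \<open>
  By Fubini the weighted distance of \<open>f\<close> to its mollification is at most an average of weighted distances
  of \<open>f\<close> to its translates by vectors of length at most \<open>r n\<close>.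
\<close>

lemma mollify_converges_L1:
  assumes f: "f \<in> borel_measurable borel" "\<And>p. \<bar>f p\<bar> \<le> M"
    and k: "\<And>n. k n \<in> borel_measurable borel" "\<And>n. integrable lborel (k n)" "\<And>n z. k n z \<ge> 0"
      "\<And>n. integral\<^sup>L lborel (k n) = 1" "\<And>n z. k n z \<noteq> 0 \<Longrightarrow> norm z \<le> r n"
    and r: "r \<longlonglongrightarrow> 0"
  shows "(\<lambda>n. \<integral>q. \<bar>mollify (k n) f q - f q\<bar> * weight q \<partial>lborel) \<longlonglongrightarrow> 0"
    and "\<And>n. integrable lborel (\<lambda>q. \<bar>mollify (k n) f q - f q\<bar> * weight q)"
proof -
  note [measurable] = f(1) k(1) mollify_measurable[OF f(1) k(1)]
  have ik: "integrable lborel (\<lambda>z. u z * k n z)"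
    if [measurable]: "u \<in> borel_measurable borel" and "\<And>z. \<bar>u z\<bar> \<le> B" for u n B
  proof (rule Bochner_Integration.integrable_bound[where f="\<lambda>z. B * k n z"])
    show "AE z in lborel. norm (u z * k n z) \<le> norm (B * k n z)"
    proof (rule AE_I2)
      fix z show "norm (u z * k n z) \<le> norm (B * k n z)"
        unfolding norm_mult using that(2)[of z] by (intro mult_right_mono) auto
    qed
  qed (use k(2) in auto)
  let ?w = "\<lambda>z. \<integral>q. \<bar>f (q + z) - f q\<bar> * weight q \<partial>lborel"
  have f2: "\<bar>f p - f q\<bar> \<le> 2 * M" for p q using f(2)[of p] f(2)[of q] by linarith
  have diff: "mollify (k n) f q - f q = (\<integral>z. (f (q + z) - f q) * k n z \<partial>lborel)" for n q
  proof -
    have "(\<integral>z. (f (q + z) - f q) * k n z \<partial>lborel) = (\<integral>z. f (q + z) * k n z - f q * k n z \<partial>lborel)"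
      by (simp add: algebra_simps)
    also have "\<dots> = mollify (k n) f q - f q"
      using ik[of "\<lambda>z. f (q + z)" M n] f k(2,4)[of n]
      by (subst Bochner_Integration.integral_diff) (simp_all add: mollify_translate)
    finally show ?thesis by simp
  qed
  have prod: "integrable (lborel \<Otimes>\<^sub>M lborel) (\<lambda>(q, z). \<bar>f (q + z) - f q\<bar> * weight q * k n z)" for n
  proof (rule Bochner_Integration.integrable_bound[where f="\<lambda>(q, z). (2 * M * weight q) * k n z"])
    show "integrable (lborel \<Otimes>\<^sub>M lborel) (\<lambda>(q, z). (2 * M * weight q) * k n z)"
      by (rule integrable_tensor(1)) (use integrable_weight k(2) in auto)
    show "AE x in lborel \<Otimes>\<^sub>M lborel. norm (case x of (q, z) \<Rightarrow> \<bar>f (q + z) - f q\<bar> * weight q * k n z)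
        \<le> norm (case x of (q, z) \<Rightarrow> (2 * M * weight q) * k n z)"
    proof (rule AE_I2)
      fix x :: "(real \<times> real) \<times> real \<times> real"
      obtain q z where x: "x = (q, z)" by (cases x)
      have "norm (\<bar>f (q + z) - f q\<bar> * weight q * k n z) \<le> norm ((2 * M * weight q) * k n z)"
        unfolding norm_mult using f2[of "q + z" q] by (intro mult_right_mono) auto
      then show "norm (case x of (q, z) \<Rightarrow> \<bar>f (q + z) - f q\<bar> * weight q * k n z)
        \<le> norm (case x of (q, z) \<Rightarrow> (2 * M * weight q) * k n z)" by (simp add: x)
    qed
  qed measurable
  have pt: "\<bar>mollify (k n) f q - f q\<bar> * weight q \<le> (\<integral>z. \<bar>f (q + z) - f q\<bar> * weight q * k n z \<partial>lborel)" for n q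
  proof -
    have "\<bar>mollify (k n) f q - f q\<bar> \<le> (\<integral>z. norm ((f (q + z) - f q) * k n z) \<partial>lborel)"
      unfolding diff using integral_norm_bound[of lborel "\<lambda>z. (f (q + z) - f q) * k n z"] by simp
    also have "\<dots> = (\<integral>z. \<bar>f (q + z) - f q\<bar> * k n z \<partial>lborel)"
      using k(3) by (simp add: abs_mult)
    finally have "\<bar>mollify (k n) f q - f q\<bar> * weight q \<le> (\<integral>z. \<bar>f (q + z) - f q\<bar> * k n z \<partial>lborel) * weight q"
      using weight_pos[of q] by (intro mult_right_mono) auto
    also have "\<dots> = (\<integral>z. \<bar>f (q + z) - f q\<bar> * weight q * k n z \<partial>lborel)"
      by (subst integral_mult_left_zero[symmetric]) (simp add: mult_ac)
    finally show ?thesis .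
  qed
  show int: "integrable lborel (\<lambda>q. \<bar>mollify (k n) f q - f q\<bar> * weight q)" for n
  proof (rule Bochner_Integration.integrable_bound[OF lborel_pair.integrable_fst[OF prod[of n]]])
    show "AE q in lborel. norm (\<bar>mollify (k n) f q - f q\<bar> * weight q)
        \<le> norm (\<integral>z. \<bar>f (q + z) - f q\<bar> * weight q * k n z \<partial>lborel)"
    proof (rule AE_I2)
      fix q show "norm (\<bar>mollify (k n) f q - f q\<bar> * weight q)
          \<le> norm (\<integral>z. \<bar>f (q + z) - f q\<bar> * weight q * k n z \<partial>lborel)"
        using pt[of n q] weight_pos[of q] by (simp add: abs_mult)
    qed
  qed measurable
  show "(\<lambda>n. \<integral>q. \<bar>mollify (k n) f q - f q\<bar> * weight q \<partial>lborel) \<longlonglongrightarrow> 0"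
  proof (rule LIMSEQ_I)
    fix e :: real assume e: "e > 0"
    have "\<forall>\<^sub>F z in at 0. ?w z < e / 2"
      using translation_continuous_L1[OF f] e by (intro order_tendstoD(2)[where y="0::real"]) auto
    then obtain d where d: "d > 0" "\<And>z. z \<noteq> 0 \<Longrightarrow> norm z < d \<Longrightarrow> ?w z < e / 2"
      unfolding eventually_at by auto
    have d': "?w z \<le> e / 2" if "norm z < d" for z
      using d(2)[of z] that e by (cases "z = 0") auto
    from r d(1) obtain n0 where n0: "\<And>n. n \<ge> n0 \<Longrightarrow> \<bar>r n\<bar> < d"
      unfolding LIMSEQ_iff by fastforce
    have "norm ((\<integral>q. \<bar>mollify (k n) f q - f q\<bar> * weight q \<partial>lborel) - 0) < e" if "n \<ge> n0" for n
    proof -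
      have "(\<integral>q. \<bar>mollify (k n) f q - f q\<bar> * weight q \<partial>lborel)
          \<le> (\<integral>q. (\<integral>z. \<bar>f (q + z) - f q\<bar> * weight q * k n z \<partial>lborel) \<partial>lborel)"
        by (rule integral_mono[OF int lborel_pair.integrable_fst[OF prod] pt])
      also have "\<dots> = (\<integral>z. (\<integral>q. \<bar>f (q + z) - f q\<bar> * weight q * k n z \<partial>lborel) \<partial>lborel)"
        by (rule lborel_pair.Fubini_integral[OF prod, symmetric])
      also have "\<dots> = (\<integral>z. ?w z * k n z \<partial>lborel)" by simp
      also have "\<dots> \<le> (\<integral>z. e / 2 * k n z \<partial>lborel)"
      proof (rule integral_mono)
        show "integrable lborel (\<lambda>z. ?w z * k n z)"
          using lborel_pair.integrable_snd[OF prod[of n]] by simp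
        show "integrable lborel (\<lambda>z. e / 2 * k n z)" using k(2) by simp
        show "?w z * k n z \<le> e / 2 * k n z" for z
        proof (cases "k n z = 0")
          case False
          then have "norm z < d" using k(5)[of n z] n0[OF that] by linarith
          then show ?thesis using d' k(3) by (intro mult_right_mono) auto
        qed simp
      qed
      also have "\<dots> = e / 2" using k(4) by simp
      finally have "(\<integral>q. \<bar>mollify (k n) f q - f q\<bar> * weight q \<partial>lborel) \<le> e / 2" .
      moreover have "(\<integral>q. \<bar>mollify (k n) f q - f q\<bar> * weight q \<partial>lborel) \<ge> 0"
        by (rule integral_nonneg_AE) (use weight_pos in \<open>auto intro!: AE_I2 simp: less_imp_le\<close>)
      ultimately show ?thesis using e by simp
    qed
    then show "\<exists>n0. \<forall>n\<ge>n0. norm ((\<integral>q. \<bar>mollify (k n) f q - f q\<bar> * weight q \<partial>lborel) - 0) < e" by blast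
  qed
qed

section \<open>Potentials of closed one-forms\<close>

text \<open>
  The Poincare lemma on a convex set: integrate the form along the segment from the origin. The derivative
  of the integrand in \<open>p\<close> turns, by closedness, into the derivative in \<open>s\<close> of \<open>s P(s p)\<close> and \<open>s Q(s p)\<close>.
\<close>

lemma closed_form_potential:
  fixes P Q :: "real \<times> real \<Rightarrow> real"
  assumes U: "open U" "convex U" "0 \<in> U"
    and dP: "\<And>p. (P has_derivative (\<lambda>h. Pt p * fst h + Px p * snd h)) (at p)"
    and dQ: "\<And>p. (Q has_derivative (\<lambda>h. Qt p * fst h + Qx p * snd h)) (at p)"
    and cont: "continuous_on UNIV Pt" "continuous_on UNIV Px" "continuous_on UNIV Qt" "continuous_on UNIV Qx"
    and closed: "\<And>p. p \<in> U \<Longrightarrow> Px p = Qt p"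
  shows "\<exists>H. H 0 = 0 \<and> (\<forall>p\<in>U. (H has_derivative (\<lambda>h. P p * fst h + Q p * snd h)) (at p))"
proof -
  define f where "f p s = fst p * P (s *\<^sub>R p) + snd p * Q (s *\<^sub>R p)" for p and s :: real
  define A where "A p s = P (s *\<^sub>R p) + s * (fst p * Pt (s *\<^sub>R p) + snd p * Qt (s *\<^sub>R p))" for p and s :: real
  define B where "B p s = Q (s *\<^sub>R p) + s * (fst p * Px (s *\<^sub>R p) + snd p * Qx (s *\<^sub>R p))" for p and s :: real
  define E1 :: "(real \<times> real) \<Rightarrow>\<^sub>L real" where "E1 = Blinfun fst"
  define E2 :: "(real \<times> real) \<Rightarrow>\<^sub>L real" where "E2 = Blinfun snd"
  define H where "H p = integral (cbox 0 1) (f p)" for p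
  have E: "blinfun_apply E1 = fst" "blinfun_apply E2 = snd"
    unfolding E1_def E2_def by (simp_all add: bounded_linear_Blinfun_apply bounded_linear_fst bounded_linear_snd)
  have contP: "continuous_on UNIV P" and contQ: "continuous_on UNIV Q"
    using dP dQ by (meson continuous_at_imp_continuous_on has_derivative_continuous)+
  have co: "continuous_on S (\<lambda>z. g (u z))" if "continuous_on UNIV g" "continuous_on S u"
    for g :: "real \<times> real \<Rightarrow> real" and u :: "'c::topological_space \<Rightarrow> real \<times> real" and S
    using continuous_on_compose2[OF that(1,2)] by simp
  note cos = co[OF contP] co[OF contQ] co[OF cont(1)] co[OF cont(2)] co[OF cont(3)] co[OF cont(4)]
  have df: "((\<lambda>p. f p s) has_derivative blinfun_apply (A p s *\<^sub>R E1 + B p s *\<^sub>R E2)) (at p within U)" for p s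
  proof -
    have s: "((\<lambda>p. s *\<^sub>R p) has_derivative (\<lambda>h. s *\<^sub>R h)) (at p)"
      by (auto intro!: derivative_eq_intros)
    have "((\<lambda>p. P (s *\<^sub>R p)) has_derivative (\<lambda>h. Pt (s *\<^sub>R p) * fst (s *\<^sub>R h) + Px (s *\<^sub>R p) * snd (s *\<^sub>R h))) (at p)"
      using diff_chain_at[OF s dP[of "s *\<^sub>R p"]] by (simp add: o_def)
    moreover have "((\<lambda>p. Q (s *\<^sub>R p)) has_derivative (\<lambda>h. Qt (s *\<^sub>R p) * fst (s *\<^sub>R h) + Qx (s *\<^sub>R p) * snd (s *\<^sub>R h))) (at p)"
      using diff_chain_at[OF s dQ[of "s *\<^sub>R p"]] by (simp add: o_def)
    moreover have "(fst has_derivative fst) (at p)" "(snd has_derivative snd) (at p)"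
      by (auto intro!: derivative_eq_intros)
    ultimately have "((\<lambda>p. f p s) has_derivative (\<lambda>h.
        fst p * (Pt (s *\<^sub>R p) * fst (s *\<^sub>R h) + Px (s *\<^sub>R p) * snd (s *\<^sub>R h)) + fst h * P (s *\<^sub>R p)
        + (snd p * (Qt (s *\<^sub>R p) * fst (s *\<^sub>R h) + Qx (s *\<^sub>R p) * snd (s *\<^sub>R h)) + snd h * Q (s *\<^sub>R p)))) (at p)"
      unfolding f_def by (intro has_derivative_add has_derivative_mult)
    also have "(\<lambda>h. fst p * (Pt (s *\<^sub>R p) * fst (s *\<^sub>R h) + Px (s *\<^sub>R p) * snd (s *\<^sub>R h)) + fst h * P (s *\<^sub>R p)
        + (snd p * (Qt (s *\<^sub>R p) * fst (s *\<^sub>R h) + Qx (s *\<^sub>R p) * snd (s *\<^sub>R h)) + snd h * Q (s *\<^sub>R p)))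
        = blinfun_apply (A p s *\<^sub>R E1 + B p s *\<^sub>R E2)"
      by (rule ext) (simp add: A_def B_def E blinfun.bilinear_simps algebra_simps)
    finally show ?thesis by (rule has_derivative_at_withinI)
  qed
  have cA: "continuous_on S (\<lambda>z. A (fst z) (snd z))" and cB: "continuous_on S (\<lambda>z. B (fst z) (snd z))" for S
    unfolding A_def B_def by (intro continuous_intros cos)+
  have cA1: "continuous_on {0..1} (A p)" and cB1: "continuous_on {0..1} (B p)" for p
    unfolding A_def B_def by (intro continuous_intros cos)+
  have dH: "(H has_derivative (\<lambda>h. P p * fst h + Q p * snd h)) (at p)" if p: "p \<in> U" for p
  proof -
    have "((\<lambda>p. integral (cbox 0 1) (f p)) has_derivative
        blinfun_apply (integral (cbox 0 1) (\<lambda>s. A p s *\<^sub>R E1 + B p s *\<^sub>R E2))) (at p within U)"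
    proof (rule leibniz_rule[OF _ _ _ p U(2)])
      show "((\<lambda>p. f p s) has_derivative blinfun_apply (A p s *\<^sub>R E1 + B p s *\<^sub>R E2)) (at p within U)" for p s by (rule df)
      show "f p integrable_on cbox 0 1" for p
        unfolding f_def by (intro integrable_continuous continuous_intros cos)
      show "continuous_on (U \<times> cbox 0 1) (\<lambda>(p, s). A p s *\<^sub>R E1 + B p s *\<^sub>R E2)"
        unfolding split_beta by (intro continuous_intros cA cB)
    qed
    moreover have "integral (cbox 0 1) (\<lambda>s. A p s *\<^sub>R E1 + B p s *\<^sub>R E2) = P p *\<^sub>R E1 + Q p *\<^sub>R E2"
    proof -
      have sp: "s *\<^sub>R p \<in> U" if "s \<in> {0..1}" for s
        using convexD_alt[OF U(2) U(3) p, of s] that by simp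
      have dsp: "((\<lambda>s. s *\<^sub>R p) has_derivative (\<lambda>h. h *\<^sub>R p)) (at s within {0..1})" for s :: real
        by (auto intro!: derivative_eq_intros)
      have dPs: "((\<lambda>s. P (s *\<^sub>R p)) has_real_derivative Pt (s *\<^sub>R p) * fst p + Px (s *\<^sub>R p) * snd p) (at s within {0..1})" for s
        using diff_chain_within[OF dsp has_derivative_at_withinI[OF dP[of "s *\<^sub>R p"]]]
        unfolding o_def has_field_derivative_def
        by (rule has_derivative_eq_rhs) (simp add: fun_eq_iff algebra_simps)
      have dQs: "((\<lambda>s. Q (s *\<^sub>R p)) has_real_derivative Qt (s *\<^sub>R p) * fst p + Qx (s *\<^sub>R p) * snd p) (at s within {0..1})" for s
        using diff_chain_within[OF dsp has_derivative_at_withinI[OF dQ[of "s *\<^sub>R p"]]]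
        unfolding o_def has_field_derivative_def
        by (rule has_derivative_eq_rhs) (simp add: fun_eq_iff algebra_simps)
      have "(A p has_integral (1 * P (1 *\<^sub>R p) - 0 * P (0 *\<^sub>R p))) {0..1}"
      proof (rule fundamental_theorem_of_calculus)
        fix s :: real assume s: "s \<in> {0..1}"
        have "((\<lambda>s. s * P (s *\<^sub>R p)) has_real_derivative A p s) (at s within {0..1})"
          using DERIV_mult[OF DERIV_ident dPs, of s] closed[OF sp[OF s]]
          by (simp add: A_def algebra_simps)
        then show "((\<lambda>s. s * P (s *\<^sub>R p)) has_vector_derivative A p s) (at s within {0..1})"
          by (simp add: has_real_derivative_iff_has_vector_derivative)
      qed simp
      then have a: "integral (cbox 0 1) (A p) = P p" by (simp add: integral_unique)
      have "(B p has_integral (1 * Q (1 *\<^sub>R p) - 0 * Q (0 *\<^sub>R p))) {0..1}"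
      proof (rule fundamental_theorem_of_calculus)
        fix s :: real assume s: "s \<in> {0..1}"
        have "((\<lambda>s. s * Q (s *\<^sub>R p)) has_real_derivative B p s) (at s within {0..1})"
          using DERIV_mult[OF DERIV_ident dQs, of s] closed[OF sp[OF s]]
          by (simp add: B_def algebra_simps)
        then show "((\<lambda>s. s * Q (s *\<^sub>R p)) has_vector_derivative B p s) (at s within {0..1})"
          by (simp add: has_real_derivative_iff_has_vector_derivative)
      qed simp
      then have b: "integral (cbox 0 1) (B p) = Q p" by (simp add: integral_unique)
      have iA: "(\<lambda>s. A p s *\<^sub>R E1) integrable_on cbox 0 1" and iB: "(\<lambda>s. B p s *\<^sub>R E2) integrable_on cbox 0 1"
        using cA1 cB1 by (intro integrable_continuous continuous_intros; simp)+
      have "integral (cbox 0 1) (\<lambda>s. A p s *\<^sub>R E1) = integral (cbox 0 1) (A p) *\<^sub>R E1"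
        using integral_linear[OF integrable_continuous bounded_linear_scaleR_left[of E1], of 0 1 "A p"] cA1
        by (simp add: o_def)
      moreover have "integral (cbox 0 1) (\<lambda>s. B p s *\<^sub>R E2) = integral (cbox 0 1) (B p) *\<^sub>R E2"
        using integral_linear[OF integrable_continuous bounded_linear_scaleR_left[of E2], of 0 1 "B p"] cB1
        by (simp add: o_def)
      ultimately show ?thesis using a b Henstock_Kurzweil_Integration.integral_add[OF iA iB] by simp
    qed
    ultimately have "(H has_derivative blinfun_apply (P p *\<^sub>R E1 + Q p *\<^sub>R E2)) (at p within U)"
      unfolding H_def[abs_def] by simp
    then show ?thesis
      unfolding at_within_open[OF p U(1)] by (rule has_derivative_eq_rhs) (simp add: E blinfun.bilinear_simps fun_eq_iff)
  qed
  moreover have "H 0 = 0" by (simp add: H_def f_def[abs_def])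
  ultimately show ?thesis by blast
qed

section \<open>Regularised densities and their potentials\<close>

definition tensor :: "(real \<Rightarrow> real) \<Rightarrow> (real \<Rightarrow> real) \<Rightarrow> real \<times> real \<Rightarrow> real" where
  "tensor f g p = f (fst p) * g (snd p)"

lemma tensor_has_derivative:
  assumes "(f has_real_derivative f') (at (fst p))" "(g has_real_derivative g') (at (snd p))"
  shows "(tensor f g has_derivative (\<lambda>h. (f' * g (snd p)) * fst h + (f (fst p) * g') * snd h)) (at p)"
proof -
  have "((\<lambda>p. f (fst p)) has_derivative (\<lambda>h. f' * fst h)) (at p)"
    using diff_chain_at[of fst fst p f "(*) f'"] assms(1)
    by (simp add: o_def has_field_derivative_def has_derivative_fst)
  moreover have "((\<lambda>p. g (snd p)) has_derivative (\<lambda>h. g' * snd h)) (at p)"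
    using diff_chain_at[of snd snd p g "(*) g'"] assms(2)
    by (simp add: o_def has_field_derivative_def has_derivative_snd)
  ultimately have "((\<lambda>p. f (fst p) * g (snd p)) has_derivative
      (\<lambda>h. f (fst p) * (g' * snd h) + (f' * fst h) * g (snd p))) (at p)"
    by (rule has_derivative_mult)
  then show ?thesis
    unfolding tensor_def[abs_def] by (rule has_derivative_eq_rhs) (simp add: fun_eq_iff algebra_simps)
qed

lemma tensor_continuous:
  assumes "continuous_on UNIV f" "continuous_on UNIV g"
  shows "continuous_on UNIV (tensor f g)"
proof -
  have "continuous_on UNIV (\<lambda>p::real \<times> real. f (fst p))"
    by (rule continuous_on_compose2[OF assms(1)]) (auto intro: continuous_intros)
  moreover have "continuous_on UNIV (\<lambda>p::real \<times> real. g (snd p))"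
    by (rule continuous_on_compose2[OF assms(2)]) (auto intro: continuous_intros)
  ultimately show ?thesis unfolding tensor_def[abs_def] by (rule continuous_on_mult)
qed

lemma tensor_support:
  assumes "\<And>x. x \<notin> {a..b} \<Longrightarrow> f x = 0" "\<And>x. x \<notin> {a..b} \<Longrightarrow> g x = 0" "z \<notin> cbox (a, a) (b, b)"
  shows "tensor f g z = 0"
  using assms by (cases z) (auto simp: tensor_def cbox_Pair_eq)

text \<open>A mollification is an average, so it inherits pointwise bounds.\<close>

lemma mollify_bounds:
  assumes f: "f \<in> borel_measurable borel" "\<And>p. lo \<le> f p" "\<And>p. f p \<le> hi"
    and k: "k \<in> borel_measurable borel" "integrable lborel k" "\<And>z. k z \<ge> 0" "integral\<^sup>L lborel k = 1"
  shows "lo \<le> mollify k f q" "mollify k f q \<le> hi"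
proof -
  note [measurable] = f(1) k(1)
  have int: "integrable lborel (\<lambda>z. f (q + z) * k z)"
  proof (rule Bochner_Integration.integrable_bound[where f="\<lambda>z. max \<bar>lo\<bar> \<bar>hi\<bar> * k z"])
    show "AE z in lborel. norm (f (q + z) * k z) \<le> norm (max \<bar>lo\<bar> \<bar>hi\<bar> * k z)"
    proof (rule AE_I2)
      fix z
      have "\<bar>f (q + z)\<bar> \<le> max \<bar>lo\<bar> \<bar>hi\<bar>" using f(2)[of "q + z"] f(3)[of "q + z"] by linarith
      then show "norm (f (q + z) * k z) \<le> norm (max \<bar>lo\<bar> \<bar>hi\<bar> * k z)"
        unfolding norm_mult by (intro mult_right_mono) auto
    qed
  qed (use k(2) in auto)
  have "(\<integral>z. lo * k z \<partial>lborel) \<le> (\<integral>z. f (q + z) * k z \<partial>lborel)"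
    by (rule integral_mono[OF _ int mult_right_mono[OF f(2) k(3)]]) (use k in auto)
  then show "lo \<le> mollify k f q" using k(4) by (simp add: mollify_translate)
  have "(\<integral>z. f (q + z) * k z \<partial>lborel) \<le> (\<integral>z. hi * k z \<partial>lborel)"
    by (rule integral_mono[OF int _ mult_right_mono[OF f(3) k(3)]]) (use k in auto)
  then show "mollify k f q \<le> hi" using k(4) by (simp add: mollify_translate)
qed

text \<open>
  \<open>R n\<close> and \<open>Jn n\<close> stand for regularisations of \<open>\<rho>\<close> and \<open>J\<close>, with partial derivatives \<open>Rt n\<close>, \<open>Rx n\<close>, \<open>Jt n\<close>
  and \<open>Jx n\<close>, and \<open>Hn n\<close> for the potential of \<open>R n dx - Jn n dt\<close>. They are divergence-free only on the
  open slab \<open>- e n < t < T - 2 * e n\<close>, where the kernel sees nothing outside the strip; this slab contains the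
  initial time and exhausts \<open>[0, T)\<close>.
\<close>

locale smooth_potentials =
  fixes T c C L :: real and \<rho> J :: "real \<times> real \<Rightarrow> real" and e :: "nat \<Rightarrow> real"
    and R Jn Rt Rx Jt Jx Hn :: "nat \<Rightarrow> real \<times> real \<Rightarrow> real"
  assumes T: "T > 0" and c: "0 < c" "c \<le> C" and L: "L \<ge> 0"
    and \<rho>_meas [measurable]: "\<rho> \<in> borel_measurable borel"
    and J_meas [measurable]: "J \<in> borel_measurable borel"
    and \<rho>_bounds: "\<And>p. c \<le> \<rho> p" "\<And>p. \<rho> p \<le> C" and J_bound: "\<And>p. \<bar>J p\<bar> \<le> L"
    and e: "\<And>n. e n > 0" "\<And>n. 2 * e n < T" "e \<longlonglongrightarrow> 0"
    and R_bounds: "\<And>n p. c \<le> R n p" "\<And>n p. R n p \<le> C" and Jn_bound: "\<And>n p. \<bar>Jn n p\<bar> \<le> L"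
    and dR: "\<And>n p. (R n has_derivative (\<lambda>h. Rt n p * fst h + Rx n p * snd h)) (at p)"
    and dJ: "\<And>n p. (Jn n has_derivative (\<lambda>h. Jt n p * fst h + Jx n p * snd h)) (at p)"
    and cont_deriv: "\<And>n. continuous_on UNIV (Rt n)" "\<And>n. continuous_on UNIV (Rx n)"
      "\<And>n. continuous_on UNIV (Jt n)" "\<And>n. continuous_on UNIV (Jx n)"
    and div_free: "\<And>n p. - e n < fst p \<Longrightarrow> fst p < T - 2 * e n \<Longrightarrow> Rt n p + Jx n p = 0"
    and AE_conv: "AE p in lborel. (\<lambda>n. R n p) \<longlonglongrightarrow> \<rho> p \<and> (\<lambda>n. Jn n p) \<longlonglongrightarrow> J p"
    and Hn_0: "\<And>n. Hn n 0 = 0"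
    and dHn: "\<And>n p. - e n < fst p \<Longrightarrow> fst p < T - 2 * e n \<Longrightarrow>
        (Hn n has_derivative (\<lambda>h. - Jn n p * fst h + R n p * snd h)) (at p)"
begin

lemma Hn_dx:
  assumes "- e n < t" "t < T - 2 * e n"
  shows "((\<lambda>x. Hn n (t, x)) has_real_derivative R n (t, x)) (at x)"
proof -
  have 1: "((\<lambda>x. (t, x)) has_derivative (\<lambda>h. (0, h))) (at x)"
    by (auto intro!: derivative_eq_intros)
  show ?thesis
    using diff_chain_at[OF 1 dHn[of n "(t, x)"]] assms
    by (simp add: o_def has_field_derivative_def)
qed

lemma Hn_dt:
  assumes "- e n < t" "t < T - 2 * e n"
  shows "((\<lambda>t. Hn n (t, x)) has_real_derivative - Jn n (t, x)) (at t)"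
proof -
  have 1: "((\<lambda>t. (t, x)) has_derivative (\<lambda>h. (h, 0))) (at t)"
    by (auto intro!: derivative_eq_intros)
  have "((\<lambda>t. Hn n (t, x)) has_derivative (\<lambda>h. - Jn n (t, x) * h)) (at t)"
    using diff_chain_at[OF 1 dHn[of n "(t, x)"]] assms by (simp add: o_def)
  then show ?thesis unfolding has_field_derivative_def .
qed

lemma Hn_x_bounds:
  assumes "- e n < t" "t < T - 2 * e n" "x \<le> y"
  shows "c * (y - x) \<le> Hn n (t, y) - Hn n (t, x)" "Hn n (t, y) - Hn n (t, x) \<le> C * (y - x)"
proof -
  have "\<exists>z. Hn n (t, y) - Hn n (t, x) = (y - x) * R n (t, z)"
  proof (cases "x = y")
    case False
    then show ?thesis
      using MVT2[of x y "\<lambda>x. Hn n (t, x)" "\<lambda>x. R n (t, x)"] Hn_dx assms by auto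
  qed simp
  then obtain z where z: "Hn n (t, y) - Hn n (t, x) = (y - x) * R n (t, z)" by blast
  show "c * (y - x) \<le> Hn n (t, y) - Hn n (t, x)" "Hn n (t, y) - Hn n (t, x) \<le> C * (y - x)"
    unfolding z using R_bounds[of n "(t, z)"] assms(3)
    by (auto simp: mult.commute[of _ "y - x"] intro!: mult_left_mono)
qed

lemma Hn_t_lipschitz:
  assumes "- e n < t" "t < T - 2 * e n" "- e n < s" "s < T - 2 * e n"
  shows "\<bar>Hn n (t, x) - Hn n (s, x)\<bar> \<le> L * \<bar>t - s\<bar>"
  using assms
proof (induction t s rule: linorder_wlog)
  case (le t s)
  have "\<exists>z. Hn n (s, x) - Hn n (t, x) = (s - t) * - Jn n (z, x)"
  proof (cases "t = s")
    case False
    then show ?thesis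
      using MVT2[of t s "\<lambda>t. Hn n (t, x)" "\<lambda>t. - Jn n (t, x)"] Hn_dt[of n _ x] le by auto
  qed simp
  then obtain z where z: "Hn n (s, x) - Hn n (t, x) = (s - t) * - Jn n (z, x)" by blast
  have "\<bar>Hn n (t, x) - Hn n (s, x)\<bar> = \<bar>(s - t) * - Jn n (z, x)\<bar>" using z by linarith
  also have "\<dots> \<le> \<bar>s - t\<bar> * L" unfolding abs_mult using Jn_bound by (intro mult_left_mono) auto
  finally show ?case by (simp add: mult.commute abs_minus_commute)
qed (simp add: abs_minus_commute)

lemma Hn_lipschitz:
  assumes "- e n < t" "t < T - 2 * e n" "- e n < s" "s < T - 2 * e n"
  shows "\<bar>Hn n (t, x) - Hn n (s, y)\<bar> \<le> L * \<bar>t - s\<bar> + C * \<bar>x - y\<bar>"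
proof -
  have "\<bar>Hn n (s, x) - Hn n (s, y)\<bar> \<le> C * \<bar>x - y\<bar>"
  proof (cases "x \<le> y")
    case True
    have "0 \<le> c * (y - x)" using True c by simp
    then show ?thesis using Hn_x_bounds[of n s x y] assms True by simp
  next
    case False
    have "0 \<le> c * (x - y)" using False c by simp
    then show ?thesis using Hn_x_bounds[of n s y x] assms False by simp
  qed
  then show ?thesis using Hn_t_lipschitz[OF assms, of x] by linarith
qed

lemma Hn_abs_le:
  assumes "- e n < t" "t < T - 2 * e n"
  shows "\<bar>Hn n (t, x)\<bar> \<le> L * \<bar>t\<bar> + C * \<bar>x\<bar>"
  using Hn_lipschitz[of n t 0 x 0] assms e(1,2)[of n] Hn_0[of n] by (simp add: zero_prod_def)

lemma eventually_slab:
  assumes "0 \<le> t" "t < T"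
  shows "\<forall>\<^sub>F n in sequentially. - e n < t \<and> t < T - 2 * e n"
proof -
  have "\<forall>\<^sub>F n in sequentially. e n < (T - t) / 2"
    using e(3) assms by (intro order_tendstoD(2)[where y="0::real"]) auto
  then show ?thesis
    by eventually_elim (use assms e(1) in \<open>auto intro: less_le_trans[of _ 0]\<close>)
qed

text \<open>The potentials share their Lipschitz constants, so convergence on a dense set suffices.\<close>

lemma convergent_if_on_rationals:
  assumes rat: "\<And>s y. s \<in> \<rat> \<Longrightarrow> y \<in> \<rat> \<Longrightarrow> 0 \<le> s \<Longrightarrow> s < T \<Longrightarrow> convergent (\<lambda>n. Hn n (s, y))"
    and t: "0 \<le> t" "t < T"
  shows "convergent (\<lambda>n. Hn n (t, x))"
proof -
  have "Cauchy (\<lambda>n. Hn n (t, x))"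
  proof (rule metric_CauchyI)
    fix \<epsilon> :: real assume \<epsilon>: "\<epsilon> > 0"
    define d where "d = \<epsilon> / (6 * (L + 1))"
    define d' where "d' = \<epsilon> / (6 * (C + 1))"
    have d: "d > 0" "d' > 0" using \<epsilon> L c by (auto simp: d_def d'_def)
    obtain s where s: "s \<in> \<rat>" "t < s" "s < min T (t + d)"
      using Rats_dense_in_real[of t "min T (t + d)"] t d by auto
    obtain y where y: "y \<in> \<rat>" "x < y" "y < x + d'"
      using Rats_dense_in_real[of x "x + d'"] d by auto
    have "L * \<bar>t - s\<bar> \<le> (L + 1) * d" "C * \<bar>x - y\<bar> \<le> (C + 1) * d'"
      using s y L c d by (auto intro!: mult_mono)
    moreover have "(L + 1) * d = \<epsilon> / 6" "(C + 1) * d' = \<epsilon> / 6"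
      using L c by (simp_all add: d_def d'_def field_simps)
    ultimately have close: "L * \<bar>t - s\<bar> + C * \<bar>x - y\<bar> \<le> \<epsilon> / 3" by linarith
    have "\<forall>\<^sub>F n in sequentially. \<bar>Hn n (t, x) - Hn n (s, y)\<bar> \<le> \<epsilon> / 3"
    proof -
      have "\<forall>\<^sub>F n in sequentially. - e n < s \<and> s < T - 2 * e n" using eventually_slab[of s] t s by simp
      with eventually_slab[OF t] show ?thesis
        by eventually_elim (rule order_trans[OF Hn_lipschitz close]; simp)
    qed
    then obtain N1 where N1: "\<And>n. n \<ge> N1 \<Longrightarrow> \<bar>Hn n (t, x) - Hn n (s, y)\<bar> \<le> \<epsilon> / 3"
      by (auto simp: eventually_sequentially)
    have "Cauchy (\<lambda>n. Hn n (s, y))"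
      using rat[of s y] s y t by (auto intro: convergent_Cauchy)
    then obtain N2 where N2: "\<And>m n. m \<ge> N2 \<Longrightarrow> n \<ge> N2 \<Longrightarrow> dist (Hn m (s, y)) (Hn n (s, y)) < \<epsilon> / 3"
      using \<epsilon> metric_CauchyD[of "\<lambda>n. Hn n (s, y)" "\<epsilon> / 3"] by auto
    have "dist (Hn m (t, x)) (Hn n (t, x)) < \<epsilon>" if "m \<ge> max N1 N2" "n \<ge> max N1 N2" for m n
    proof -
      have "\<bar>Hn m (t, x) - Hn m (s, y)\<bar> \<le> \<epsilon> / 3" "\<bar>Hn n (t, x) - Hn n (s, y)\<bar> \<le> \<epsilon> / 3"
        "\<bar>Hn m (s, y) - Hn n (s, y)\<bar> < \<epsilon> / 3"
        using N1[of m] N1[of n] N2[of m n] that by (auto simp: dist_real_def)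
      then show ?thesis unfolding dist_real_def by linarith
    qed
    then show "\<exists>M. \<forall>m\<ge>M. \<forall>n\<ge>M. dist (Hn m (t, x)) (Hn n (t, x)) < \<epsilon>" by blast
  qed
  then show ?thesis by (simp add: Cauchy_convergent_iff)
qed

lemma subsequence:
  assumes r: "strict_mono r"
  shows "smooth_potentials T c C L \<rho> J (e \<circ> r) (R \<circ> r) (Jn \<circ> r) (Rt \<circ> r) (Rx \<circ> r) (Jt \<circ> r) (Jx \<circ> r) (Hn \<circ> r)"
proof (unfold_locales; (unfold o_def)?)
  show "(\<lambda>x. e (r x)) \<longlonglongrightarrow> 0" using LIMSEQ_subseq_LIMSEQ[OF e(3) r] by (simp add: o_def)
  show "AE p in lborel. (\<lambda>n. R (r n) p) \<longlonglongrightarrow> \<rho> p \<and> (\<lambda>n. Jn (r n) p) \<longlonglongrightarrow> J p"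
    using AE_conv
  proof eventually_elim
    case (elim p)
    then show ?case
      using LIMSEQ_subseq_LIMSEQ[OF _ r, of "\<lambda>n. R n p" "\<rho> p"] LIMSEQ_subseq_LIMSEQ[OF _ r, of "\<lambda>n. Jn n p" "J p"]
      unfolding o_def by blast
  qed
qed (fact T c L \<rho>_meas J_meas \<rho>_bounds J_bound e R_bounds Jn_bound dR dJ cont_deriv div_free Hn_0 dHn)+

text \<open>
  A diagonal argument over the rational points. The division by \<open>1 + L \<bar>t\<bar> + C \<bar>x\<bar>\<close> turns the linear growth
  of the potentials into the uniform bound that the diagonal lemma asks for.
\<close>

lemma convergent_subsequence:
  "\<exists>r. strict_mono r \<and> (\<forall>t x. 0 \<le> t \<and> t < T \<longrightarrow> convergent (\<lambda>n. Hn (r n) (t, x)))"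
proof -
  define f where "f n q = (if - e n < fst q \<and> fst q < T - 2 * e n then Hn n q else 0) / (1 + L * \<bar>fst q\<bar> + C * \<bar>snd q\<bar>)" for n q
  have C0: "C \<ge> 0" using c by linarith
  have pos: "1 + L * \<bar>fst q\<bar> + C * \<bar>snd q\<bar> > 0" for q :: "real \<times> real"
    using L C0 by (intro add_pos_nonneg) auto
  have "norm (f n q) \<le> 1" for n q
    using Hn_abs_le[of n "fst q" "snd q"] pos[of q] by (auto simp: f_def)
  then obtain r :: "nat \<Rightarrow> nat" where r: "strict_mono r"
    and lim: "\<And>q. q \<in> \<rat> \<times> \<rat> \<Longrightarrow> \<exists>l. (\<lambda>n. f (r n) q) \<longlonglongrightarrow> l"
    using function_convergent_subsequence[of "\<rat> \<times> \<rat>" f 1] countable_SIGMA[OF countable_rat countable_rat]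
    by blast
  interpret sub: smooth_potentials T c C L \<rho> J "e \<circ> r" "R \<circ> r" "Jn \<circ> r" "Rt \<circ> r" "Rx \<circ> r" "Jt \<circ> r" "Jx \<circ> r" "Hn \<circ> r"
    by (rule subsequence[OF r])
  have "convergent (\<lambda>n. (Hn \<circ> r) n (t, x))" if "0 \<le> t" "t < T" for t x
  proof (rule sub.convergent_if_on_rationals[OF _ that])
    fix s y :: real assume sy: "s \<in> \<rat>" "y \<in> \<rat>" "0 \<le> s" "s < T"
    obtain l where "(\<lambda>n. f (r n) (s, y)) \<longlonglongrightarrow> l" using lim sy by blast
    then have "(\<lambda>n. f (r n) (s, y) * (1 + L * \<bar>s\<bar> + C * \<bar>y\<bar>)) \<longlonglongrightarrow> l * (1 + L * \<bar>s\<bar> + C * \<bar>y\<bar>)"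
      by (intro tendsto_intros)
    moreover have "\<forall>\<^sub>F n in sequentially. f (r n) (s, y) * (1 + L * \<bar>s\<bar> + C * \<bar>y\<bar>) = (Hn \<circ> r) n (s, y)"
      using sub.eventually_slab[OF sy(3,4)] by eventually_elim (use pos[of "(s, y)"] in \<open>auto simp: f_def\<close>)
    ultimately have "(\<lambda>n. (Hn \<circ> r) n (s, y)) \<longlonglongrightarrow> l * (1 + L * \<bar>s\<bar> + C * \<bar>y\<bar>)"
      by (rule Lim_transform_eventually)
    then show "convergent (\<lambda>n. (Hn \<circ> r) n (s, y))" by (rule convergentI)
  qed
  then show ?thesis using r by (auto simp: o_def)
qed

end

text \<open>
  The assumption \<open>weak\<close> is the distributional continuity equation tested with translates of tensor
  products of bumps; it says that the mollified field is divergence-free.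
\<close>

lemma smooth_potentials_exist:
  fixes T c C L :: real and \<rho> J :: "real \<times> real \<Rightarrow> real"
  assumes T: "T > 0" and c: "0 < c" "c \<le> C" and L: "L \<ge> 0"
    and [measurable]: "\<rho> \<in> borel_measurable borel" "J \<in> borel_measurable borel"
    and \<rho>_bounds: "\<And>p. c \<le> \<rho> p" "\<And>p. \<rho> p \<le> C" and J_bound: "\<And>p. \<bar>J p\<bar> \<le> L"
    and weak: "\<And>D a b q. smooth_bump a b D \<Longrightarrow> 0 < a + fst q \<Longrightarrow> b + fst q < T \<Longrightarrow>
       mollify (tensor (D (Suc 0)) (D 0)) \<rho> q + mollify (tensor (D 0) (D (Suc 0))) J q = 0"
  shows "\<exists>e R Jn Rt Rx Jt Jx Hn. smooth_potentials T c C L \<rho> J e R Jn Rt Rx Jt Jx Hn"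
proof -
  define e where "e n = T / (real n + 3)" for n
  have e: "e n > 0" "2 * e n < T" for n using T by (auto simp: e_def field_simps add_pos_nonneg)
  have e0: "e \<longlonglongrightarrow> 0"
    unfolding e_def[abs_def]
  proof (rule tendsto_divide_0[OF tendsto_const filterlim_at_top_imp_at_infinity])
    show "filterlim (\<lambda>n. real n + 3) at_top sequentially"
      using filterlim_tendsto_add_at_top[OF tendsto_const[of 3] filterlim_real_sequentially] by (simp add: add.commute)
  qed
  have "\<forall>n. \<exists>D. smooth_bump (e n) (2 * e n) D" using smooth_bump_exists e by simp
  then obtain D where D: "\<And>n. smooth_bump (e n) (2 * e n) (D n)" by metis
  note DD = smooth_bump_D[OF D]
  define k where "k n i j = tensor (D n i) (D n j)" for n i j
  have k_cont: "continuous_on UNIV (k n i j)" for n i j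
    unfolding k_def by (intro tensor_continuous DD)
  have k_meas [measurable]: "k n i j \<in> borel_measurable borel" for n i j
    by (intro borel_measurable_continuous_onI k_cont)
  have k_supp: "k n i j z = 0" if "z \<notin> cbox (e n, e n) (2 * e n, 2 * e n)" for n i j z
    unfolding k_def by (rule tensor_support[OF DD(2) DD(2) that])
  have k_deriv: "(k n i j has_derivative (\<lambda>h. k n (Suc i) j p * fst h + k n i (Suc j) p * snd h)) (at p)" for n i j p
    using tensor_has_derivative[OF DD(1)[of n i "fst p"] DD(1)[of n j "snd p"]] by (simp add: k_def tensor_def)
  have Dint: "integrable lborel (D n 0)" for n
    using DD(4)[of n] not_integrable_integral_eq[of lborel "D n 0"] by force
  have k_int: "integrable lborel (k n 0 0)" "integral\<^sup>L lborel (k n 0 0) = 1" for n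
    using integrable_tensor[OF Dint Dint, of n n] DD(4)
    by (simp_all add: lborel_prod k_def tensor_def[abs_def] split_beta')
  have k_nonneg: "k n 0 0 z \<ge> 0" for n z by (simp add: k_def tensor_def DD(3))
  have k_small: "norm z \<le> 4 * e n" if "k n 0 0 z \<noteq> 0" for n z
  proof -
    have "z \<in> cbox (e n, e n) (2 * e n, 2 * e n)" using k_supp that by blast
    then have "0 \<le> fst z" "fst z \<le> 2 * e n" "0 \<le> snd z" "snd z \<le> 2 * e n"
      using e(1)[of n] by (auto simp: cbox_Pair_eq cbox_def Basis_prod_def inner_prod_def)
    moreover have "norm z \<le> \<bar>fst z\<bar> + \<bar>snd z\<bar>" using norm_Pair_le[of "fst z" "snd z"] by simp
    ultimately show ?thesis by simp
  qed
  have r0: "(\<lambda>n. 4 * e n) \<longlonglongrightarrow> 0" using tendsto_mult_right_zero[OF e0, of 4] by simp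
  have \<rho>C: "\<bar>\<rho> p\<bar> \<le> C" for p using \<rho>_bounds[of p] c by linarith
  have moll_deriv: "(mollify (k n i j) f has_derivative
      (\<lambda>h. - mollify (k n (Suc i) j) f q * fst h - mollify (k n i (Suc j)) f q * snd h)) (at q)"
    if "f \<in> borel_measurable borel" "\<And>p. \<bar>f p\<bar> \<le> M" for f M n i j q
    by (rule mollify_has_derivative[OF that k_deriv k_cont k_cont k_supp k_supp k_supp])
  note d\<rho> = moll_deriv[of \<rho> C] and dJ = moll_deriv[of J L]
  have c\<rho>: "continuous_on UNIV (mollify (k n i j) \<rho>)" for n i j
    using d\<rho>[of n i j] \<rho>C by (auto intro!: continuous_at_imp_continuous_on has_derivative_continuous)
  have cJ: "continuous_on UNIV (mollify (k n i j) J)" for n i j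
    using dJ[of n i j] J_bound by (auto intro!: continuous_at_imp_continuous_on has_derivative_continuous)
  define R where "R n = mollify (k n 0 0) \<rho>" for n
  define Jn where "Jn n = mollify (k n 0 0) J" for n
  define Rt where "Rt n p = - mollify (k n 1 0) \<rho> p" for n p
  define Rx where "Rx n p = - mollify (k n 0 1) \<rho> p" for n p
  define Jt where "Jt n p = - mollify (k n 1 0) J p" for n p
  define Jx where "Jx n p = - mollify (k n 0 1) J p" for n p
  have conts: "continuous_on UNIV (Rt n)" "continuous_on UNIV (Rx n)" "continuous_on UNIV (Jt n)" "continuous_on UNIV (Jx n)" for n
    unfolding Rt_def Rx_def Jt_def Jx_def by (intro continuous_intros c\<rho> cJ)+
  have dR: "(R n has_derivative (\<lambda>h. Rt n p * fst h + Rx n p * snd h)) (at p)" for n p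
    using d\<rho>[of n 0 0 p] \<rho>C by (simp add: R_def Rt_def Rx_def)
  have dJn: "(Jn n has_derivative (\<lambda>h. Jt n p * fst h + Jx n p * snd h)) (at p)" for n p
    using dJ[of n 0 0 p] J_bound by (simp add: Jn_def Jt_def Jx_def)
  have div: "Rt n p + Jx n p = 0" if "- e n < fst p" "fst p < T - 2 * e n" for n p
    using weak[OF D[of n], of p] that by (simp add: Rt_def Jx_def k_def)
  have "\<exists>H. H 0 = 0 \<and> (\<forall>p\<in>{- e n<..<T - 2 * e n} \<times> UNIV.
      (H has_derivative (\<lambda>h. - Jn n p * fst h + R n p * snd h)) (at p))" for n
  proof (rule closed_form_potential[where Pt="\<lambda>p. - Jt n p" and Px="\<lambda>p. - Jx n p" and Qt="Rt n" and Qx="Rx n"])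
    show "((\<lambda>p. - Jn n p) has_derivative (\<lambda>h. - Jt n p * fst h + - Jx n p * snd h)) (at p)" for p
      using has_derivative_minus[OF dJn[of n p]] by simp
    show "- Jx n p = Rt n p" if "p \<in> {- e n<..<T - 2 * e n} \<times> UNIV" for p
      using div[of n p] that by auto
  qed (use e dR in \<open>auto intro!: open_Times convex_Times continuous_intros conts simp: zero_prod_def\<close>)
  then have "\<forall>n. \<exists>H. H 0 = 0 \<and> (\<forall>p\<in>{- e n<..<T - 2 * e n} \<times> UNIV.
      (H has_derivative (\<lambda>h. - Jn n p * fst h + R n p * snd h)) (at p))" by blast
  from choice[OF this] obtain Hn where Hn: "\<And>n. Hn n 0 = 0" "\<And>n p. p \<in> {- e n<..<T - 2 * e n} \<times> UNIV \<Longrightarrow>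
      (Hn n has_derivative (\<lambda>h. - Jn n p * fst h + R n p * snd h)) (at p)"
    by blast
  have L1: "(\<lambda>n. \<integral>q. norm (\<bar>R n q - \<rho> q\<bar> * weight q + \<bar>Jn n q - J q\<bar> * weight q) \<partial>lborel) \<longlonglongrightarrow> 0"
    and L1_int: "\<And>n. integrable lborel (\<lambda>q. \<bar>R n q - \<rho> q\<bar> * weight q + \<bar>Jn n q - J q\<bar> * weight q)"
  proof -
    have a: "(\<lambda>n. \<integral>q. \<bar>R n q - \<rho> q\<bar> * weight q \<partial>lborel) \<longlonglongrightarrow> 0" "integrable lborel (\<lambda>q. \<bar>R n q - \<rho> q\<bar> * weight q)" for n
      using mollify_converges_L1[where f=\<rho> and M=C and r="\<lambda>n. 4 * e n" and k="\<lambda>n. k n 0 0",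
          OF _ \<rho>C k_meas k_int(1) k_nonneg k_int(2) k_small r0] unfolding R_def by auto
    have b: "(\<lambda>n. \<integral>q. \<bar>Jn n q - J q\<bar> * weight q \<partial>lborel) \<longlonglongrightarrow> 0" "integrable lborel (\<lambda>q. \<bar>Jn n q - J q\<bar> * weight q)" for n
      using mollify_converges_L1[where f=J and M=L and r="\<lambda>n. 4 * e n" and k="\<lambda>n. k n 0 0",
          OF _ J_bound k_meas k_int(1) k_nonneg k_int(2) k_small r0] unfolding Jn_def by auto
    show "integrable lborel (\<lambda>q. \<bar>R n q - \<rho> q\<bar> * weight q + \<bar>Jn n q - J q\<bar> * weight q)" for n
      by (intro Bochner_Integration.integrable_add a b)
    have "norm (\<bar>R n q - \<rho> q\<bar> * weight q + \<bar>Jn n q - J q\<bar> * weight q) = \<bar>R n q - \<rho> q\<bar> * weight q + \<bar>Jn n q - J q\<bar> * weight q" for n q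
      using weight_pos[of q] by (simp add: less_imp_le)
    then show "(\<lambda>n. \<integral>q. norm (\<bar>R n q - \<rho> q\<bar> * weight q + \<bar>Jn n q - J q\<bar> * weight q) \<partial>lborel) \<longlonglongrightarrow> 0"
      using tendsto_add[OF a(1) b(1)] a(2) b(2) by (simp add: Bochner_Integration.integral_add)
  qed
  obtain r :: "nat \<Rightarrow> nat" where r: "strict_mono r"
    and AE_r: "AE q in lborel. (\<lambda>n. \<bar>R (r n) q - \<rho> q\<bar> * weight q + \<bar>Jn (r n) q - J q\<bar> * weight q) \<longlonglongrightarrow> 0"
    using tendsto_L1_AE_subseq[OF L1_int L1] by blast
  have AE_conv: "AE q in lborel. (\<lambda>n. R (r n) q) \<longlonglongrightarrow> \<rho> q \<and> (\<lambda>n. Jn (r n) q) \<longlonglongrightarrow> J q"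
    using AE_r
  proof eventually_elim
    case (elim q)
    have w: "weight q > 0" by (rule weight_pos)
    have "(\<lambda>n. (\<bar>R (r n) q - \<rho> q\<bar> * weight q + \<bar>Jn (r n) q - J q\<bar> * weight q) / weight q) \<longlonglongrightarrow> 0 / weight q"
      using w by (intro tendsto_intros elim) auto
    then have lim: "(\<lambda>n. \<bar>R (r n) q - \<rho> q\<bar> + \<bar>Jn (r n) q - J q\<bar>) \<longlonglongrightarrow> 0"
      using w by (simp add: distrib_right[symmetric])
    have "(\<lambda>n. R (r n) q - \<rho> q) \<longlonglongrightarrow> 0" "(\<lambda>n. Jn (r n) q - J q) \<longlonglongrightarrow> 0"
      by (rule Lim_null_comparison[OF _ lim], simp)+
    then show ?case by (simp add: LIM_zero_iff)
  qed
  have kb: "k n 0 0 \<in> borel_measurable borel" for n by measurable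
  have "smooth_potentials T c C L \<rho> J (\<lambda>n. e (r n)) (\<lambda>n. R (r n)) (\<lambda>n. Jn (r n)) (\<lambda>n. Rt (r n))
      (\<lambda>n. Rx (r n)) (\<lambda>n. Jt (r n)) (\<lambda>n. Jx (r n)) (\<lambda>n. Hn (r n))"
  proof (unfold_locales)
    show "(\<lambda>x. e (r x)) \<longlonglongrightarrow> 0" using LIMSEQ_subseq_LIMSEQ[OF e0 r] by (simp add: o_def)
    have \<rho>m: "\<rho> \<in> borel_measurable borel" and Jm: "J \<in> borel_measurable borel" by measurable
    note bounds = mollify_bounds[OF _ _ _ kb k_int(1) k_nonneg k_int(2)]
    show "c \<le> R (r n) p" "R (r n) p \<le> C" for n p
      unfolding R_def using bounds[OF \<rho>m \<rho>_bounds] by blast+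
    have "J p \<ge> - L" "J p \<le> L" for p using J_bound[of p] by linarith+
    then have "- L \<le> Jn n p" "Jn n p \<le> L" for n p
      unfolding Jn_def using bounds[OF Jm, of "- L" L] by blast+
    then show "\<bar>Jn (r n) p\<bar> \<le> L" for n p by (simp add: abs_le_iff minus_le_iff)
    show "AE p in lborel. (\<lambda>n. R (r n) p) \<longlonglongrightarrow> \<rho> p \<and> (\<lambda>n. Jn (r n) p) \<longlonglongrightarrow> J p" by (rule AE_conv)
    show "Hn (r n) 0 = 0" for n by (rule Hn)
    show "(Hn (r n) has_derivative (\<lambda>h. - Jn (r n) p * fst h + R (r n) p * snd h)) (at p)"
      if "- e (r n) < fst p" "fst p < T - 2 * e (r n)" for n p
      using that by (intro Hn(2)) (auto simp: mem_Times_iff)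
  qed (fact assms e conts dR dJn div | use assms e conts dR dJn div in auto)+
  then show ?thesis by blast
qed

section \<open>The limiting potential as a change of variables\<close>

text \<open>
  Off the strip the conventions \<open>\<rho> = 1\<close> and \<open>H (t, x) = x\<close> make \<open>\<Phi>\<close> a bijection of the whole plane and the
  change of variables below an identity between measures on the plane.
\<close>

locale potential = smooth_potentials +
  fixes H :: "real \<times> real \<Rightarrow> real"
  assumes H_lim: "\<And>t x. 0 \<le> t \<Longrightarrow> t < T \<Longrightarrow> (\<lambda>n. Hn n (t, x)) \<longlonglongrightarrow> H (t, x)"
    and H_off: "\<And>t x. t \<notin> {0..<T} \<Longrightarrow> H (t, x) = x"
    and \<rho>_off: "\<And>t x. t \<notin> {0<..<T} \<Longrightarrow> \<rho> (t, x) = 1"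
begin

lemma c_le_1: "c \<le> 1" "1 \<le> C"
  using \<rho>_bounds[of "(-1, 0)"] \<rho>_off[of "-1" 0] by auto

lemma C_pos: "C > 0" using c by linarith

lemma H_x_bounds:
  assumes "x \<le> y"
  shows "c * (y - x) \<le> H (t, y) - H (t, x)" "H (t, y) - H (t, x) \<le> C * (y - x)"
proof -
  have "c * (y - x) \<le> H (t, y) - H (t, x) \<and> H (t, y) - H (t, x) \<le> C * (y - x)"
  proof (cases "0 \<le> t \<and> t < T")
    case True
    then have lim: "(\<lambda>n. Hn n (t, y) - Hn n (t, x)) \<longlonglongrightarrow> H (t, y) - H (t, x)"
      by (intro tendsto_diff H_lim) auto
    have ev: "\<forall>\<^sub>F n in sequentially. c * (y - x) \<le> Hn n (t, y) - Hn n (t, x) \<and> Hn n (t, y) - Hn n (t, x) \<le> C * (y - x)"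
      using eventually_slab[of t] True by (auto elim!: eventually_mono intro: Hn_x_bounds assms)
    show ?thesis
      using tendsto_lowerbound[OF lim, of "c * (y - x)"] tendsto_upperbound[OF lim, of "C * (y - x)"] ev
      by (simp add: eventually_conj_iff)
  next
    case False
    then show ?thesis
      using mult_right_mono[OF c_le_1(1), of "y - x"] mult_right_mono[OF c_le_1(2), of "y - x"] assms H_off[of t] by auto
  qed
  then show "c * (y - x) \<le> H (t, y) - H (t, x)" "H (t, y) - H (t, x) \<le> C * (y - x)" by auto
qed

lemma H_strict_mono: "x < y \<Longrightarrow> H (t, x) < H (t, y)"
  using H_x_bounds(1)[of x y t] mult_pos_pos[OF c(1), of "y - x"] by linarith

lemma H_less_iff: "H (t, x) < H (t, y) \<longleftrightarrow> x < y"
  using H_strict_mono[of x y t] H_strict_mono[of y x t] by (cases x y rule: linorder_cases) auto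

lemma H_le_iff: "H (t, x) \<le> H (t, y) \<longleftrightarrow> x \<le> y"
  using H_less_iff[of t y x] by (simp add: not_less[symmetric])

lemma H_x_lipschitz: "\<bar>H (t, x) - H (t, y)\<bar> \<le> C * \<bar>x - y\<bar>"
  using H_x_bounds[of x y t] H_x_bounds[of y x t] H_le_iff[of t x y] H_le_iff[of t y x]
  by (cases "x \<le> y") auto

lemma H_x_expand: "c * \<bar>x - y\<bar> \<le> \<bar>H (t, x) - H (t, y)\<bar>"
  using H_x_bounds[of x y t] H_x_bounds[of y x t]
  by (cases "x \<le> y") auto

lemma H_t_lipschitz:
  assumes "0 \<le> t" "t < T" "0 \<le> s" "s < T"
  shows "\<bar>H (t, x) - H (s, x)\<bar> \<le> L * \<bar>t - s\<bar>"
proof (rule tendsto_upperbound)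
  show "(\<lambda>n. \<bar>Hn n (t, x) - Hn n (s, x)\<bar>) \<longlonglongrightarrow> \<bar>H (t, x) - H (s, x)\<bar>"
    by (intro tendsto_intros H_lim assms)
  show "\<forall>\<^sub>F n in sequentially. \<bar>Hn n (t, x) - Hn n (s, x)\<bar> \<le> L * \<bar>t - s\<bar>"
    using eventually_slab[OF assms(1,2)] eventually_slab[OF assms(3,4)]
    by eventually_elim (auto intro: Hn_t_lipschitz)
qed simp

lemma H_abs_le: "0 \<le> t \<Longrightarrow> t < T \<Longrightarrow> \<bar>H (t, x)\<bar> \<le> L * T + C * \<bar>x\<bar>"
proof (rule tendsto_upperbound)
  assume t: "0 \<le> t" "t < T"
  show "(\<lambda>n. \<bar>Hn n (t, x)\<bar>) \<longlonglongrightarrow> \<bar>H (t, x)\<bar>" by (intro tendsto_intros H_lim t)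
  have "L * \<bar>t\<bar> \<le> L * T" using t L by (intro mult_left_mono) auto
  then show "\<forall>\<^sub>F n in sequentially. \<bar>Hn n (t, x)\<bar> \<le> L * T + C * \<bar>x\<bar>"
    using eventually_slab[OF t] by (auto elim!: eventually_mono intro: order_trans[OF Hn_abs_le])
qed simp

lemma H_continuous_x: "continuous_on S (\<lambda>x. H (t, x))"
proof (rule lipschitz_on_continuous_on[where L=C], rule lipschitz_onI)
  show "dist (H (t, x)) (H (t, y)) \<le> C * dist x y" for x y
    using H_x_lipschitz by (simp add: dist_real_def)
qed (use C_pos in simp)

text \<open>The slope of \<open>H (t, \<cdot>)\<close> is at least \<open>c\<close>, so moving by \<open>(y - H (t, 0)) / c\<close> overshoots the value \<open>y\<close>.\<close>

lemma H_surj: "\<exists>x. H (t, x) = y"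
proof -
  define a where "a = (y - H (t, 0)) / c"
  have a: "c * a = y - H (t, 0)" using c by (simp add: a_def)
  show ?thesis
  proof (cases "a \<ge> 0")
    case True
    then have "H (t, 0) \<le> y" "y \<le> H (t, a)"
      using H_x_bounds(1)[of 0 a t] a mult_nonneg_nonneg[of c a] c by auto
    then show ?thesis using IVT'[of "\<lambda>x. H (t, x)" 0 y a] True H_continuous_x by blast
  next
    case False
    then have "y \<le> H (t, 0)" "H (t, a) \<le> y"
      using H_x_bounds(1)[of a 0 t] a mult_nonneg_nonpos[of c a] c by auto
    then show ?thesis using IVT'[of "\<lambda>x. H (t, x)" a y 0] False H_continuous_x by auto
  qed
qed

text \<open>\<open>X (t, \<cdot>)\<close> is the inverse of \<open>H (t, \<cdot>)\<close>, so \<open>t \<mapsto> X (t, y)\<close> is the characteristic labelled by \<open>y\<close>.\<close>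

definition X :: "real \<times> real \<Rightarrow> real" where
  "X p = (SOME x. H (fst p, x) = snd p)"

lemma H_X [simp]: "H (t, X (t, y)) = y"
  using someI_ex[OF H_surj[of t y]] by (simp add: X_def)

lemma X_H [simp]: "X (t, H (t, x)) = x"
  using H_le_iff[of t "X (t, H (t, x))" x] H_le_iff[of t x "X (t, H (t, x))"] by simp

lemma X_less_iff: "X (t, y) < x \<longleftrightarrow> y < H (t, x)" "x < X (t, y) \<longleftrightarrow> H (t, x) < y"
  using H_less_iff[of t "X (t, y)" x] H_less_iff[of t x "X (t, y)"] by simp_all

lemma X_off: "t \<notin> {0..<T} \<Longrightarrow> X (t, y) = y"
  using H_X[of t y] H_off[of t "X (t, y)"] by argo

lemma X_lipschitz_y: "c * \<bar>X (t, y) - X (t, z)\<bar> \<le> \<bar>y - z\<bar>"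
  using H_x_expand[of "X (t, y)" "X (t, z)" t] by simp

lemma X_lipschitz:
  assumes "0 \<le> t" "t < T" "0 \<le> s" "s < T"
  shows "c * \<bar>X (t, y) - X (s, z)\<bar> \<le> \<bar>y - z\<bar> + L * \<bar>t - s\<bar>"
  using H_x_expand[of "X (t, y)" "X (s, z)" t] H_t_lipschitz[OF assms, of "X (s, z)"] by simp

lemma lipschitz_pair_continuous:
  fixes f :: "real \<times> real \<Rightarrow> real"
  assumes "\<And>t x s y. (t, x) \<in> S \<Longrightarrow> (s, y) \<in> S \<Longrightarrow> \<bar>f (t, x) - f (s, y)\<bar> \<le> K * \<bar>t - s\<bar> + K * \<bar>x - y\<bar>"
    and "K \<ge> 0"
  shows "continuous_on S f"
proof (rule lipschitz_on_continuous_on[where L="2 * K"], rule lipschitz_onI)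
  fix p q assume pq: "p \<in> S" "q \<in> S"
  have "\<bar>fst p - fst q\<bar> \<le> dist p q" "\<bar>snd p - snd q\<bar> \<le> dist p q"
    using dist_fst_le[of p q] dist_snd_le[of p q] by (simp_all add: dist_real_def)
  then have "K * \<bar>fst p - fst q\<bar> + K * \<bar>snd p - snd q\<bar> \<le> K * dist p q + K * dist p q"
    using assms(2) by (intro add_mono mult_left_mono) auto
  then show "dist (f p) (f q) \<le> 2 * K * dist p q"
    using assms(1)[of "fst p" "snd p" "fst q" "snd q"] pq by (simp add: dist_real_def)
qed (use assms(2) in simp)

lemma H_continuous: "continuous_on (spacetime0 T) H"
proof (rule lipschitz_pair_continuous[where K="L + C"])
  fix t x s y assume "(t, x) \<in> spacetime0 T" "(s, y) \<in> spacetime0 T"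
  then have "\<bar>H (t, x) - H (s, y)\<bar> \<le> L * \<bar>t - s\<bar> + C * \<bar>x - y\<bar>"
    using H_t_lipschitz[of t s x] H_x_lipschitz[of s x y] by auto
  also have "\<dots> \<le> (L + C) * \<bar>t - s\<bar> + (L + C) * \<bar>x - y\<bar>"
    using L C_pos by (intro add_mono mult_right_mono) auto
  finally show "\<bar>H (t, x) - H (s, y)\<bar> \<le> (L + C) * \<bar>t - s\<bar> + (L + C) * \<bar>x - y\<bar>" .
qed (use L C_pos in simp)

lemma X_continuous: "continuous_on (spacetime0 T) X"
proof (rule lipschitz_pair_continuous[where K="(L + 1) / c"])
  fix t x s y assume "(t, x) \<in> spacetime0 T" "(s, y) \<in> spacetime0 T"
  then have "c * \<bar>X (t, x) - X (s, y)\<bar> \<le> \<bar>x - y\<bar> + L * \<bar>t - s\<bar>"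
    using X_lipschitz[of t s x y] by auto
  also have "\<dots> \<le> (L + 1) * \<bar>t - s\<bar> + (L + 1) * \<bar>x - y\<bar>"
    using L by (simp add: algebra_simps mult_nonneg_nonneg)
  finally have "c * \<bar>X (t, x) - X (s, y)\<bar> \<le> (L + 1) * \<bar>t - s\<bar> + (L + 1) * \<bar>x - y\<bar>" .
  then have "\<bar>X (t, x) - X (s, y)\<bar> \<le> ((L + 1) * \<bar>t - s\<bar> + (L + 1) * \<bar>x - y\<bar>) / c"
    using c(1) by (simp add: pos_le_divide_eq mult.commute)
  then show "\<bar>X (t, x) - X (s, y)\<bar> \<le> (L + 1) / c * \<bar>t - s\<bar> + (L + 1) / c * \<bar>x - y\<bar>"
    by (metis add_divide_distrib times_divide_eq_left)
qed (use L c in simp)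

lemma borel_if_continuous_spacetime0:
  fixes f :: "real \<times> real \<Rightarrow> real"
  assumes "continuous_on (spacetime0 T) f" "\<And>t x. t \<notin> {0..<T} \<Longrightarrow> f (t, x) = x"
  shows "f \<in> borel_measurable borel"
proof -
  have "(\<lambda>p. if p \<in> spacetime0 T then f p else snd p) \<in> borel_measurable borel"
    by (rule borel_measurable_continuous_on_if) (auto intro!: assms continuous_intros borel_Times)
  also have "(\<lambda>p. if p \<in> spacetime0 T then f p else snd p) = f"
    using assms(2) by (force simp: fun_eq_iff)
  finally show ?thesis .
qed

lemma H_measurable [measurable]: "H \<in> borel_measurable borel"
  by (rule borel_if_continuous_spacetime0[OF H_continuous H_off])

lemma X_measurable [measurable]: "X \<in> borel_measurable borel"
  by (rule borel_if_continuous_spacetime0[OF X_continuous X_off])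

definition \<Phi> :: "real \<times> real \<Rightarrow> real \<times> real" where "\<Phi> p = (fst p, H p)"
definition \<Psi> :: "real \<times> real \<Rightarrow> real \<times> real" where "\<Psi> p = (fst p, X p)"

lemma \<Phi>_\<Psi> [simp]: "\<Phi> (\<Psi> p) = p" "\<Psi> (\<Phi> p) = p"
  by (cases p; simp add: \<Phi>_def \<Psi>_def)+

lemma fst_\<Phi>_\<Psi> [simp]: "fst (\<Phi> p) = fst p" "fst (\<Psi> p) = fst p"
  by (simp_all add: \<Phi>_def \<Psi>_def)

lemma \<Phi>_measurable [measurable]: "\<Phi> \<in> borel_measurable borel"
  and \<Psi>_measurable [measurable]: "\<Psi> \<in> borel_measurable borel"
  unfolding \<Phi>_def[abs_def] \<Psi>_def[abs_def]
  by (intro borel_measurable_Pair H_measurable X_measurable borel_measurable_continuous_onI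
      continuous_on_fst continuous_on_id)+

text \<open>
  The integrated form of \<open>\<partial>\<^sub>x H = \<rho>\<close>. The identity for \<open>Hn\<close> passes to the limit at those times for which
  \<open>R n (t, \<cdot>)\<close> converges almost everywhere, that is, at almost all times by Fubini.
\<close>

lemma AE_H_increment:
  "AE t in lborel. \<forall>x y. x \<le> y \<longrightarrow> (\<integral>z. \<rho> (t, z) * indicator {x..y} z \<partial>lborel) = H (t, y) - H (t, x)"
proof -
  have "AE p in lborel \<Otimes>\<^sub>M lborel. (\<lambda>n. R n p) \<longlonglongrightarrow> \<rho> p"
    unfolding lborel_prod using AE_conv by simp
  from lborel_pair.AE_pair[OF this]
  have conv: "AE t in lborel. AE z in lborel. (\<lambda>n. R n (t, z)) \<longlonglongrightarrow> \<rho> (t, z)" .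
  have t0: "AE t in lborel. t \<noteq> (0::real)" by (rule AE_lborel_singleton)
  show ?thesis
    using conv t0
  proof eventually_elim
    case (elim t)
    show ?case
    proof (intro allI impI)
      fix x y :: real assume xy: "x \<le> y"
      show "(\<integral>z. \<rho> (t, z) * indicator {x..y} z \<partial>lborel) = H (t, y) - H (t, x)"
      proof (cases "0 < t \<and> t < T")
        case False
        then have "t \<notin> {0<..<T}" "t \<notin> {0..<T}" using elim(2) by auto
        then show ?thesis using xy by (simp add: \<rho>_off H_off)
      next
        case True
        have contR: "continuous_on UNIV (R n)" for n
          using dR by (meson continuous_at_imp_continuous_on has_derivative_continuous)
        have [measurable]: "R n \<in> borel_measurable borel" for n
          by (intro borel_measurable_continuous_onI contR)
        have "(\<lambda>n. \<integral>z. R n (t, z) * indicator {x..y} z \<partial>lborel) \<longlonglongrightarrow> (\<integral>z. \<rho> (t, z) * indicator {x..y} z \<partial>lborel)"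
        proof (rule integral_dominated_convergence[where w="\<lambda>z. C * indicator {x..y} z"])
          show "AE z in lborel. (\<lambda>n. R n (t, z) * indicator {x..y} z) \<longlonglongrightarrow> \<rho> (t, z) * indicator {x..y} z"
            using elim(1) by eventually_elim (rule tendsto_mult_right)
          show "integrable lborel (\<lambda>z. C * indicator {x..y} z :: real)"
            by (intro integrable_mult_right integrable_real_indicator) (auto simp: emeasure_lborel_Icc_eq)
          show "AE z in lborel. norm (R n (t, z) * indicator {x..y} z) \<le> C * indicator {x..y} z" for n
          proof (rule AE_I2)
            fix z
            have "\<bar>R n (t, z)\<bar> \<le> C" using R_bounds[of n "(t, z)"] c by linarith
            then show "norm (R n (t, z) * indicator {x..y} z) \<le> C * indicator {x..y} z"
              by (auto simp: indicator_def)
          qed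
        qed measurable
        moreover have "\<forall>\<^sub>F n in sequentially. (\<integral>z. R n (t, z) * indicator {x..y} z \<partial>lborel) = Hn n (t, y) - Hn n (t, x)"
          using eventually_slab[of t] True
        proof (auto elim!: eventually_mono)
          fix n assume n: "- e n < t" "t < T - 2 * e n"
          show "(\<integral>z. R n (t, z) * indicator {x..y} z \<partial>lborel) = Hn n (t, y) - Hn n (t, x)"
          proof (rule integral_FTC_Icc_real[OF xy])
            show "((\<lambda>x. Hn n (t, x)) has_real_derivative R n (t, z)) (at z)" for z by (rule Hn_dx[OF n])
            have "continuous_on UNIV (\<lambda>z. R n (t, z))"
              by (rule continuous_on_compose2[OF contR]) (auto intro: continuous_intros)
            then show "isCont (\<lambda>z. R n (t, z)) z" for z
              by (simp add: continuous_on_eq_continuous_at)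
          qed
        qed
        ultimately have "(\<lambda>n. Hn n (t, y) - Hn n (t, x)) \<longlonglongrightarrow> (\<integral>z. \<rho> (t, z) * indicator {x..y} z \<partial>lborel)"
          by (rule Lim_transform_eventually)
        moreover have "(\<lambda>n. Hn n (t, y) - Hn n (t, x)) \<longlonglongrightarrow> H (t, y) - H (t, x)"
          using True by (intro tendsto_diff H_lim) auto
        ultimately show ?thesis by (rule LIMSEQ_unique)
      qed
    qed
  qed
qed

lemma \<rho>_pos: "\<rho> p > 0" using \<rho>_bounds(1)[of p] c by linarith

text \<open>
  On a rectangle this is Fubini together with \<open>AE_H_increment\<close>: for fixed \<open>t\<close> the \<open>\<rho>\<close>-mass of the
  interval between \<open>X (t, l2)\<close> and \<open>X (t, u2)\<close> is \<open>u2 - l2\<close>.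
\<close>

lemma distr_\<Phi>: "distr (density lborel (\<lambda>p. ennreal (\<rho> p))) borel \<Phi> = lborel"
proof (rule lborel_eqI[symmetric])
  fix l u :: "real \<times> real" assume lu: "\<And>b. b \<in> Basis \<Longrightarrow> l \<bullet> b \<le> u \<bullet> b"
  obtain l1 l2 u1 u2 where l: "l = (l1, l2)" and u: "u = (u1, u2)" by (cases l; cases u)
  have le: "l1 \<le> u1" "l2 \<le> u2" using lu[of "(1, 0)"] lu[of "(0, 1)"] by (auto simp: l u Basis_prod_def)
  have "emeasure (distr (density lborel (\<lambda>p. ennreal (\<rho> p))) borel \<Phi>) (box l u)
      = (\<integral>\<^sup>+p. ennreal (\<rho> p) * indicator (\<Phi> -` box l u) p \<partial>lborel)"
    by (subst emeasure_distr)
      (auto intro!: emeasure_density simp: measurable_sets_borel[OF \<Phi>_measurable])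
  also have "\<dots> = (\<integral>\<^sup>+p. ennreal (\<rho> p) * indicator (box l u) (\<Phi> p) \<partial>(lborel \<Otimes>\<^sub>M lborel))"
    by (simp add: lborel_prod indicator_def vimage_def)
  also have "\<dots> = (\<integral>\<^sup>+t. \<integral>\<^sup>+x. ennreal (\<rho> (t, x)) * indicator (box l u) (\<Phi> (t, x)) \<partial>lborel \<partial>lborel)"
  proof (rule lborel.nn_integral_fst[symmetric])
    have "(\<lambda>p. indicator (box l u) (\<Phi> p) :: ennreal) \<in> borel_measurable borel"
      by (rule measurable_compose[OF \<Phi>_measurable]) simp
    then have "(\<lambda>p. ennreal (\<rho> p) * indicator (box l u) (\<Phi> p)) \<in> borel_measurable borel"
      by measurable
    then show "(\<lambda>p. ennreal (\<rho> p) * indicator (box l u) (\<Phi> p)) \<in> borel_measurable (lborel \<Otimes>\<^sub>M lborel)"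
      by (simp add: lborel_prod)
  qed
  also have "\<dots> = (\<integral>\<^sup>+t. ennreal (u2 - l2) * indicator {l1<..<u1} t \<partial>lborel)"
  proof (rule nn_integral_cong_AE)
    show "AE t in lborel. (\<integral>\<^sup>+x. ennreal (\<rho> (t, x)) * indicator (box l u) (\<Phi> (t, x)) \<partial>lborel)
        = ennreal (u2 - l2) * indicator {l1<..<u1} t"
      using AE_H_increment
    proof eventually_elim
      case (elim t)
      let ?I = "{X (t, l2)..X (t, u2)}"
      have X_le: "X (t, l2) \<le> X (t, u2)"
        using H_le_iff[of t "X (t, l2)" "X (t, u2)"] le by simp
      have ind: "indicator (box l u) (\<Phi> (t, x)) = (indicator {l1<..<u1} t * indicator {X (t, l2)<..<X (t, u2)} x :: ennreal)" for x
        by (auto simp: l u \<Phi>_def indicator_def mem_box Basis_prod_def X_less_iff)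
      have "(\<integral>\<^sup>+x. ennreal (\<rho> (t, x)) * indicator {X (t, l2)<..<X (t, u2)} x \<partial>lborel)
          = (\<integral>\<^sup>+x. ennreal (\<rho> (t, x) * indicator ?I x) \<partial>lborel)"
      proof (rule nn_integral_cong_AE)
        show "AE x in lborel. ennreal (\<rho> (t, x)) * indicator {X (t, l2)<..<X (t, u2)} x = ennreal (\<rho> (t, x) * indicator ?I x)"
          using AE_lborel_singleton[of "X (t, l2)"] AE_lborel_singleton[of "X (t, u2)"]
          by eventually_elim (auto simp: indicator_def)
      qed
      also have "\<dots> = ennreal (\<integral>x. \<rho> (t, x) * indicator ?I x \<partial>lborel)"
      proof (rule nn_integral_eq_integral)
        show "integrable lborel (\<lambda>x. \<rho> (t, x) * indicator ?I x)"
        proof (rule integrable_bounded_support[where K=C])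
          show "\<bar>\<rho> (t, x) * indicator ?I x\<bar> \<le> C" for x
            using \<rho>_bounds[of "(t, x)"] \<rho>_pos[of "(t, x)"] C_pos by (auto simp: indicator_def)
          show "\<rho> (t, x) * indicator ?I x = 0" if "x \<notin> cbox (X (t, l2)) (X (t, u2))" for x using that by simp
        qed measurable
        show "AE x in lborel. 0 \<le> \<rho> (t, x) * indicator ?I x"
          using \<rho>_pos by (auto simp: indicator_def less_imp_le)
      qed
      also have "\<dots> = ennreal (u2 - l2)" using elim X_le by simp
      finally have "(\<integral>\<^sup>+x. ennreal (\<rho> (t, x)) * indicator {X (t, l2)<..<X (t, u2)} x \<partial>lborel) = ennreal (u2 - l2)" .
      then show ?case unfolding ind by (cases "t \<in> {l1<..<u1}") (simp_all add: indicator_def)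
    qed
  qed
  also have "\<dots> = ennreal (u2 - l2) * ennreal (u1 - l1)"
    using le by (simp add: nn_integral_cmult)
  also have "\<dots> = (\<Prod>b\<in>Basis. (u - l) \<bullet> b)"
    using le by (simp add: l u Basis_prod_def ennreal_mult' mult.commute)
  finally show "emeasure (distr (density lborel (\<lambda>p. ennreal (\<rho> p))) borel \<Phi>) (box l u) = (\<Prod>b\<in>Basis. (u - l) \<bullet> b)" .
qed simp

lemma change_of_variables:
  fixes f :: "real \<times> real \<Rightarrow> real"
  assumes [measurable]: "f \<in> borel_measurable borel"
  shows "integrable lborel (\<lambda>p. \<rho> p * f (\<Phi> p)) \<longleftrightarrow> integrable lborel f"
    and "(\<integral>p. \<rho> p * f (\<Phi> p) \<partial>lborel) = integral\<^sup>L lborel f"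
proof -
  have pos: "AE p in lborel. 0 \<le> \<rho> p" using \<rho>_pos by (simp add: less_imp_le)
  have "integrable lborel f \<longleftrightarrow> integrable (distr (density lborel (\<lambda>p. ennreal (\<rho> p))) borel \<Phi>) f"
    by (simp add: distr_\<Phi>)
  also have "\<dots> \<longleftrightarrow> integrable (density lborel (\<lambda>p. ennreal (\<rho> p))) (\<lambda>p. f (\<Phi> p))"
    by (rule integrable_distr_eq) measurable
  also have "\<dots> \<longleftrightarrow> integrable lborel (\<lambda>p. \<rho> p * f (\<Phi> p))"
    using pos by (subst integrable_density) auto
  finally show "integrable lborel (\<lambda>p. \<rho> p * f (\<Phi> p)) \<longleftrightarrow> integrable lborel f" by simp
  have "integral\<^sup>L lborel f = integral\<^sup>L (distr (density lborel (\<lambda>p. ennreal (\<rho> p))) borel \<Phi>) f"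
    by (simp add: distr_\<Phi>)
  also have "\<dots> = integral\<^sup>L (density lborel (\<lambda>p. ennreal (\<rho> p))) (\<lambda>p. f (\<Phi> p))"
    by (rule integral_distr) measurable
  also have "\<dots> = (\<integral>p. \<rho> p * f (\<Phi> p) \<partial>lborel)"
    using pos by (subst integral_density) auto
  finally show "(\<integral>p. \<rho> p * f (\<Phi> p) \<partial>lborel) = integral\<^sup>L lborel f" by simp
qed

end

section \<open>Test functions\<close>

text \<open>
  The sets with vanishing integral form a Dynkin system, and boxes are stable under intersection. The total
  integral vanishes because boxes exhaust the space.
\<close>

lemma integral_indicator_zero_if_boxes:
  fixes \<Phi> :: "'m \<Rightarrow> 'a::euclidean_space"
  assumes f: "integrable M f" and [measurable]: "\<Phi> \<in> M \<rightarrow>\<^sub>M borel"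
    and box: "\<And>a b. (\<integral>p. f p * indicator (box a b) (\<Phi> p) \<partial>M) = (0::real)"
    and A: "A \<in> sets borel"
  shows "(\<integral>p. f p * indicator A (\<Phi> p) \<partial>M) = 0"
proof -
  have [measurable]: "f \<in> borel_measurable M" using f by (rule borel_measurable_integrable)
  have int: "integrable M (\<lambda>p. f p * indicator B (\<Phi> p))" if [measurable]: "B \<in> sets borel" for B
    by (rule Bochner_Integration.integrable_bound[OF f]) (auto simp: indicator_def)
  have total: "integral\<^sup>L M f = 0"
  proof -
    let ?B = "\<lambda>n::nat. box (- (real n *\<^sub>R One)) (real n *\<^sub>R One) :: 'a set"
    have "(\<lambda>n. \<integral>p. f p * indicator (?B n) (\<Phi> p) \<partial>M) \<longlonglongrightarrow> integral\<^sup>L M f"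
    proof (rule integral_dominated_convergence[where w="\<lambda>p. norm (f p)"])
      show "AE p in M. (\<lambda>n. f p * indicator (?B n) (\<Phi> p)) \<longlonglongrightarrow> f p"
      proof (rule AE_I2)
        fix p
        obtain N :: nat where N: "norm (\<Phi> p) < real N" using reals_Archimedean2 by blast
        have "\<Phi> p \<in> ?B n" if "n \<ge> N" for n
        proof -
          have "\<bar>\<Phi> p \<bullet> i\<bar> < real n" if "i \<in> Basis" for i
            using Basis_le_norm[OF that, of "\<Phi> p"] N \<open>n \<ge> N\<close> by linarith
          then show ?thesis by (auto simp: mem_box inner_Basis abs_less_iff minus_less_iff)
        qed
        then have "\<forall>\<^sub>F n in sequentially. f p * indicator (?B n) (\<Phi> p) = f p"
          by (auto simp: eventually_sequentially intro!: exI[of _ N])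
        then show "(\<lambda>n. f p * indicator (?B n) (\<Phi> p)) \<longlonglongrightarrow> f p" by (rule tendsto_eventually)
      qed
      show "AE p in M. norm (f p * indicator (?B n) (\<Phi> p)) \<le> norm (f p)" for n
        by (rule AE_I2) (auto simp: indicator_def)
    qed (use f in auto)
    then show ?thesis unfolding box by (simp add: LIMSEQ_const_iff)
  qed
  have "Int_stable (range (\<lambda>(a, b). box a b :: 'a set))"
    by (auto simp: Int_stable_def box_Int_box)
  moreover have "range (\<lambda>(a, b). box a b :: 'a set) \<subseteq> Pow UNIV" by simp
  moreover have "A \<in> sigma_sets UNIV (range (\<lambda>(a, b). box a b))"
    using A unfolding borel_eq_box by (subst (asm) sets_measure_of) auto
  ultimately show ?thesis
  proof (induction rule: sigma_sets_induct_disjoint)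
    fix B assume "B \<in> range (\<lambda>(a, b). box a b :: 'a set)"
    then show "(\<integral>p. f p * indicator B (\<Phi> p) \<partial>M) = 0" using box by auto
  next
    fix B assume "B \<in> sigma_sets UNIV (range (\<lambda>(a, b). box a b :: 'a set))"
      and IH: "(\<integral>p. f p * indicator B (\<Phi> p) \<partial>M) = 0"
    then have B: "B \<in> sets borel" unfolding borel_eq_box by (subst sets_measure_of) auto
    have "(\<integral>p. f p * indicator (UNIV - B) (\<Phi> p) \<partial>M) = (\<integral>p. f p - f p * indicator B (\<Phi> p) \<partial>M)"
      by (intro Bochner_Integration.integral_cong) (auto simp: indicator_def)
    then show "(\<integral>p. f p * indicator (UNIV - B) (\<Phi> p) \<partial>M) = 0"
      using f int[OF B] IH total by simp
  next
    fix B :: "nat \<Rightarrow> 'a set"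
    assume disj: "disjoint_family B" and B: "range B \<subseteq> sigma_sets UNIV (range (\<lambda>(a, b). box a b :: 'a set))"
      and IH: "\<And>i. (\<integral>p. f p * indicator (B i) (\<Phi> p) \<partial>M) = 0"
    have [measurable]: "B i \<in> sets borel" for i
      using B unfolding borel_eq_box by (subst sets_measure_of) auto
    have "(\<lambda>n. \<integral>p. (\<Sum>i<n. f p * indicator (B i) (\<Phi> p)) \<partial>M) \<longlonglongrightarrow> (\<integral>p. f p * indicator (\<Union>i. B i) (\<Phi> p) \<partial>M)"
    proof (rule integral_dominated_convergence[where w="\<lambda>p. norm (f p)"])
      have ind: "(\<Sum>i<n. f p * indicator (B i) (\<Phi> p)) = f p * indicator (\<Union>i<n. B i) (\<Phi> p)" for n p
      proof -
        have "(\<Sum>i<n. indicator (B i) (\<Phi> p)) = (indicator (\<Union>i<n. B i) (\<Phi> p) :: real)"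
          using disj by (subst indicator_UN_disjoint) (auto simp: disjoint_family_on_def)
        then show ?thesis by (simp add: sum_distrib_left[symmetric])
      qed
      show "AE p in M. norm (\<Sum>i<n. f p * indicator (B i) (\<Phi> p)) \<le> norm (f p)" for n
        unfolding ind by (rule AE_I2) (auto simp: indicator_def)
      show "AE p in M. (\<lambda>n. \<Sum>i<n. f p * indicator (B i) (\<Phi> p)) \<longlonglongrightarrow> f p * indicator (\<Union>i. B i) (\<Phi> p)"
      proof (rule AE_I2)
        fix p
        have "(\<lambda>i. indicator (B i) (\<Phi> p) :: real) sums indicator (\<Union>i. B i) (\<Phi> p)"
          using disj by (intro indicator_sums) (auto simp: disjoint_family_on_def)
        then show "(\<lambda>n. \<Sum>i<n. f p * indicator (B i) (\<Phi> p)) \<longlonglongrightarrow> f p * indicator (\<Union>i. B i) (\<Phi> p)"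
          using sums_mult[of "\<lambda>i. indicator (B i) (\<Phi> p)" _ "f p"] by (simp add: sums_def)
      qed
      have UN: "(\<Union>i. B i) \<in> sets borel" by (intro sets.countable_UN) auto
      have "(\<lambda>p. indicator (\<Union>i. B i) (\<Phi> p) :: real) \<in> borel_measurable M"
        by (rule measurable_compose[OF _ borel_measurable_indicator[OF UN]]) measurable
      then show "(\<lambda>p. f p * indicator (\<Union>i. B i) (\<Phi> p)) \<in> borel_measurable M" by measurable
    qed (use f in auto)
    moreover have "(\<integral>p. (\<Sum>i<n. f p * indicator (B i) (\<Phi> p)) \<partial>M) = 0" for n
      using int IH by (subst Bochner_Integration.integral_sum) auto
    ultimately show "(\<integral>p. f p * indicator (\<Union>i. B i) (\<Phi> p) \<partial>M) = 0"
      by (simp add: LIMSEQ_const_iff)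
  qed simp
qed

lemma AE_zero_if_indicator_integrals_zero:
  assumes f: "integrable M f" and zero: "\<And>A. A \<in> sets M \<Longrightarrow> (\<integral>p. f p * indicator A p \<partial>M) = (0::real)"
  shows "AE p in M. f p = 0"
  using density_unique_real[OF f integrable_zero] zero
  by (simp add: set_lebesgue_integral_def mult.commute)

text \<open>The square of the positive part is the simplest \<open>C\<^sup>1\<close> function that vanishes on a half-line.\<close>

definition pos_sq :: "real \<Rightarrow> real" where "pos_sq z = (max 0 z)\<^sup>2"

lemma pos_sq_has_derivative: "(pos_sq has_real_derivative 2 * max 0 z) (at z)"
proof -
  consider "z > 0" | "z < 0" | "z = 0" by linarith
  then show ?thesis
  proof cases
    case 1
    have "((\<lambda>z. z\<^sup>2) has_real_derivative 2 * max 0 z) (at z)"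
      using 1 by (auto intro!: derivative_eq_intros)
    moreover have "\<forall>\<^sub>F y in nhds z. y\<^sup>2 = pos_sq y"
      using eventually_nhds_in_open[of "{0<..}" z] 1 by (auto elim!: eventually_mono simp: pos_sq_def)
    ultimately show ?thesis by (subst (asm) DERIV_cong_ev[OF refl _ refl]) auto
  next
    case 2
    have "((\<lambda>z. 0) has_real_derivative 2 * max 0 z) (at z)" using 2 by simp
    moreover have "\<forall>\<^sub>F y in nhds z. 0 = pos_sq y"
      using eventually_nhds_in_open[of "{..<0}" z] 2 by (auto elim!: eventually_mono simp: pos_sq_def)
    ultimately show ?thesis by (subst (asm) DERIV_cong_ev[OF refl _ refl]) auto
  next
    case 3
    have "((\<lambda>h. pos_sq h / h) \<longlongrightarrow> 0) (at 0)"
    proof (rule Lim_null_comparison)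
      show "\<forall>\<^sub>F h in at 0. norm (pos_sq h / h) \<le> \<bar>h\<bar>"
        by (intro always_eventually allI) (auto simp: pos_sq_def power2_eq_square max_def)
      show "((\<lambda>h::real. \<bar>h\<bar>) \<longlongrightarrow> 0) (at 0)" using tendsto_rabs_zero[OF tendsto_ident_at] by simp
    qed
    then show ?thesis using 3 by (simp add: DERIV_def pos_sq_def)
  qed
qed

text \<open>
  A \<open>C\<^sup>1\<close> approximation from below of the indicator of the interval from \<open>c\<close> to \<open>d\<close>, which improves as \<open>k\<close>
  grows. Inside the interval it equals \<open>1\<close> as soon as \<open>k ((x - c) (d - x))\<^sup>2 \<ge> 1\<close>, so it also serves as a plateau function.
\<close>

definition hat :: "real \<Rightarrow> real \<Rightarrow> real \<Rightarrow> real \<Rightarrow> real" where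
  "hat c d k x = 1 - pos_sq (1 - k * pos_sq ((x - c) * (d - x)))"

definition hat' :: "real \<Rightarrow> real \<Rightarrow> real \<Rightarrow> real \<Rightarrow> real" where
  "hat' c d k x = 4 * k * max 0 (1 - k * pos_sq ((x - c) * (d - x))) * max 0 ((x - c) * (d - x)) * (c + d - 2 * x)"

lemma pos_sq_continuous [continuous_intros]: "continuous_on S f \<Longrightarrow> continuous_on S (\<lambda>x. pos_sq (f x))"
  unfolding pos_sq_def by (intro continuous_intros)

lemma hat_has_derivative: "(hat c d k has_real_derivative hat' c d k x) (at x)"
proof -
  have 1: "((\<lambda>x. (x - c) * (d - x)) has_real_derivative (c + d - 2 * x)) (at x)"
    by (auto intro!: derivative_eq_intros)
  have 2: "((\<lambda>x. 1 - k * pos_sq ((x - c) * (d - x))) has_real_derivative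
      - (k * (2 * max 0 ((x - c) * (d - x)) * (c + d - 2 * x)))) (at x)"
    using DERIV_diff[OF DERIV_const DERIV_cmult[OF DERIV_chain2[OF pos_sq_has_derivative 1]], of 1 k] by simp
  show ?thesis
    unfolding hat_def[abs_def] hat'_def
    using DERIV_diff[OF DERIV_const DERIV_chain2[OF pos_sq_has_derivative 2], of 1]
    by (simp add: algebra_simps)
qed

lemma hat_continuous: "continuous_on S (hat c d k)" and hat'_continuous: "continuous_on S (hat' c d k)"
  unfolding hat_def[abs_def] hat'_def[abs_def] by (intro continuous_intros)+

lemma hat_bounds:
  assumes "k \<ge> 0"
  shows "0 \<le> hat c d k x" "hat c d k x \<le> 1"
proof -
  let ?z = "max 0 (1 - k * pos_sq ((x - c) * (d - x)))"
  have "0 \<le> ?z" "?z \<le> 1" using assms by (auto simp: pos_sq_def)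
  then have "?z\<^sup>2 \<le> 1" by (simp add: power_le_one)
  then show "0 \<le> hat c d k x" by (simp add: hat_def pos_sq_def)
  show "hat c d k x \<le> 1" by (simp add: hat_def pos_sq_def)
qed

lemma hat_outside:
  assumes "c \<le> d" "x \<notin> {c<..<d}"
  shows "hat c d k x = 0" "hat' c d k x = 0"
proof -
  have "(x - c) * (d - x) \<le> 0"
    using assms by (auto simp: mult_le_0_iff)
  then show "hat c d k x = 0" "hat' c d k x = 0" by (auto simp: hat_def hat'_def pos_sq_def)
qed

lemma hat_tendsto:
  assumes "c \<le> d"
  shows "(\<lambda>n. hat c d (real n) x) \<longlonglongrightarrow> indicator {c<..<d} x"
proof (cases "x \<in> {c<..<d}")
  case True
  let ?q = "pos_sq ((x - c) * (d - x))"
  have "(x - c) * (d - x) > 0" using True by (intro mult_pos_pos) auto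
  then have q: "?q > 0" unfolding pos_sq_def by (intro zero_less_power) simp
  obtain N :: nat where N: "1 / ?q < real N" using reals_Archimedean2 by blast
  have "hat c d (real n) x = 1" if "n \<ge> N" for n
  proof -
    have "1 / ?q \<le> real n" using N that by linarith
    then have "1 \<le> real n * ?q" using q by (simp add: field_simps)
    then show ?thesis by (simp add: hat_def pos_sq_def)
  qed
  then have "\<forall>\<^sub>F n in sequentially. hat c d (real n) x = indicator {c<..<d} x"
    using True by (auto simp: eventually_sequentially)
  then show ?thesis by (rule tendsto_eventually)
next
  case False
  then show ?thesis using hat_outside[OF assms False] by simp
qed

lemma hat_plateau:
  assumes "r \<ge> 0" "\<bar>x\<bar> \<le> r"
  shows "hat (- (r + 2)) (r + 2) 1 x = 1" "hat' (- (r + 2)) (r + 2) 1 x = 0"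
proof -
  have "1 * 1 \<le> (x + (r + 2)) * (r + 2 - x)" using assms by (intro mult_mono) auto
  then have "1 * 1 \<le> pos_sq ((x + (r + 2)) * (r + 2 - x))"
    unfolding pos_sq_def power2_eq_square by (intro mult_mono) auto
  moreover have "x - - (r + 2) = x + (r + 2)" by simp
  ultimately have "max 0 (1 - 1 * pos_sq ((x - - (r + 2)) * (r + 2 - x))) = 0" by (simp only:)
  then show "hat (- (r + 2)) (r + 2) 1 x = 1" "hat' (- (r + 2)) (r + 2) 1 x = 0"
    unfolding hat_def hat'_def pos_sq_def[of "1 - _"] by (simp_all only:) simp_all
qed

lemma antiderivative_vanishing_right:
  fixes g :: "real \<Rightarrow> real"
  assumes g: "continuous_on UNIV g" "\<And>t. t \<ge> b \<Longrightarrow> g t = 0"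
  shows "\<exists>G. (\<forall>t. (G has_real_derivative g t) (at t)) \<and> (\<forall>t\<ge>b. G t = 0)"
proof -
  have "isCont g x" for x using g(1) by (simp add: continuous_on_eq_continuous_at)
  then have "\<exists>F. \<forall>x. - \<infinity> < ereal x \<longrightarrow> ereal x < \<infinity> \<longrightarrow> (F has_vector_derivative g x) (at x)"
    by (intro einterval_antiderivative) auto
  then obtain F where "\<forall>x. - \<infinity> < ereal x \<longrightarrow> ereal x < \<infinity> \<longrightarrow> (F has_vector_derivative g x) (at x)" ..
  then have F: "(F has_real_derivative g t) (at t)" for t
    by (simp add: has_real_derivative_iff_has_vector_derivative)
  have "F t - F b = 0" if "t \<ge> b" for t
  proof (cases "t = b")
    case False
    then have "b < t" using that by simp
    have "\<exists>z>b. z < t \<and> F t - F b = (t - b) * g z"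
      by (rule MVT2[OF \<open>b < t\<close>]) (rule F)
    then obtain z where "b < z" "F t - F b = (t - b) * g z" by (elim exE conjE)
    moreover have "g z = 0" by (rule g(2)) (use \<open>b < z\<close> in linarith)
    ultimately show ?thesis by simp
  qed simp
  then have "\<forall>t\<ge>b. F t - F b = 0" by blast
  moreover have "\<forall>t. ((\<lambda>t. F t - F b) has_real_derivative g t) (at t)"
  proof
    fix t show "((\<lambda>t. F t - F b) has_real_derivative g t) (at t)"
      using DERIV_diff[OF F[of t] DERIV_const[of "F b"]] by simp
  qed
  ultimately show ?thesis by (intro exI[of _ "\<lambda>t. F t - F b"] conjI)
qed

text \<open>
  The functions composed with \<open>Hn n\<close> are controlled only for times in the slab. They vanish from the earlier
  time \<open>s1\<close> on, so replacing them by \<open>0\<close> from \<open>s2\<close> on gives test functions on the whole strip.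
\<close>

definition cut :: "real \<Rightarrow> (real \<times> real \<Rightarrow> real) \<Rightarrow> real \<times> real \<Rightarrow> real" where
  "cut s f p = (if fst p < s then f p else 0)"

lemma cut_test_function:
  assumes T: "0 < s1" "s1 < s2" "s2 \<le> T"
    and d: "\<And>p. 0 \<le> fst p \<Longrightarrow> fst p < s2 \<Longrightarrow> (\<phi> has_derivative (\<lambda>h. \<phi>t p * fst h + \<phi>x p * snd h)) (at p)"
    and cont: "continuous_on ({0..<s2} \<times> UNIV) \<phi>t" "continuous_on ({0..<s2} \<times> UNIV) \<phi>x"
    and zero: "\<And>p. s1 \<le> fst p \<Longrightarrow> fst p < s2 \<Longrightarrow> \<phi> p = 0 \<and> \<phi>t p = 0 \<and> \<phi>x p = 0"
    and supp: "\<And>p. 0 \<le> fst p \<Longrightarrow> fst p < s2 \<Longrightarrow> \<bar>snd p\<bar> > r \<Longrightarrow> \<phi> p = 0"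
  shows "C1_on (spacetime0 T) (cut s2 \<phi>) (cut s2 \<phi>t) (cut s2 \<phi>x)"
    and "compactly_supported_in (spacetime0 T) (cut s2 \<phi>)"
proof -
  have cutcont: "continuous_on (spacetime0 T) (cut s2 f)"
    if f: "continuous_on ({0..<s2} \<times> UNIV) f" and f0: "\<And>p. s1 \<le> fst p \<Longrightarrow> fst p < s2 \<Longrightarrow> f p = 0" for f
  proof -
    let ?A = "{0..<s2} \<times> (UNIV :: real set)" and ?B = "{s1<..<T} \<times> (UNIV :: real set)"
    have U: "spacetime0 T = ?A \<union> ?B" using T by auto
    have "openin (top_of_set (spacetime0 T)) ?A"
      unfolding openin_open by (intro exI[of _ "{..<s2} \<times> UNIV"]) (use T in \<open>auto intro: open_Times\<close>)
    moreover have "openin (top_of_set (spacetime0 T)) ?B"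
      unfolding openin_open by (intro exI[of _ "{s1<..} \<times> UNIV"]) (use T in \<open>auto intro: open_Times\<close>)
    moreover have "continuous_on ?A (cut s2 f)"
      using f by (rule continuous_on_eq) (auto simp: cut_def)
    moreover have "continuous_on ?B (cut s2 f)"
      by (rule continuous_on_eq[OF continuous_on_const[of _ 0]]) (use f0 in \<open>auto simp: cut_def\<close>)
    ultimately show ?thesis unfolding U by (rule continuous_on_Un_local_open)
  qed
  have deriv: "(cut s2 \<phi> has_derivative (\<lambda>h. cut s2 \<phi>t p * fst h + cut s2 \<phi>x p * snd h)) (at p within spacetime0 T)"
    if p: "p \<in> spacetime0 T" for p
  proof (cases "fst p < s2")
    case True
    have "(cut s2 \<phi> has_derivative (\<lambda>h. \<phi>t p * fst h + \<phi>x p * snd h)) (at p)"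
    proof (rule has_derivative_transform_within_open)
      show "(\<phi> has_derivative (\<lambda>h. \<phi>t p * fst h + \<phi>x p * snd h)) (at p)"
        by (rule d) (use True p in \<open>auto simp: mem_Times_iff\<close>)
      show "open ({..<s2} \<times> (UNIV :: real set))" by (intro open_Times) auto
    qed (use True in \<open>auto simp: cut_def mem_Times_iff\<close>)
    then have "(cut s2 \<phi> has_derivative (\<lambda>h. \<phi>t p * fst h + \<phi>x p * snd h)) (at p within spacetime0 T)"
      by (rule has_derivative_at_withinI)
    moreover have "cut s2 \<phi>t p = \<phi>t p" "cut s2 \<phi>x p = \<phi>x p" using True by (simp_all add: cut_def)
    ultimately show ?thesis by (simp only:)
  next
    case False
    have "(cut s2 \<phi> has_derivative (\<lambda>h. 0)) (at p)"
    proof (rule has_derivative_transform_within_open)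
      show "((\<lambda>_. 0) has_derivative (\<lambda>h. 0)) (at p)" by (rule has_derivative_const)
      show "open ({s1<..} \<times> (UNIV :: real set))" by (intro open_Times) auto
      show "0 = cut s2 \<phi> q" if "q \<in> {s1<..} \<times> UNIV" for q
        using that zero[of q] by (auto simp: cut_def)
    qed (use False T in \<open>auto simp: mem_Times_iff\<close>)
    then have "(cut s2 \<phi> has_derivative (\<lambda>h. 0)) (at p within spacetime0 T)"
      by (rule has_derivative_at_withinI)
    moreover have "cut s2 \<phi>t p = 0" "cut s2 \<phi>x p = 0" using False by (simp_all add: cut_def)
    ultimately show ?thesis by (simp only: mult_zero_left add_0_left)
  qed
  show "C1_on (spacetime0 T) (cut s2 \<phi>) (cut s2 \<phi>t) (cut s2 \<phi>x)"
    unfolding C1_on_def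
    by (intro conjI ballI cutcont cont deriv) (use zero in simp_all)
  have "p \<in> {0..s1} \<times> {-r..r}" if "p \<in> support_on (spacetime0 T) (cut s2 \<phi>)" for p
  proof -
    have p: "0 \<le> fst p" "cut s2 \<phi> p \<noteq> 0"
      using that by (auto simp: support_on_def)
    then have p2: "fst p < s2" "\<phi> p \<noteq> 0" unfolding cut_def by (meson, meson)
    have "fst p \<le> s1" using zero[of p] p2 by linarith
    moreover have "\<bar>snd p\<bar> \<le> r" using supp[of p] p p2 by linarith
    ultimately show ?thesis using p(1) by (simp add: mem_Times_iff abs_le_iff)
  qed
  then have "support_on (spacetime0 T) (cut s2 \<phi>) \<subseteq> {0..s1} \<times> {-r..r}" ..
  then have sub: "closure (support_on (spacetime0 T) (cut s2 \<phi>)) \<subseteq> {0..s1} \<times> {-r..r}"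
    by (rule closure_minimal) (intro closed_Times closed_atLeastAtMost)
  have "compact ({0..s1} \<times> {-r..r} \<inter> closure (support_on (spacetime0 T) (cut s2 \<phi>)))"
    by (intro compact_Int_closed compact_Times compact_Icc closed_closure)
  then have 1: "compact (closure (support_on (spacetime0 T) (cut s2 \<phi>)))"
    unfolding Int_absorb1[OF sub] .
  have "{0..s1} \<times> {-r..r} \<subseteq> spacetime0 T"
    using T by (intro Sigma_mono) auto
  with sub have 2: "closure (support_on (spacetime0 T) (cut s2 \<phi>)) \<subseteq> spacetime0 T"
    by (rule order_trans)
  show "compactly_supported_in (spacetime0 T) (cut s2 \<phi>)"
    unfolding compactly_supported_in_def using 1 2 by (rule conjI)
qed

section \<open>Uniqueness\<close>

locale transport = potential T c C L \<rho> J e R Jn Rt Rx Jt Jx Hn H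
  for T c C L \<rho> J e R Jn Rt Rx Jt Jx Hn H +
  fixes b :: "real \<times> real \<Rightarrow> real"
  assumes b_meas [measurable]: "b \<in> borel_measurable borel"
    and J_eq: "\<And>p. J p = \<rho> p * b p"
begin

lemma b_bound: "\<bar>b p\<bar> \<le> L / c"
proof -
  have "c * \<bar>b p\<bar> \<le> \<rho> p * \<bar>b p\<bar>" using \<rho>_bounds(1) by (intro mult_right_mono) auto
  also have "\<dots> = \<bar>J p\<bar>" using \<rho>_pos[of p] by (simp add: J_eq abs_mult)
  also have "\<dots> \<le> L" by (rule J_bound)
  finally show ?thesis using c(1) by (simp add: pos_le_divide_eq mult.commute)
qed

lemma strip_sets [measurable]: "spacetime T \<in> sets borel"
  by (intro borel_Times) auto

text \<open>The weak formulation with initial condition \<open>0\<close>, for Borel functions and the Borel measure on the plane.\<close>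

definition vanishing_weak_solution :: "(real \<times> real \<Rightarrow> real) \<Rightarrow> bool" where
  "vanishing_weak_solution v \<longleftrightarrow> v \<in> borel_measurable borel \<and>
     (\<forall>\<phi> \<phi>t \<phi>x. C1_on (spacetime0 T) \<phi> \<phi>t \<phi>x \<and> compactly_supported_in (spacetime0 T) \<phi> \<longrightarrow>
       integrable lborel (\<lambda>p. indicator (spacetime T) p * (v p * (\<phi>t p + b p * \<phi>x p))) \<and>
       (\<integral>p. indicator (spacetime T) p * (v p * (\<phi>t p + b p * \<phi>x p)) \<partial>lborel) = 0)"

text \<open>
  Local integrability inside the open strip does not control \<open>v\<close> near \<open>t = 0\<close>. The integrability of the
  weak integrand does: \<open>\<phi> = G(t) \<chi>(x)\<close> with \<open>G' = 1\<close> and \<open>\<chi> = 1\<close> on the box satisfies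
  \<open>\<partial>\<^sub>t \<phi> + b \<partial>\<^sub>x \<phi> = 1\<close> there.
\<close>

lemma vanishing_weak_solution_integrable:
  assumes v: "vanishing_weak_solution v" and s: "0 < s" "s < T" and r: "r \<ge> 0"
  shows "integrable lborel (\<lambda>p. indicator ({0<..<s} \<times> {-r..r}) p * v p)"
proof -
  define s1 where "s1 = (s + T) / 2"
  have s1: "s < s1" "s1 < T" using s by (auto simp: s1_def)
  define g where "g t = max 0 (min 1 ((s1 - t) / (s1 - s)))" for t
  have g: "continuous_on UNIV g" "g t = 0" if "t \<ge> s1" for t
    unfolding g_def using s1 that by (auto intro!: continuous_intros simp: divide_nonpos_pos)
  have g1: "g t = 1" if "t \<le> s" for t
    using that s1 by (simp add: g_def)
  have gc: "continuous_on UNIV g" using g(1)[of s1] by simp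
  obtain G where G: "\<And>t. (G has_real_derivative g t) (at t)" "\<And>t. t \<ge> s1 \<Longrightarrow> G t = 0"
    using antiderivative_vanishing_right[OF gc g(2)] by blast
  let ?h = "hat (- (r + 2)) (r + 2) 1" and ?h' = "hat' (- (r + 2)) (r + 2) 1"
  have Gc: "continuous_on UNIV G"
    using G(1) by (intro continuous_at_imp_continuous_on ballI DERIV_isCont) blast
  have C1: "C1_on (spacetime0 T) (cut T (tensor G ?h)) (cut T (tensor g ?h)) (cut T (tensor G ?h'))"
    and cs: "compactly_supported_in (spacetime0 T) (cut T (tensor G ?h))"
  proof (atomize (full), intro conjI)
    have d: "(tensor G ?h has_derivative (\<lambda>q. tensor g ?h p * fst q + tensor G ?h' p * snd q)) (at p)" for p
      using tensor_has_derivative[OF G(1)[of "fst p"] hat_has_derivative[of _ _ _ "snd p"]] by (simp add: tensor_def)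
    have c1: "continuous_on ({0..<T} \<times> UNIV) (tensor g ?h)"
      by (rule continuous_on_subset[OF tensor_continuous[OF gc hat_continuous]]) simp
    have c2: "continuous_on ({0..<T} \<times> UNIV) (tensor G ?h')"
      by (rule continuous_on_subset[OF tensor_continuous[OF Gc hat'_continuous]]) simp
    have z: "tensor G ?h p = 0 \<and> tensor g ?h p = 0 \<and> tensor G ?h' p = 0" if "s1 \<le> fst p" for p
      using that g(2) G(2) by (simp add: tensor_def)
    have sp: "tensor G ?h p = 0" if "\<bar>snd p\<bar> > r + 2" for p
    proof -
      have "snd p \<notin> {- (r + 2)<..<r + 2}" using that by auto
      then show ?thesis using hat_outside(1)[of "- (r + 2)" "r + 2" "snd p"] r by (simp add: tensor_def)
    qed
    show "C1_on (spacetime0 T) (cut T (tensor G ?h)) (cut T (tensor g ?h)) (cut T (tensor G ?h'))"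
      by (rule cut_test_function(1)[of s1 T T _ _ _ "r + 2"]) (use s s1 d c1 c2 z sp in auto)
    show "compactly_supported_in (spacetime0 T) (cut T (tensor G ?h))"
      by (rule cut_test_function(2)[of s1 T T _ "tensor g ?h" "tensor G ?h'" "r + 2"]) (use s s1 d c1 c2 z sp in auto)
  qed
  have "integrable lborel (\<lambda>p. indicator (spacetime T) p * (v p * (cut T (tensor g ?h) p + b p * cut T (tensor G ?h') p)))"
    using v C1 cs unfolding vanishing_weak_solution_def by blast
  from integrable_mult_indicator[OF _ this, of "{0<..<s} \<times> {-r..r}"]
  have "integrable lborel (\<lambda>p. indicator ({0<..<s} \<times> {-r..r}) p *\<^sub>R
      (indicator (spacetime T) p * (v p * (cut T (tensor g ?h) p + b p * cut T (tensor G ?h') p))))"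
    by (simp add: borel_Times)
  also have "(\<lambda>p. indicator ({0<..<s} \<times> {-r..r}) p *\<^sub>R
      (indicator (spacetime T) p * (v p * (cut T (tensor g ?h) p + b p * cut T (tensor G ?h') p))))
      = (\<lambda>p. indicator ({0<..<s} \<times> {-r..r}) p * v p)"
  proof
    fix p :: "real \<times> real"
    show "indicator ({0<..<s} \<times> {-r..r}) p *\<^sub>R
      (indicator (spacetime T) p * (v p * (cut T (tensor g ?h) p + b p * cut T (tensor G ?h') p)))
      = indicator ({0<..<s} \<times> {-r..r}) p * v p"
    proof (cases "p \<in> {0<..<s} \<times> {-r..r}")
      case True
      then have p: "0 < fst p" "fst p < s" "\<bar>snd p\<bar> \<le> r" by (auto simp: mem_Times_iff)
      have "cut T (tensor g ?h) p = 1" "cut T (tensor G ?h') p = 0"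
        using p s g1[of "fst p"] hat_plateau[OF r p(3)] by (simp_all add: cut_def tensor_def)
      moreover have "p \<in> spacetime T" using p s by (auto simp: mem_Times_iff)
      ultimately show ?thesis by simp
    qed simp
  qed
  finally show ?thesis .
qed

text \<open>
  The potentials grow at least like \<open>c \<bar>x\<bar>\<close>, uniformly in time, so \<open>h (Hn n)\<close> and \<open>h H\<close> are compactly
  supported in space whenever \<open>h\<close> is compactly supported.
\<close>

lemma Hn_large:
  assumes "- e n < t" "t < T - 2 * e n" "0 \<le> t" "\<bar>x\<bar> > (K + L * T) / c"
  shows "\<bar>Hn n (t, x)\<bar> > K"
proof -
  have "c * \<bar>x\<bar> \<le> \<bar>Hn n (t, x) - Hn n (t, 0)\<bar>"
    using Hn_x_bounds(1)[of n t 0 x] Hn_x_bounds(1)[of n t x 0] assms(1,2) by (cases "x \<ge> 0") auto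
  moreover have "\<bar>Hn n (t, 0)\<bar> \<le> L * T"
    using Hn_abs_le[of n t 0] assms mult_left_mono[of t T L] L e(1)[of n] by simp
  moreover have "c * \<bar>x\<bar> > K + L * T" using assms(4) c(1) by (simp add: pos_divide_less_eq mult.commute)
  ultimately show ?thesis by linarith
qed

lemma H_large:
  assumes "0 \<le> t" "t < T" "\<bar>x\<bar> > (K + L * T) / c"
  shows "\<bar>H (t, x)\<bar> > K"
proof -
  have "c * \<bar>x\<bar> \<le> \<bar>H (t, x) - H (t, 0)\<bar>" using H_x_expand[of x 0 t] by simp
  moreover have "\<bar>H (t, 0)\<bar> \<le> L * T" using H_abs_le[of t 0] assms by simp
  moreover have "c * \<bar>x\<bar> > K + L * T" using assms(3) c(1) by (simp add: pos_divide_less_eq mult.commute)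
  ultimately show ?thesis by linarith
qed

text \<open>
  The test functions are \<open>G(t) h(Hn)\<close> with \<open>G' = g\<close>. Applying \<open>\<partial>\<^sub>t + b \<partial>\<^sub>x\<close> gives \<open>g h(Hn)\<close> plus the error
  \<open>G h'(Hn) (b R - Jn)\<close>, which is bounded and tends to \<open>G h'(H) (b \<rho> - J) = 0\<close> almost everywhere. Since \<open>G\<close>
  may be nonzero at \<open>t = 0\<close>, every \<open>g\<close> that vanishes near \<open>T\<close> is admissible.
\<close>

lemma vanishing_weak_solution_orthogonal:
  assumes v: "vanishing_weak_solution v"
    and s1: "0 < s1" "s1 < T"
    and g: "continuous_on UNIV g" "\<And>t. t \<ge> s1 \<Longrightarrow> g t = 0"
    and h: "\<And>y. (h has_real_derivative h' y) (at y)" "continuous_on UNIV h'"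
      "\<And>y. \<bar>y\<bar> > K \<Longrightarrow> h y = 0 \<and> h' y = 0"
  shows "(\<integral>p. indicator (spacetime T) p * (v p * (g (fst p) * h (H p))) \<partial>lborel) = 0"
proof -
  have [measurable]: "v \<in> borel_measurable borel" using v by (simp add: vanishing_weak_solution_def)
  obtain G where G: "\<And>t. (G has_real_derivative g t) (at t)" "\<And>t. t \<ge> s1 \<Longrightarrow> G t = 0"
    using antiderivative_vanishing_right[OF g] by blast
  have Gc: "continuous_on UNIV G"
    using G(1) by (intro continuous_at_imp_continuous_on ballI DERIV_isCont) blast
  have hc: "continuous_on UNIV h"
    using h(1) by (intro continuous_at_imp_continuous_on ballI DERIV_isCont) blast
  have [measurable]: "g \<in> borel_measurable borel" "h \<in> borel_measurable borel"
    using g(1) hc by (auto intro: borel_measurable_continuous_onI)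
  define s2 where "s2 = (s1 + T) / 2"
  have s2: "s1 < s2" "s2 < T" using s1 by (auto simp: s2_def)
  define r where "r = max 0 ((K + L * T) / c)"
  have r: "r \<ge> 0" "(K + L * T) / c \<le> r" by (auto simp: r_def)
  have supp: "z \<notin> cbox (- \<bar>K\<bar>) \<bar>K\<bar> \<Longrightarrow> h z = 0" "z \<notin> cbox (- \<bar>K\<bar>) \<bar>K\<bar> \<Longrightarrow> h' z = 0" for z
    using h(3)[of z] by auto
  obtain Bh where Bh: "Bh > 0" "\<And>y. \<bar>h y\<bar> \<le> Bh"
    using continuous_compact_support_bounded[OF hc supp(1)] by blast
  obtain Bh' where Bh': "Bh' > 0" "\<And>y. \<bar>h' y\<bar> \<le> Bh'"
    using continuous_compact_support_bounded[OF h(2) supp(2)] by blast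
  have bd: "\<exists>B>0. \<forall>t\<in>{0..T}. \<bar>f t\<bar> \<le> B" if "continuous_on UNIV f" for f :: "real \<Rightarrow> real"
  proof -
    have "bounded (f ` {0..T})"
      by (intro compact_imp_bounded compact_continuous_image continuous_on_subset[OF that]) auto
    then show ?thesis unfolding bounded_pos by auto
  qed
  obtain Bg where Bg: "Bg > 0" "\<And>t. t \<in> {0..T} \<Longrightarrow> \<bar>g t\<bar> \<le> Bg" using bd[OF g(1)] by blast
  obtain BG where BG: "BG > 0" "\<And>t. t \<in> {0..T} \<Longrightarrow> \<bar>G t\<bar> \<le> BG" using bd[OF Gc] by blast
  define \<phi> where "\<phi> n p = G (fst p) * h (Hn n p)" for n p
  define \<phi>t where "\<phi>t n p = g (fst p) * h (Hn n p) - G (fst p) * h' (Hn n p) * Jn n p" for n p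
  define \<phi>x where "\<phi>x n p = G (fst p) * h' (Hn n p) * R n p" for n p
  \<comment> \<open>from \<open>N\<close> on the slab contains the supports, so only the shifted sequence is used below\<close>
  obtain N where N: "\<And>n. n \<ge> N \<Longrightarrow> s2 < T - 2 * e n"
    using eventually_slab[of s2] s1 s2 by (auto simp: eventually_sequentially)
  have slab: "- e n < t" "t < T - 2 * e n" if "n \<ge> N" "0 \<le> t" "t < s2" for n t
    using N[OF that(1)] e(1)[of n] that by linarith+
  define F where "F n p = indicator (spacetime T) p * (v p * (cut s2 (\<phi>t n) p + b p * cut s2 (\<phi>x n) p))" for n p
  have F: "integrable lborel (F n)" "integral\<^sup>L lborel (F n) = 0" if n: "n \<ge> N" for n
  proof -
    have d: "(\<phi> n has_derivative (\<lambda>q. \<phi>t n p * fst q + \<phi>x n p * snd q)) (at p)"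
      if "0 \<le> fst p" "fst p < s2" for p
    proof -
      have "((\<lambda>p. G (fst p)) has_derivative (\<lambda>q. g (fst p) * fst q)) (at p)"
        using diff_chain_at[of fst fst p G "(*) (g (fst p))"] G(1)
        by (simp add: o_def has_field_derivative_def has_derivative_fst)
      moreover have "((\<lambda>p. h (Hn n p)) has_derivative (\<lambda>q. h' (Hn n p) * (- Jn n p * fst q + R n p * snd q))) (at p)"
        using diff_chain_at[OF dHn, of n p h "(*) (h' (Hn n p))"] h(1) slab[OF n that]
        by (simp add: o_def has_field_derivative_def)
      ultimately have "(\<phi> n has_derivative (\<lambda>q. G (fst p) * (h' (Hn n p) * (- Jn n p * fst q + R n p * snd q))
          + (g (fst p) * fst q) * h (Hn n p))) (at p)"
        unfolding \<phi>_def[abs_def] by (rule has_derivative_mult)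
      then show ?thesis
        by (rule has_derivative_eq_rhs) (simp add: fun_eq_iff \<phi>t_def \<phi>x_def algebra_simps)
    qed
    have Hc: "continuous_on ({0..<s2} \<times> UNIV) (Hn n)"
    proof (intro continuous_at_imp_continuous_on ballI)
      fix p :: "real \<times> real" assume "p \<in> {0..<s2} \<times> UNIV"
      then have "(Hn n has_derivative (\<lambda>h. - Jn n p * fst h + R n p * snd h)) (at p)"
        using slab[OF n, of "fst p"] by (intro dHn) (auto simp: mem_Times_iff)
      then show "isCont (Hn n) p" by (rule has_derivative_continuous)
    qed
    have JR: "continuous_on S (Jn n)" "continuous_on S (R n)" for S
      using dJ dR by (meson continuous_at_imp_continuous_on has_derivative_continuous)+
    have co: "continuous_on S (\<lambda>p. f (fst p))" if "continuous_on UNIV f" for f :: "real \<Rightarrow> real" and S :: "(real \<times> real) set"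
      by (rule continuous_on_compose2[OF that]) (auto intro: continuous_intros)
    have cH: "continuous_on ({0..<s2} \<times> UNIV) (\<lambda>p. f (Hn n p))" if "continuous_on UNIV f" for f :: "real \<Rightarrow> real"
      by (rule continuous_on_compose2[OF that Hc]) auto
    have c1: "continuous_on ({0..<s2} \<times> UNIV) (\<phi>t n)"
      unfolding \<phi>t_def[abs_def]
      by (intro continuous_on_diff continuous_on_mult co[OF g(1)] co[OF Gc] cH[OF hc] cH[OF h(2)] JR)
    have c2: "continuous_on ({0..<s2} \<times> UNIV) (\<phi>x n)"
      unfolding \<phi>x_def[abs_def]
      by (intro continuous_on_mult co[OF Gc] cH[OF h(2)] JR)
    have z: "\<phi> n p = 0 \<and> \<phi>t n p = 0 \<and> \<phi>x n p = 0" if "s1 \<le> fst p" "fst p < s2" for p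
      using that g(2) G(2) by (simp add: \<phi>_def \<phi>t_def \<phi>x_def)
    have sp: "\<phi> n p = 0" if "0 \<le> fst p" "fst p < s2" "\<bar>snd p\<bar> > r" for p
      using Hn_large[of n "fst p" K "snd p"] slab[OF n that(1,2)] h(3)[of "Hn n p"] that r by (simp add: \<phi>_def)
    have "C1_on (spacetime0 T) (cut s2 (\<phi> n)) (cut s2 (\<phi>t n)) (cut s2 (\<phi>x n))"
      by (rule cut_test_function(1)[of s1 s2 T _ _ _ r]) (use s1 s2 d c1 c2 z sp in auto)
    moreover have "compactly_supported_in (spacetime0 T) (cut s2 (\<phi> n))"
      by (rule cut_test_function(2)[of s1 s2 T _ "\<phi>t n" "\<phi>x n" r]) (use s1 s2 d c1 c2 z sp in auto)
    ultimately show "integrable lborel (F n)" "integral\<^sup>L lborel (F n) = 0"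
      using v unfolding vanishing_weak_solution_def F_def[abs_def] by blast+
  qed
  define w where "w p = (Bg * Bh + BG * Bh' * (L + L / c * C)) * \<bar>indicator ({0<..<s1} \<times> {-r..r}) p * v p\<bar>" for p
  have "(\<lambda>n. integral\<^sup>L lborel (F (n + N))) \<longlonglongrightarrow>
      (\<integral>p. indicator (spacetime T) p * (v p * (g (fst p) * h (H p))) \<partial>lborel)"
  proof (rule integral_dominated_convergence[where w=w])
    show "integrable lborel w"
      unfolding w_def by (intro integrable_mult_right integrable_abs vanishing_weak_solution_integrable v s1 r)
    have "(\<lambda>p. g (fst p)) \<in> borel_measurable (borel :: (real \<times> real) measure)"
      by (intro borel_measurable_continuous_onI continuous_on_compose2[OF g(1)] continuous_on_fst continuous_on_id) auto
    then show "(\<lambda>p. indicator (spacetime T) p * (v p * (g (fst p) * h (H p)))) \<in> borel_measurable lborel"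
      by measurable
    show "F (n + N) \<in> borel_measurable lborel" for n
      using F(1)[of "n + N"] by (intro borel_measurable_integrable) simp
    show "AE p in lborel. (\<lambda>n. F (n + N) p) \<longlonglongrightarrow> indicator (spacetime T) p * (v p * (g (fst p) * h (H p)))"
      using AE_conv
    proof eventually_elim
      case (elim p)
      show ?case
      proof (cases "p \<in> spacetime T \<and> fst p < s2")
        case False
        then show ?thesis using g(2)[of "fst p"] s2 by (auto simp: F_def cut_def indicator_def)
      next
        case True
        then have p: "0 \<le> fst p" "fst p < T" by (auto simp: mem_Times_iff)
        have Hl: "(\<lambda>n. Hn n p) \<longlonglongrightarrow> H p" using H_lim[OF p, of "snd p"] by simp
        have hl: "(\<lambda>n. h (Hn n p)) \<longlonglongrightarrow> h (H p)" "(\<lambda>n. h' (Hn n p)) \<longlonglongrightarrow> h' (H p)"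
          using continuous_on_tendsto_compose[OF hc Hl] continuous_on_tendsto_compose[OF h(2) Hl] by auto
        have "(\<lambda>n. indicator (spacetime T) p * (v p * (\<phi>t n p + b p * \<phi>x n p))) \<longlonglongrightarrow>
           indicator (spacetime T) p * (v p * ((g (fst p) * h (H p) - G (fst p) * h' (H p) * J p) + b p * (G (fst p) * h' (H p) * \<rho> p)))"
          unfolding \<phi>t_def \<phi>x_def using elim by (intro tendsto_intros hl) auto
        then have "(\<lambda>n. indicator (spacetime T) p * (v p * (\<phi>t n p + b p * \<phi>x n p))) \<longlonglongrightarrow>
           indicator (spacetime T) p * (v p * (g (fst p) * h (H p)))"
          by (simp add: J_eq algebra_simps)
        then have "(\<lambda>n. F n p) \<longlonglongrightarrow> indicator (spacetime T) p * (v p * (g (fst p) * h (H p)))"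
          using True by (simp add: F_def cut_def)
        then show ?thesis by (rule LIMSEQ_ignore_initial_segment)
      qed
    qed
    show "AE p in lborel. norm (F (n + N) p) \<le> w p" for n
    proof (rule AE_I2)
      fix p :: "real \<times> real"
      let ?n = "n + N"
      have pos: "0 \<le> Bg * Bh + BG * Bh' * (L + L / c * C)"
        using Bg(1) Bh(1) BG(1) Bh'(1) L c C_pos by (intro add_nonneg_nonneg mult_nonneg_nonneg divide_nonneg_pos) auto
      show "norm (F ?n p) \<le> w p"
      proof (cases "p \<in> spacetime T \<and> fst p < s1 \<and> \<bar>snd p\<bar> \<le> r")
        case True
        then have p: "0 < fst p" "fst p < s1" "\<bar>snd p\<bar> \<le> r" "fst p \<in> {0..T}" by (auto simp: mem_Times_iff)
        have t1: "\<bar>g (fst p) * h (Hn ?n p)\<bar> \<le> Bg * Bh"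
          unfolding abs_mult using Bg Bh p by (intro mult_mono) auto
        have "\<bar>b p * R ?n p - Jn ?n p\<bar> \<le> \<bar>b p\<bar> * \<bar>R ?n p\<bar> + \<bar>Jn ?n p\<bar>"
          using abs_triangle_ineq4[of "b p * R ?n p" "Jn ?n p"] by (simp add: abs_mult)
        also have "\<dots> \<le> L / c * C + L"
          using b_bound[of p] R_bounds[of ?n p] Jn_bound[of ?n p] c L by (intro add_mono mult_mono) auto
        finally have t2: "\<bar>b p * R ?n p - Jn ?n p\<bar> \<le> L + L / c * C" by simp
        have "\<bar>G (fst p) * h' (Hn ?n p) * (b p * R ?n p - Jn ?n p)\<bar> \<le> BG * Bh' * (L + L / c * C)"
          unfolding abs_mult using BG Bh' p t2 by (intro mult_mono) auto
        then have "\<bar>g (fst p) * h (Hn ?n p) + G (fst p) * h' (Hn ?n p) * (b p * R ?n p - Jn ?n p)\<bar>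
            \<le> Bg * Bh + BG * Bh' * (L + L / c * C)"
          using t1 by linarith
        moreover have "\<phi>t ?n p + b p * \<phi>x ?n p = g (fst p) * h (Hn ?n p) + G (fst p) * h' (Hn ?n p) * (b p * R ?n p - Jn ?n p)"
          by (simp add: \<phi>t_def \<phi>x_def algebra_simps)
        ultimately have "\<bar>v p\<bar> * \<bar>\<phi>t ?n p + b p * \<phi>x ?n p\<bar> \<le> \<bar>v p\<bar> * (Bg * Bh + BG * Bh' * (L + L / c * C))"
          by (intro mult_left_mono) auto
        moreover have "p \<in> {0<..<s1} \<times> {-r..r}" using p by (auto simp: mem_Times_iff)
        ultimately show ?thesis
          using True p s2 by (simp add: F_def w_def cut_def abs_mult mult.commute)
      next
        case False
        have "F ?n p = 0"
        proof (cases "p \<in> spacetime T \<and> fst p < s2")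
          case True
          then have p: "0 < fst p" "fst p < s2" by (auto simp: mem_Times_iff)
          show ?thesis
          proof (cases "fst p < s1")
            case True
            then have "\<bar>snd p\<bar> > r" using False \<open>p \<in> spacetime T \<and> fst p < s2\<close> by auto
            then have "\<bar>Hn ?n p\<bar> > K"
              using Hn_large[of ?n "fst p" K "snd p"] slab[of ?n "fst p"] p r by simp
            then show ?thesis using h(3) by (simp add: F_def cut_def \<phi>t_def \<phi>x_def)
          next
            case False
            then show ?thesis using g(2)[of "fst p"] G(2)[of "fst p"] by (simp add: F_def cut_def \<phi>t_def \<phi>x_def)
          qed
        qed (auto simp: F_def cut_def)
        then show ?thesis using pos by (simp add: w_def)
      qed
    qed
  qed
  then show ?thesis using F(2) by (simp add: LIMSEQ_const_iff)
qed

lemma vanishing_weak_solution_rectangle: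
  assumes v: "vanishing_weak_solution v" and t1: "t1 < T"
  shows "integrable lborel (\<lambda>p. indicator (spacetime T) p * (v p * (indicator {t0<..<t1} (fst p) * indicator {y0<..<y1} (H p))))"
    and "(\<integral>p. indicator (spacetime T) p * (v p * (indicator {t0<..<t1} (fst p) * indicator {y0<..<y1} (H p))) \<partial>lborel) = 0"
proof -
  have [measurable]: "v \<in> borel_measurable borel" using v by (simp add: vanishing_weak_solution_def)
  have mfst: "(\<lambda>p. f (fst p)) \<in> borel_measurable borel" if "f \<in> borel_measurable borel"
    for f :: "real \<Rightarrow> real"
    by (rule measurable_compose[OF _ that]) (intro borel_measurable_continuous_onI continuous_on_fst continuous_on_id)
  define K where "K = max \<bar>y0\<bar> \<bar>y1\<bar>"
  define r where "r = max 0 ((K + L * T) / c)"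
  have r: "r \<ge> 0" "(K + L * T) / c \<le> r" by (auto simp: r_def)
  define s where "s = max (T / 2) t1"
  have s: "0 < s" "s < T" "t1 \<le> s" using T t1 by (auto simp: s_def)
  let ?w = "\<lambda>p. \<bar>indicator ({0<..<s} \<times> {-r..r}) p * v p\<bar>"
  have w: "integrable lborel ?w"
    by (intro integrable_abs vanishing_weak_solution_integrable v s r)
  have bound: "norm (indicator (spacetime T) p * (v p * (a * k))) \<le> ?w p"
    if "0 \<le> a" "a \<le> 1" "0 \<le> k" "k \<le> 1" "fst p \<ge> t1 \<Longrightarrow> a = 0" "\<bar>H p\<bar> > K \<Longrightarrow> k = 0" for a k p
  proof (cases "p \<in> spacetime T \<and> fst p < s \<and> \<bar>snd p\<bar> \<le> r")
    case True
    then have p: "p \<in> {0<..<s} \<times> {-r..r}" "p \<in> spacetime T" by (auto simp: mem_Times_iff)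
    have "a * k \<le> 1" using that by (simp add: mult_le_one)
    then have "\<bar>v p\<bar> * (a * k) \<le> \<bar>v p\<bar> * 1" using that by (intro mult_left_mono) auto
    then show ?thesis using p that by (simp add: abs_mult)
  next
    case False
    have "p \<in> spacetime T \<Longrightarrow> a * k = 0"
    proof -
      assume p: "p \<in> spacetime T"
      show ?thesis
      proof (cases "fst p < s")
        case True
        then have "\<bar>snd p\<bar> > r" using False p by auto
        then have "\<bar>H p\<bar> > K" using H_large[of "fst p" K "snd p"] p r by (auto simp: mem_Times_iff)
        then show ?thesis using that(6) by simp
      next
        case False
        then show ?thesis using that(5) s by simp
      qed
    qed
    then show ?thesis by (cases "p \<in> spacetime T") auto
  qed
  have meas: "(\<lambda>p. indicator (spacetime T) p * (v p * (indicator {t0<..<t1} (fst p) * indicator {y0<..<y1} (H p)))) \<in> borel_measurable borel"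
    using mfst[of "indicator {t0<..<t1}"] by measurable
  show "integrable lborel (\<lambda>p. indicator (spacetime T) p * (v p * (indicator {t0<..<t1} (fst p) * indicator {y0<..<y1} (H p))))"
  proof (rule Bochner_Integration.integrable_bound[OF w])
    show "AE p in lborel. norm (indicator (spacetime T) p * (v p * (indicator {t0<..<t1} (fst p) * indicator {y0<..<y1} (H p))))
        \<le> norm (?w p)"
    proof (rule AE_I2)
      fix p
      have "norm (indicator (spacetime T) p * (v p * (indicator {t0<..<t1} (fst p) * indicator {y0<..<y1} (H p)))) \<le> ?w p"
        by (rule bound) (auto simp: indicator_def K_def)
      then show "norm (indicator (spacetime T) p * (v p * (indicator {t0<..<t1} (fst p) * indicator {y0<..<y1} (H p))))
        \<le> norm (?w p)" by simp
    qed
  qed (use meas in simp)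
  show "(\<integral>p. indicator (spacetime T) p * (v p * (indicator {t0<..<t1} (fst p) * indicator {y0<..<y1} (H p))) \<partial>lborel) = 0"
  proof (cases "t0 \<le> t1 \<and> y0 \<le> y1 \<and> 0 < t1")
    case False
    have *: "indicator (spacetime T) p * (v p * (indicator {t0<..<t1} (fst p) * indicator {y0<..<y1} (H p))) = 0" for p
      using False by (auto simp: indicator_def mem_Times_iff)
    show ?thesis unfolding * by simp
  next
    case True
    let ?f = "\<lambda>n p. indicator (spacetime T) p * (v p * (hat t0 t1 (real n) (fst p) * hat y0 y1 (real n) (H p)))"
    have zero: "integral\<^sup>L lborel (?f n) = 0" for n
    proof (rule vanishing_weak_solution_orthogonal[OF v])
      show "0 < t1" "t1 < T" using True t1 by auto
      show "hat t0 t1 (real n) t = 0" if "t1 \<le> t" for t using hat_outside True that by auto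
      show "(hat y0 y1 (real n) has_real_derivative hat' y0 y1 (real n) y) (at y)" for y by (rule hat_has_derivative)
      show "hat y0 y1 (real n) y = 0 \<and> hat' y0 y1 (real n) y = 0" if "\<bar>y\<bar> > K" for y
      proof -
        have "y \<notin> {y0<..<y1}" using that by (auto simp: K_def)
        then show ?thesis using hat_outside True by blast
      qed
    qed (rule hat_continuous hat'_continuous)+
    have "(\<lambda>n. integral\<^sup>L lborel (?f n)) \<longlonglongrightarrow>
      (\<integral>p. indicator (spacetime T) p * (v p * (indicator {t0<..<t1} (fst p) * indicator {y0<..<y1} (H p))) \<partial>lborel)"
    proof (rule integral_dominated_convergence[OF _ _ w])
      show "AE p in lborel. (\<lambda>n. ?f n p) \<longlonglongrightarrow> indicator (spacetime T) p * (v p * (indicator {t0<..<t1} (fst p) * indicator {y0<..<y1} (H p)))"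
      proof (rule AE_I2)
        fix p show "(\<lambda>n. ?f n p) \<longlonglongrightarrow> indicator (spacetime T) p * (v p * (indicator {t0<..<t1} (fst p) * indicator {y0<..<y1} (H p)))"
          using True by (intro tendsto_mult tendsto_const hat_tendsto) auto
      qed
      show "AE p in lborel. norm (?f n p) \<le> ?w p" for n
      proof (rule AE_I2)
        fix p show "norm (?f n p) \<le> ?w p"
        proof (rule bound)
          show "fst p \<ge> t1 \<Longrightarrow> hat t0 t1 (real n) (fst p) = 0" using hat_outside True by auto
          show "\<bar>H p\<bar> > K \<Longrightarrow> hat y0 y1 (real n) (H p) = 0"
          proof -
            assume "\<bar>H p\<bar> > K"
            then have "H p \<notin> {y0<..<y1}" by (auto simp: K_def)
            then show ?thesis using hat_outside True by blast
          qed
        qed (simp_all add: hat_bounds)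
      qed
      show "?f n \<in> borel_measurable lborel" for n
      proof -
        have [measurable]: "hat a b' k \<in> borel_measurable borel" for a b' k
          by (intro borel_measurable_continuous_onI hat_continuous)
        show ?thesis using mfst[of "hat t0 t1 (real n)"] by measurable
      qed
    qed (use meas in simp)
    then show ?thesis unfolding zero by (simp add: LIMSEQ_const_iff)
  qed
qed

text \<open>
  Restricting \<open>v\<close> to the preimage of a bounded box makes it integrable. Its integral over the preimage of any
  Borel set vanishes, and every Borel set \<open>A\<close> is the preimage under \<open>\<Phi>\<close> of \<open>\<Psi> -` A\<close>.
\<close>

lemma vanishing_weak_solution_zero:
  assumes v: "vanishing_weak_solution v"
  shows "AE p in lborel. p \<in> spacetime T \<longrightarrow> v p = 0"
proof -
  have [measurable]: "v \<in> borel_measurable borel" using v by (simp add: vanishing_weak_solution_def)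
  define B where "B n = box (0, - real n) (T - T / (real n + 2), real n)" for n :: nat
  define w where "w n p = indicator (spacetime T) p * (v p * indicator (B n) (\<Phi> p))" for n p
  have tn: "T - T / (real n + 2) < T" for n using T by simp
  have boxeq: "indicator (box (t0, y0) (t1, y1)) (\<Phi> p) = (indicator {t0<..<t1} (fst p) * indicator {y0<..<y1} (H p) :: real)"
    for t0 y0 t1 y1 p
    by (auto simp: \<Phi>_def indicator_def mem_box Basis_prod_def)
  have ind_Int: "indicator {s0<..<s1} t * indicator {t0<..<t1} t = (indicator {max s0 t0<..<min s1 t1} t :: real)"
    for s0 s1 t0 t1 t :: real
    by (auto simp: indicator_def)
  have "AE p in lborel. w n p = 0" for n
  proof (rule AE_zero_if_indicator_integrals_zero)
    show w_int: "integrable lborel (w n)"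
      unfolding w_def[abs_def] B_def boxeq by (rule vanishing_weak_solution_rectangle(1)[OF v tn])
    fix A :: "(real \<times> real) set" assume A: "A \<in> sets lborel"
    have \<Psi>A: "\<Psi> -` A \<in> sets borel" using measurable_sets_borel[OF \<Psi>_measurable, of A] A by simp
    have box0: "(\<integral>p. w n p * indicator (box l u) (\<Phi> p) \<partial>lborel) = 0" for l u
    proof -
      obtain l1 l2 u1 u2 where lu: "l = (l1, l2)" "u = (u1, u2)" by (cases l; cases u)
      have *: "w n p * indicator (box l u) (\<Phi> p) = indicator (spacetime T) p * (v p *
          (indicator {max 0 l1<..<min (T - T / (real n + 2)) u1} (fst p) * indicator {max (- real n) l2<..<min (real n) u2} (H p)))" for p
        unfolding w_def B_def lu boxeq ind_Int[symmetric] by (simp add: mult_ac)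
      show ?thesis
        unfolding * by (rule vanishing_weak_solution_rectangle(2)[OF v]) (use tn[of n] in linarith)
    qed
    have "(\<integral>p. w n p * indicator (\<Psi> -` A) (\<Phi> p) \<partial>lborel) = 0"
      by (rule integral_indicator_zero_if_boxes[OF w_int _ box0 \<Psi>A]) simp
    moreover have "indicator (\<Psi> -` A) (\<Phi> p) = (indicator A p :: real)" for p by (simp add: indicator_def)
    ultimately show "(\<integral>p. w n p * indicator A p \<partial>lborel) = 0" by simp
  qed
  then have "AE p in lborel. \<forall>n. w n p = 0" by (simp add: AE_all_countable)
  then show ?thesis
  proof eventually_elim
    case (elim p)
    show ?case
    proof
      assume p: "p \<in> spacetime T"
      then have t: "0 < fst p" "fst p < T" by (auto simp: mem_Times_iff)
      obtain n :: nat where n: "max \<bar>H p\<bar> (T / (T - fst p)) < real n" using reals_Archimedean2 by blast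
      have "T / (T - fst p) < real n + 2" using n by linarith
      then have "T < (real n + 2) * (T - fst p)" using t by (simp add: pos_divide_less_eq)
      then have "fst p < T - T / (real n + 2)" by (simp add: field_simps)
      then have "\<Phi> p \<in> B n" using n t by (auto simp: B_def \<Phi>_def mem_box Basis_prod_def)
      then show "v p = 0" using elim[rule_format, of n] p by (simp add: w_def)
    qed
  qed
qed

end

section \<open>Existence\<close>

text \<open>
  A quantitative form of compact support in \<open>[0, T)\<close> times the line. The non-strict inequalities make all
  boundary terms on the rectangle \<open>{0..s} \<times> {-r..r}\<close> vanish except the one at \<open>t = 0\<close>.
\<close>

definition supported_test :: "real \<Rightarrow> real \<Rightarrow> real \<Rightarrow> (real \<times> real \<Rightarrow> real) \<Rightarrow> (real \<times> real \<Rightarrow> real) \<Rightarrow> (real \<times> real \<Rightarrow> real) \<Rightarrow> bool" where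
  "supported_test T s r \<phi> \<phi>t \<phi>x \<longleftrightarrow> C1_on (spacetime0 T) \<phi> \<phi>t \<phi>x \<and> 0 < s \<and> s < T \<and> r > 0 \<and>
     (\<forall>p\<in>spacetime0 T. fst p \<ge> s \<or> \<bar>snd p\<bar> \<ge> r \<longrightarrow> \<phi> p = 0 \<and> \<phi>t p = 0 \<and> \<phi>x p = 0)"

text \<open>
  Off the support the derivative of \<open>\<phi>\<close> relative to the half-open strip is \<open>0\<close>. Relative derivatives are
  unique there even at \<open>t = 0\<close>, where only one time direction is available; hence \<open>\<phi>t\<close> and \<open>\<phi>x\<close> vanish too.
\<close>

lemma supported_test_exists:
  assumes T: "T > 0" and C1: "C1_on (spacetime0 T) \<phi> \<phi>t \<phi>x" and cs: "compactly_supported_in (spacetime0 T) \<phi>"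
  shows "\<exists>s r. supported_test T s r \<phi> \<phi>t \<phi>x"
proof -
  let ?K = "closure (support_on (spacetime0 T) \<phi>)"
  have K: "compact ?K" "?K \<subseteq> spacetime0 T" using cs by (auto simp: compactly_supported_in_def)
  have "compact (fst ` ?K)" by (intro compact_continuous_image continuous_on_fst continuous_on_id K)
  moreover have "fst ` ?K \<subseteq> {..<T}" using K(2) by (auto simp: mem_Times_iff)
  ultimately have "\<exists>s. 0 < s \<and> s < T \<and> (\<forall>t\<in>fst ` ?K. t < s)"
  proof (cases "fst ` ?K = {}")
    case True
    then show ?thesis using T by (intro exI[of _ "T / 2"]) auto
  next
    case False
    assume "compact (fst ` ?K)" "fst ` ?K \<subseteq> {..<T}"
    from compact_attains_sup[OF this(1) False] obtain m where m: "m \<in> fst ` ?K" "\<And>t. t \<in> fst ` ?K \<Longrightarrow> t \<le> m" by blast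
    then have "m < T" "0 \<le> m" using \<open>fst ` ?K \<subseteq> {..<T}\<close> K(2) by (auto simp: mem_Times_iff)
    then show ?thesis using m(2) by (intro exI[of _ "(m + T) / 2"]) (force simp: less_divide_eq)
  qed
  then obtain s where s: "0 < s" "s < T" "\<And>t. t \<in> fst ` ?K \<Longrightarrow> t < s" by blast
  obtain r where r: "r > 0" "\<And>p. p \<in> ?K \<Longrightarrow> norm p < r"
    using compact_imp_bounded[OF K(1)] bounded_pos_less by blast
  have "\<phi> p = 0 \<and> \<phi>t p = 0 \<and> \<phi>x p = 0" if p: "p \<in> spacetime0 T" and "fst p \<ge> s \<or> \<bar>snd p\<bar> \<ge> r" for p
  proof -
    have nK: "p \<notin> ?K"
    proof
      assume pK: "p \<in> ?K"
      then have "fst p < s" using s(3) by blast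
      moreover have "\<bar>snd p\<bar> < r" using r(2)[OF pK] norm_snd_le[of "snd p" "fst p"] by simp
      ultimately show False using that(2) by linarith
    qed
    have z: "\<phi> q = 0" if "q \<in> spacetime0 T" "q \<notin> ?K" for q
      using that closure_subset[of "support_on (spacetime0 T) \<phi>"] by (auto simp: support_on_def)
    have d1: "(\<phi> has_derivative (\<lambda>h. \<phi>t p * fst h + \<phi>x p * snd h)) (at p within spacetime0 T)"
      using C1 p unfolding C1_on_def by blast
    have "open (- ?K)" by (simp add: open_Compl)
    then obtain d where d: "d > 0" "\<And>q. dist q p < d \<Longrightarrow> q \<notin> ?K"
      using nK unfolding open_dist by force
    have d2: "(\<phi> has_derivative (\<lambda>h. 0)) (at p within spacetime0 T)"
      by (rule has_derivative_transform_within[OF has_derivative_const[of 0] d(1) p])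
        (use z d(2) in auto)
    have "(\<lambda>h. \<phi>t p * fst h + \<phi>x p * snd h) = (\<lambda>h. 0)"
    proof (rule frechet_derivative_unique_within[OF d1 d2])
      fix i :: "real \<times> real" and \<epsilon> :: real assume i: "i \<in> Basis" "\<epsilon> > 0"
      show "\<exists>d. 0 < \<bar>d\<bar> \<and> \<bar>d\<bar> < \<epsilon> \<and> p + d *\<^sub>R i \<in> spacetime0 T"
        using i p by (intro exI[of _ "min (\<epsilon> / 2) ((T - fst p) / 2)"])
          (auto simp: Basis_prod_def mem_Times_iff min_def field_simps)
    qed
    from fun_cong[OF this, of "(1, 0)"] fun_cong[OF this, of "(0, 1)"] z[OF p nK]
    show ?thesis by simp
  qed
  then show ?thesis unfolding supported_test_def using C1 s r(1) by blast
qed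

lemma supported_test_D:
  assumes "supported_test T s r \<phi> \<phi>t \<phi>x"
  shows "0 < s" "s < T" "r > 0"
    "\<And>p. 0 \<le> fst p \<Longrightarrow> fst p < T \<Longrightarrow> fst p \<ge> s \<or> \<bar>snd p\<bar> \<ge> r \<Longrightarrow> \<phi> p = 0 \<and> \<phi>t p = 0 \<and> \<phi>x p = 0"
    "continuous_on (spacetime0 T) \<phi>" "continuous_on (spacetime0 T) \<phi>t" "continuous_on (spacetime0 T) \<phi>x"
    "\<And>t x. 0 \<le> t \<Longrightarrow> t < T \<Longrightarrow> ((\<lambda>x. \<phi> (t, x)) has_real_derivative \<phi>x (t, x)) (at x)"
    "\<And>t x S. 0 \<le> t \<Longrightarrow> t < T \<Longrightarrow> S \<subseteq> {0..<T} \<Longrightarrow> ((\<lambda>t. \<phi> (t, x)) has_real_derivative \<phi>t (t, x)) (at t within S)"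
proof -
  note st = assms[unfolded supported_test_def C1_on_def]
  show "0 < s" "s < T" "r > 0"
    "\<And>p. 0 \<le> fst p \<Longrightarrow> fst p < T \<Longrightarrow> fst p \<ge> s \<or> \<bar>snd p\<bar> \<ge> r \<Longrightarrow> \<phi> p = 0 \<and> \<phi>t p = 0 \<and> \<phi>x p = 0"
    "continuous_on (spacetime0 T) \<phi>t" "continuous_on (spacetime0 T) \<phi>x"
    using st by (auto simp: mem_Times_iff)
  show "continuous_on (spacetime0 T) \<phi>"
  proof (unfold continuous_on_eq_continuous_within, rule ballI)
    fix p assume "p \<in> spacetime0 T"
    with st have "(\<phi> has_derivative (\<lambda>h. \<phi>t p * fst h + \<phi>x p * snd h)) (at p within spacetime0 T)" by blast
    then show "continuous (at p within spacetime0 T) \<phi>" by (rule has_derivative_continuous)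
  qed
  fix t x :: real assume t: "0 \<le> t" "t < T"
  then have d: "(\<phi> has_derivative (\<lambda>h. \<phi>t (t, x) * fst h + \<phi>x (t, x) * snd h)) (at (t, x) within spacetime0 T)"
    using st by auto
  show "((\<lambda>x. \<phi> (t, x)) has_real_derivative \<phi>x (t, x)) (at x)"
  proof -
    have 1: "((\<lambda>x. (t, x)) has_derivative (\<lambda>h. (0, h))) (at x within UNIV)" by (auto intro!: derivative_eq_intros)
    have "(\<phi> has_derivative (\<lambda>h. \<phi>t (t, x) * fst h + \<phi>x (t, x) * snd h)) (at (t, x) within range (Pair t))"
      by (rule has_derivative_subset[OF d]) (use t in auto)
    from diff_chain_within[OF 1 this] show ?thesis by (simp add: o_def has_field_derivative_def)
  qed
  fix S :: "real set" assume S: "S \<subseteq> {0..<T}"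
  show "((\<lambda>t. \<phi> (t, x)) has_real_derivative \<phi>t (t, x)) (at t within S)"
  proof -
    have 1: "((\<lambda>t. (t, x)) has_derivative (\<lambda>h. (h, 0))) (at t within S)" by (auto intro!: derivative_eq_intros)
    have "(\<phi> has_derivative (\<lambda>h. \<phi>t (t, x) * fst h + \<phi>x (t, x) * snd h)) (at (t, x) within (\<lambda>t. (t, x)) ` S)"
      by (rule has_derivative_subset[OF d]) (use S in auto)
    from diff_chain_within[OF 1 this]
    have "((\<lambda>t. \<phi> (t, x)) has_derivative (\<lambda>h. \<phi>t (t, x) * h)) (at t within S)" by (simp add: o_def)
    then show ?thesis unfolding has_field_derivative_def .
  qed
qed

lemma AE_fst_neq_0: "AE p in lborel. fst (p :: real \<times> real) \<noteq> 0"
proof -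
  have "negligible {p :: real \<times> real. (1, 0) \<bullet> p = 0}"
    by (rule negligible_hyperplane) (simp add: zero_prod_def)
  then have "{p :: real \<times> real. (1, 0) \<bullet> p = 0} \<in> null_sets lebesgue" by (simp add: negligible_iff_null_sets)
  then have "AE p in lebesgue. p \<notin> {p :: real \<times> real. (1, 0) \<bullet> p = 0}" by (rule AE_not_in)
  then show ?thesis by (auto simp: AE_completion_iff inner_prod_def)
qed

lemma integral_deriv_rectangle:
  assumes ab: "a \<le> (b::real)" and cd: "c' \<le> (d'::real)"
    and cont: "continuous_on ({a..b} \<times> {c'..d'}) f"
    and F: "\<And>t x. t \<in> {a..b} \<Longrightarrow> x \<in> {c'..d'} \<Longrightarrow> ((\<lambda>x. F (t, x)) has_real_derivative f (t, x)) (at x within {c'..d'})"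
  shows "(\<integral>p. indicator ({a..b} \<times> {c'..d'}) p * f p \<partial>lborel)
      = (\<integral>t. indicator {a..b} t * (F (t, d') - F (t, c')) \<partial>lborel)"
proof -
  let ?Q = "{a..b} \<times> {c'..d'}"
  have int: "integrable lborel (\<lambda>p. indicator ?Q p *\<^sub>R f p)"
    by (intro borel_integrable_compact cont compact_Times compact_Icc)
  have int': "integrable (lborel \<Otimes>\<^sub>M lborel) (\<lambda>(t, x). indicator ?Q (t, x) * f (t, x))"
    using int by (simp add: lborel_prod split_beta')
  have "(\<integral>p. indicator ?Q p * f p \<partial>lborel) = (\<integral>p. (case p of (t, x) \<Rightarrow> indicator ?Q (t, x) * f (t, x)) \<partial>(lborel \<Otimes>\<^sub>M lborel))"
    by (simp add: lborel_prod split_beta')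
  also have "\<dots> = (\<integral>t. (\<integral>x. indicator ?Q (t, x) * f (t, x) \<partial>lborel) \<partial>lborel)"
    using lborel_pair.integral_fst[OF int'] by (simp add: split_beta')
  also have "\<dots> = (\<integral>t. indicator {a..b} t * (F (t, d') - F (t, c')) \<partial>lborel)"
  proof (rule Bochner_Integration.integral_cong[OF refl])
    fix t
    show "(\<integral>x. indicator ?Q (t, x) * f (t, x) \<partial>lborel) = indicator {a..b} t * (F (t, d') - F (t, c'))"
    proof (cases "t \<in> {a..b}")
      case True
      have "(\<integral>x. indicator {c'..d'} x *\<^sub>R f (t, x) \<partial>lborel) = F (t, d') - F (t, c')"
      proof (rule integral_FTC_atLeastAtMost[OF cd])
        show "((\<lambda>x. F (t, x)) has_vector_derivative f (t, x)) (at x within {c'..d'})" if "c' \<le> x" "x \<le> d'" for x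
          using F[OF True, of x] that by (simp add: has_real_derivative_iff_has_vector_derivative)
        show "continuous_on {c'..d'} (\<lambda>x. f (t, x))"
          by (rule continuous_on_compose2[OF cont]) (use True in \<open>auto intro: continuous_intros\<close>)
      qed
      then show ?thesis using True by (simp add: indicator_times)
    qed (simp add: indicator_times)
  qed
  finally show ?thesis .
qed

lemma lborel_swap:
  fixes f :: "real \<times> real \<Rightarrow> real"
  assumes "f \<in> borel_measurable borel"
  shows "(\<integral>p. f (snd p, fst p) \<partial>lborel) = integral\<^sup>L lborel f"
  using lborel_pair.integral_product_swap[of f] assms
  by (simp add: lborel_prod split_beta')

context transport
begin

lemma continuous_R_Jn: "continuous_on S (R n)" "continuous_on S (Jn n)"
  using dR dJ by (meson continuous_at_imp_continuous_on has_derivative_continuous)+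

lemma R_Jn_partials:
  "((\<lambda>t. R n (t, x)) has_real_derivative Rt n (t, x)) (at t)"
  "((\<lambda>x. Jn n (t, x)) has_real_derivative Jx n (t, x)) (at x)"
proof -
  have 1: "((\<lambda>t. (t, x)) has_derivative (\<lambda>h. (h, 0))) (at t)" by (auto intro!: derivative_eq_intros)
  have "((\<lambda>t. R n (t, x)) has_derivative (\<lambda>h. Rt n (t, x) * h)) (at t)"
    using diff_chain_at[OF 1 dR[of n "(t, x)"]] by (simp add: o_def)
  then show "((\<lambda>t. R n (t, x)) has_real_derivative Rt n (t, x)) (at t)"
    unfolding has_field_derivative_def .
  have 2: "((\<lambda>x. (t, x)) has_derivative (\<lambda>h. (0, h))) (at x)" by (auto intro!: derivative_eq_intros)
  show "((\<lambda>x. Jn n (t, x)) has_real_derivative Jx n (t, x)) (at x)"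
    using diff_chain_at[OF 2 dJ[of n "(t, x)"]] by (simp add: o_def has_field_derivative_def)
qed

lemma continuous_Hn: "s < T - 2 * e n \<Longrightarrow> continuous_on ({0..s} \<times> UNIV) (Hn n)"
proof (intro continuous_at_imp_continuous_on ballI)
  fix p :: "real \<times> real" assume "s < T - 2 * e n" "p \<in> {0..s} \<times> UNIV"
  then have "(Hn n has_derivative (\<lambda>h. - Jn n p * fst h + R n p * snd h)) (at p)"
    using e(1)[of n] by (intro dHn) (auto simp: mem_Times_iff)
  then show "isCont (Hn n) p" by (rule has_derivative_continuous)
qed

text \<open>
  The field \<open>(A, B) = h(Hn) (R, Jn)\<close> is divergence-free, because \<open>(R, Jn)\<close> is and is tangent to the level lines
  of \<open>Hn\<close>. So \<open>A \<phi>t + B \<phi>x = \<partial>\<^sub>t (A \<phi>) + \<partial>\<^sub>x (B \<phi>)\<close>, which integrates to \<open>- \<integral> A(0, x) \<phi>(0, x) dx\<close>. As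
  \<open>A (0, \<cdot>)\<close> is the derivative of \<open>K (Hn (0, \<cdot>))\<close>, one integration by parts moves the derivative to \<open>\<phi>\<close>; the
  right-hand side then no longer contains \<open>R (0, \<cdot>)\<close>, whose limit at the single time \<open>0\<close> is not under control.
\<close>

lemma smooth_green_identity:
  assumes st: "supported_test T s r \<phi> \<phi>t \<phi>x"
    and h: "\<And>y. (h has_real_derivative h' y) (at y)" "continuous_on UNIV h'"
    and K: "\<And>y. (K has_real_derivative h y) (at y)"
    and n: "s < T - 2 * e n"
  shows "(\<integral>p. indicator ({0..s} \<times> {-r..r}) p * (h (Hn n p) * (R n p * \<phi>t p + Jn n p * \<phi>x p)) \<partial>lborel)
    = (\<integral>x. indicator {-r..r} x * (K (Hn n (0, x)) * \<phi>x (0, x)) \<partial>lborel)"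
proof -
  note D = supported_test_D[OF st]
  let ?Q = "{0..s} \<times> {-r..r}"
  have hc: "continuous_on UNIV h" and Kc: "continuous_on UNIV K"
    using h(1) K by (intro continuous_at_imp_continuous_on ballI DERIV_isCont; blast)+
  have Qsub: "?Q \<subseteq> spacetime0 T" using D(1,2) by auto
  have slab: "- e n < t" "t < T - 2 * e n" if "t \<in> {0..s}" for t
    using that n e(1)[of n] by auto
  have cHn: "continuous_on ?Q (Hn n)" by (rule continuous_on_subset[OF continuous_Hn[OF n]]) auto
  have cH: "continuous_on ?Q (\<lambda>p. f (Hn n p))" if "continuous_on UNIV f" for f :: "real \<Rightarrow> real"
    by (rule continuous_on_compose2[OF that cHn]) auto
  have c\<phi>: "continuous_on ?Q \<phi>" "continuous_on ?Q \<phi>t" "continuous_on ?Q \<phi>x"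
    using D(5-7) Qsub by (auto intro: continuous_on_subset)
  have cRJ: "continuous_on ?Q (Rt n)" "continuous_on ?Q (Jx n)"
    by (rule continuous_on_subset[OF cont_deriv(1)], simp) (rule continuous_on_subset[OF cont_deriv(4)], simp)
  define A where "A p = h (Hn n p) * R n p" for p
  define B where "B p = h (Hn n p) * Jn n p" for p
  define At where "At p = h (Hn n p) * Rt n p - h' (Hn n p) * Jn n p * R n p" for p
  define Bx where "Bx p = h (Hn n p) * Jx n p + h' (Hn n p) * R n p * Jn n p" for p
  have cA: "continuous_on ?Q A" "continuous_on ?Q B" "continuous_on ?Q At" "continuous_on ?Q Bx"
    unfolding A_def[abs_def] B_def[abs_def] At_def[abs_def] Bx_def[abs_def]
    by (intro continuous_on_add continuous_on_diff continuous_on_mult cH[OF hc] cH[OF h(2)] continuous_R_Jn cRJ)+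
  have AB: "At p + Bx p = 0" if "p \<in> ?Q" for p
  proof -
    have "At p + Bx p = h (Hn n p) * (Rt n p + Jx n p)" by (simp add: At_def Bx_def algebra_simps)
    then show ?thesis using div_free[of n p] slab[of "fst p"] that by (auto simp: mem_Times_iff)
  qed
  have dA: "((\<lambda>t. A (t, x) * \<phi> (t, x)) has_real_derivative (At (t, x) * \<phi> (t, x) + A (t, x) * \<phi>t (t, x))) (at t within {0..s})"
    if t: "t \<in> {0..s}" for t x
  proof -
    have "((\<lambda>t. h (Hn n (t, x))) has_real_derivative h' (Hn n (t, x)) * - Jn n (t, x)) (at t)"
      by (rule DERIV_chain2[OF h(1) Hn_dt[OF slab[OF t]]])
    from DERIV_mult[OF this R_Jn_partials(1)]
    have "((\<lambda>t. A (t, x)) has_real_derivative At (t, x)) (at t)"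
      unfolding A_def At_def by (rule DERIV_cong) (simp add: algebra_simps)
    then have "((\<lambda>t. A (t, x)) has_real_derivative At (t, x)) (at t within {0..s})"
      by (rule has_field_derivative_at_within)
    moreover have "((\<lambda>t. \<phi> (t, x)) has_real_derivative \<phi>t (t, x)) (at t within {0..s})"
      by (rule D(9)) (use t D(2) in auto)
    ultimately show ?thesis by (rule DERIV_cong[OF DERIV_mult]) (simp add: algebra_simps)
  qed
  have dB: "((\<lambda>x. B (t, x) * \<phi> (t, x)) has_real_derivative (Bx (t, x) * \<phi> (t, x) + B (t, x) * \<phi>x (t, x))) (at x within S)"
    if t: "t \<in> {0..s}" for t x S
  proof -
    have "((\<lambda>x. h (Hn n (t, x))) has_real_derivative h' (Hn n (t, x)) * R n (t, x)) (at x)"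
      by (rule DERIV_chain2[OF h(1) Hn_dx[OF slab[OF t]]])
    from DERIV_mult[OF this R_Jn_partials(2)]
    have "((\<lambda>x. B (t, x)) has_real_derivative Bx (t, x)) (at x)"
      unfolding B_def Bx_def by (rule DERIV_cong) (simp add: algebra_simps)
    moreover have "((\<lambda>x. \<phi> (t, x)) has_real_derivative \<phi>x (t, x)) (at x)"
      by (rule D(8)) (use t D(2) in auto)
    ultimately have "((\<lambda>x. B (t, x) * \<phi> (t, x)) has_real_derivative (Bx (t, x) * \<phi> (t, x) + B (t, x) * \<phi>x (t, x))) (at x)"
      by (rule DERIV_cong[OF DERIV_mult]) (simp add: algebra_simps)
    then show ?thesis by (rule has_field_derivative_at_within)
  qed
  define f1 where "f1 p = At p * \<phi> p + A p * \<phi>t p" for p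
  define f2 where "f2 p = Bx p * \<phi> p + B p * \<phi>x p" for p
  have cf: "continuous_on ?Q f1" "continuous_on ?Q f2"
    unfolding f1_def[abs_def] f2_def[abs_def] by (intro continuous_on_add continuous_on_mult cA c\<phi>)+
  have if1: "integrable lborel (\<lambda>p. indicator ?Q p * f1 p)" and if2: "integrable lborel (\<lambda>p. indicator ?Q p * f2 p)"
    using borel_integrable_compact[OF compact_Times[OF compact_Icc compact_Icc] cf(1)]
      borel_integrable_compact[OF compact_Times[OF compact_Icc compact_Icc] cf(2)] by simp_all
  have I2: "(\<integral>p. indicator ?Q p * f2 p \<partial>lborel) = 0"
  proof -
    have "(\<integral>p. indicator ?Q p * f2 p \<partial>lborel)
        = (\<integral>t. indicator {0..s} t * (B (t, r) * \<phi> (t, r) - B (t, -r) * \<phi> (t, -r)) \<partial>lborel)"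
      by (rule integral_deriv_rectangle[where F="\<lambda>p. B p * \<phi> p", OF _ _ cf(2)])
        (use D(1,3) dB in \<open>auto simp: f2_def\<close>)
    also have "\<dots> = integral\<^sup>L lborel (\<lambda>t::real. 0)"
    proof (rule Bochner_Integration.integral_cong[OF refl])
      fix t
      have "t \<in> {0..s} \<Longrightarrow> \<phi> (t, r) = 0 \<and> \<phi> (t, -r) = 0"
        using D(2,3) D(4)[of "(t, r)"] D(4)[of "(t, -r)"] by auto
      then show "indicator {0..s} t * (B (t, r) * \<phi> (t, r) - B (t, -r) * \<phi> (t, -r)) = 0"
        by (auto simp: indicator_def)
    qed
    finally show ?thesis by simp
  qed
  have I1: "(\<integral>p. indicator ?Q p * f1 p \<partial>lborel) = - (\<integral>x. indicator {-r..r} x * (A (0, x) * \<phi> (0, x)) \<partial>lborel)"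
  proof -
    let ?Q' = "{-r..r} \<times> {0..s}"
    have ind: "indicator ?Q p = (indicator ?Q' (snd p, fst p) :: real)" for p
      by (cases p) (auto simp: indicator_def)
    have m: "(\<lambda>p. indicator ?Q p * f1 p) \<in> borel_measurable borel"
      using borel_measurable_integrable[OF if1] by simp
    have "(\<integral>p. indicator ?Q p * f1 p \<partial>lborel) = (\<integral>p. indicator ?Q (snd p, fst p) * f1 (snd p, fst p) \<partial>lborel)"
      using lborel_swap[OF m] by simp
    also have "\<dots> = (\<integral>p. indicator ?Q' p * f1 (snd p, fst p) \<partial>lborel)" unfolding ind by simp
    also have "\<dots> = (\<integral>x. indicator {-r..r} x * (A (s, x) * \<phi> (s, x) - A (0, x) * \<phi> (0, x)) \<partial>lborel)"
    proof (rule integral_deriv_rectangle[where F="\<lambda>p. A (snd p, fst p) * \<phi> (snd p, fst p)"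
          and f="\<lambda>p. f1 (snd p, fst p)" and a="-r" and b=r and c'=0 and d'=s, THEN trans])
      show "continuous_on ?Q' (\<lambda>p. f1 (snd p, fst p))"
        by (rule continuous_on_compose2[OF cf(1)]) (auto intro!: continuous_intros)
      show "((\<lambda>t. A (snd (x, t), fst (x, t)) * \<phi> (snd (x, t), fst (x, t))) has_real_derivative f1 (snd (x, t), fst (x, t)))
          (at t within {0..s})"
        if "x \<in> {-r..r}" "t \<in> {0..s}" for x t
        using dA[OF that(2)] by (simp add: f1_def)
    qed (use D(1,3) in \<open>simp_all\<close>)
    also have "\<dots> = (\<integral>x. - (indicator {-r..r} x * (A (0, x) * \<phi> (0, x))) \<partial>lborel)"
      by (rule Bochner_Integration.integral_cong[OF refl]) (use D(1,2) D(4)[of "(s, _)"] in auto)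
    finally show ?thesis by simp
  qed
  have parts: "(\<integral>x. indicator {-r..r} x * (A (0, x) * \<phi> (0, x)) \<partial>lborel)
      = - (\<integral>x. indicator {-r..r} x * (K (Hn n (0, x)) * \<phi>x (0, x)) \<partial>lborel)"
  proof -
    have c0: "continuous_on {-r..r} (\<lambda>x. f (0, x))" if "continuous_on ?Q f" for f :: "real \<times> real \<Rightarrow> real"
      by (rule continuous_on_compose2[OF that]) (use D(1) in \<open>auto intro: continuous_intros\<close>)
    let ?f1 = "\<lambda>x. A (0, x) * \<phi> (0, x)" and ?f2 = "\<lambda>x. K (Hn n (0, x)) * \<phi>x (0, x)"
    have c1: "continuous_on {-r..r} ?f1" by (intro continuous_on_mult c0 cA c\<phi>)
    have c2: "continuous_on {-r..r} ?f2" by (intro continuous_on_mult c0[OF cH[OF Kc]] c0 c\<phi>)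
    have i1: "integrable lborel (\<lambda>x. indicator {-r..r} x * ?f1 x)" and i2: "integrable lborel (\<lambda>x. indicator {-r..r} x * ?f2 x)"
      using borel_integrable_compact[OF compact_Icc c1] borel_integrable_compact[OF compact_Icc c2] by simp_all
    have "(\<integral>x. indicator {-r..r} x *\<^sub>R (?f1 x + ?f2 x) \<partial>lborel) = K (Hn n (0, r)) * \<phi> (0, r) - K (Hn n (0, -r)) * \<phi> (0, -r)"
    proof (rule integral_FTC_atLeastAtMost)
      fix x assume "- r \<le> x" "x \<le> r"
      have "((\<lambda>x. K (Hn n (0, x))) has_real_derivative h (Hn n (0, x)) * R n (0, x)) (at x)"
        by (rule DERIV_chain2[OF K Hn_dx]) (use slab[of 0] D(1) in auto)
      moreover have "((\<lambda>x. \<phi> (0, x)) has_real_derivative \<phi>x (0, x)) (at x)" by (rule D(8)) (use D(1,2) in auto)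
      ultimately have "((\<lambda>x. K (Hn n (0, x)) * \<phi> (0, x)) has_real_derivative ?f1 x + ?f2 x) (at x)"
        by (rule DERIV_cong[OF DERIV_mult]) (simp add: A_def algebra_simps)
      then show "((\<lambda>x. K (Hn n (0, x)) * \<phi> (0, x)) has_vector_derivative ?f1 x + ?f2 x) (at x within {-r..r})"
        unfolding has_real_derivative_iff_has_vector_derivative by (rule has_vector_derivative_at_within)
    qed (use D(3) c1 c2 in \<open>auto intro: continuous_on_add\<close>)
    also have "\<dots> = 0" using D(1-3) D(4)[of "(0, r)"] D(4)[of "(0, -r)"] by auto
    finally have "(\<integral>x. indicator {-r..r} x * ?f1 x + indicator {-r..r} x * ?f2 x \<partial>lborel) = 0"
      by (simp add: distrib_left)
    then show ?thesis using i1 i2 by simp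
  qed
  have "(\<integral>p. indicator ?Q p * (h (Hn n p) * (R n p * \<phi>t p + Jn n p * \<phi>x p)) \<partial>lborel)
      = (\<integral>p. indicator ?Q p * f1 p + indicator ?Q p * f2 p \<partial>lborel)"
  proof (rule Bochner_Integration.integral_cong[OF refl])
    fix p
    have "f1 p + f2 p = (At p + Bx p) * \<phi> p + (A p * \<phi>t p + B p * \<phi>x p)"
      by (simp add: f1_def f2_def algebra_simps)
    then show "indicator ?Q p * (h (Hn n p) * (R n p * \<phi>t p + Jn n p * \<phi>x p)) = indicator ?Q p * f1 p + indicator ?Q p * f2 p"
      using AB[of p] by (cases "p \<in> ?Q") (auto simp: A_def B_def algebra_simps)
  qed
  also have "\<dots> = - (\<integral>x. indicator {-r..r} x * (A (0, x) * \<phi> (0, x)) \<partial>lborel)"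
    using if1 if2 I1 I2 by simp
  finally show ?thesis using parts by simp
qed

end

lemma supported_test_bounded:
  assumes st: "supported_test T s r \<phi> \<phi>t \<phi>x"
  shows "\<exists>B>0. \<forall>p. 0 \<le> fst p \<longrightarrow> fst p < T \<longrightarrow> \<bar>\<phi> p\<bar> \<le> B \<and> \<bar>\<phi>t p\<bar> \<le> B \<and> \<bar>\<phi>x p\<bar> \<le> B"
proof -
  note D = supported_test_D[OF st]
  let ?Q = "{0..s} \<times> {-r..r}"
  have Q: "compact ?Q" by (intro compact_Times compact_Icc)
  have bd: "\<exists>B>0. \<forall>p\<in>?Q. \<bar>f p\<bar> \<le> B" if "continuous_on (spacetime0 T) f" for f :: "real \<times> real \<Rightarrow> real"
  proof -
    have "?Q \<subseteq> spacetime0 T" using D(1,2) by auto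
    then have "bounded (f ` ?Q)"
      by (intro compact_imp_bounded compact_continuous_image continuous_on_subset[OF that] Q)
    then show ?thesis unfolding bounded_pos by auto
  qed
  obtain B0 where B0: "B0 > 0" "\<And>p. p \<in> ?Q \<Longrightarrow> \<bar>\<phi> p\<bar> \<le> B0" using bd[OF D(5)] by blast
  obtain B1 where B1: "B1 > 0" "\<And>p. p \<in> ?Q \<Longrightarrow> \<bar>\<phi>t p\<bar> \<le> B1" using bd[OF D(6)] by blast
  obtain B2 where B2: "B2 > 0" "\<And>p. p \<in> ?Q \<Longrightarrow> \<bar>\<phi>x p\<bar> \<le> B2" using bd[OF D(7)] by blast
  define B where "B = B0 + B1 + B2"
  have "\<bar>\<phi> p\<bar> \<le> B \<and> \<bar>\<phi>t p\<bar> \<le> B \<and> \<bar>\<phi>x p\<bar> \<le> B" if p: "0 \<le> fst p" "fst p < T" for p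
  proof (cases "p \<in> ?Q")
    case True
    show ?thesis using B0(1) B1(1) B2(1) B0(2)[OF True] B1(2)[OF True] B2(2)[OF True] by (auto simp: B_def)
  next
    case False
    then have "fst p \<ge> s \<or> \<bar>snd p\<bar> \<ge> r" using p by (cases p) (auto simp: abs_le_iff not_le)
    then show ?thesis using D(4)[OF p] B0(1) B1(1) B2(1) by (auto simp: B_def)
  qed
  moreover have "B > 0" using B0(1) B1(1) B2(1) by (simp add: B_def)
  ultimately show ?thesis by blast
qed

context transport
begin

lemma limit_green_identity:
  assumes st: "supported_test T s r \<phi> \<phi>t \<phi>x"
    and h: "\<And>y. (h has_real_derivative h' y) (at y)" "continuous_on UNIV h'" "\<And>y. \<bar>h y\<bar> \<le> Bh"
    and K: "\<And>y. (K has_real_derivative h y) (at y)"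
  shows "(\<integral>p. indicator (spacetime T) p * (\<rho> p * (h (H p) * (\<phi>t p + b p * \<phi>x p))) \<partial>lborel)
    = (\<integral>x. indicator {-r..r} x * (K (H (0, x)) * \<phi>x (0, x)) \<partial>lborel)"
proof -
  note D = supported_test_D[OF st]
  let ?Q = "{0..s} \<times> {-r..r}"
  obtain B where B: "B > 0" "\<And>p. 0 \<le> fst p \<Longrightarrow> fst p < T \<Longrightarrow> \<bar>\<phi> p\<bar> \<le> B \<and> \<bar>\<phi>t p\<bar> \<le> B \<and> \<bar>\<phi>x p\<bar> \<le> B"
    using supported_test_bounded[OF st] by blast
  have Bh0: "Bh \<ge> 0" using h(3)[of 0] by linarith
  have hc: "continuous_on UNIV h" and Kc: "continuous_on UNIV K"
    using h(1) K by (intro continuous_at_imp_continuous_on ballI DERIV_isCont; blast)+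
  have [measurable]: "h \<in> borel_measurable borel" "K \<in> borel_measurable borel"
    using hc Kc by (auto intro: borel_measurable_continuous_onI)
  have Qsub: "?Q \<subseteq> spacetime0 T" using D(1,2) by auto
  have Qb: "?Q \<in> sets borel" by (intro borel_Times) auto
  obtain N where N: "\<And>n. n \<ge> N \<Longrightarrow> s < T - 2 * e n"
    using eventually_slab[of s] D(1,2) by (auto simp: eventually_sequentially)
  have ev: "s < T - 2 * e (n + N)" for n by (rule N) simp
  have c\<phi>: "continuous_on ?Q \<phi>t" "continuous_on ?Q \<phi>x"
    using D(6,7) Qsub by (auto intro: continuous_on_subset)
  have cHn: "continuous_on ?Q (Hn (n + N))" for n
    by (rule continuous_on_subset[OF continuous_Hn[OF ev]]) auto
  let ?F = "\<lambda>n p. indicator ?Q p * (h (Hn n p) * (R n p * \<phi>t p + Jn n p * \<phi>x p))"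
  let ?L = "\<lambda>p. indicator (spacetime T) p * (\<rho> p * (h (H p) * (\<phi>t p + b p * \<phi>x p)))"
  have ms: "(\<lambda>p. indicator (spacetime T) p * f p) \<in> borel_measurable borel" if "continuous_on (spacetime0 T) f"
    for f :: "real \<times> real \<Rightarrow> real"
  proof -
    have "continuous_on (spacetime T) f" by (rule continuous_on_subset[OF that]) auto
    from borel_measurable_continuous_on_indicator[OF strip_sets this] show ?thesis by simp
  qed
  have mL: "?L \<in> borel_measurable borel"
  proof -
    have "(\<lambda>p. \<rho> p * (h (H p) * (indicator (spacetime T) p * \<phi>t p + b p * (indicator (spacetime T) p * \<phi>x p)))) \<in> borel_measurable borel"
      using ms[OF D(6)] ms[OF D(7)] by measurable
    then show ?thesis by (rule measurable_cong[THEN iffD1, rotated]) (simp add: algebra_simps)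
  qed
  have lim1: "(\<lambda>n. integral\<^sup>L lborel (?F (n + N))) \<longlonglongrightarrow> integral\<^sup>L lborel ?L"
  proof (rule integral_dominated_convergence[where w="\<lambda>p. (Bh * (C * B + L * B)) * indicator ?Q p"])
    show "?F (n + N) \<in> borel_measurable lborel" for n
    proof -
      have "continuous_on ?Q (\<lambda>p. h (Hn (n + N) p))"
        by (rule continuous_on_compose2[OF hc cHn]) auto
      then have "continuous_on ?Q (\<lambda>p. h (Hn (n + N) p) * (R (n + N) p * \<phi>t p + Jn (n + N) p * \<phi>x p))"
        by (intro continuous_on_mult continuous_on_add continuous_R_Jn c\<phi>)
      from borel_measurable_continuous_on_indicator[OF Qb this] show ?thesis by simp
    qed
    show "integrable lborel (\<lambda>p. (Bh * (C * B + L * B)) * indicator ?Q p)"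
      using borel_integrable_compact[OF compact_Times[OF compact_Icc compact_Icc] continuous_on_const[of _ "1::real"], of 0 s "-r" r]
      by (intro integrable_mult_right) simp
    show "AE p in lborel. (\<lambda>n. ?F (n + N) p) \<longlonglongrightarrow> ?L p"
      using AE_conv AE_fst_neq_0
    proof eventually_elim
      case (elim p)
      show ?case
      proof (cases "p \<in> ?Q")
        case True
        then have p: "0 < fst p" "fst p < T" using elim D(2) by (auto simp: mem_Times_iff)
        have Hl: "(\<lambda>n. Hn n p) \<longlonglongrightarrow> H p" using H_lim[of "fst p" "snd p"] p by simp
        have hl: "(\<lambda>n. h (Hn n p)) \<longlonglongrightarrow> h (H p)" using continuous_on_tendsto_compose[OF hc Hl] by auto
        have "(\<lambda>n. ?F n p) \<longlonglongrightarrow> indicator ?Q p * (h (H p) * (\<rho> p * \<phi>t p + J p * \<phi>x p))"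
          using elim by (intro tendsto_intros hl) auto
        moreover have "indicator ?Q p * (h (H p) * (\<rho> p * \<phi>t p + J p * \<phi>x p)) = ?L p"
          using True p by (simp add: J_eq algebra_simps mem_Times_iff)
        ultimately have "(\<lambda>n. ?F n p) \<longlonglongrightarrow> ?L p" by (simp only:)
        then show ?thesis by (rule LIMSEQ_ignore_initial_segment)
      next
        case False
        have "p \<in> spacetime T \<Longrightarrow> \<phi>t p = 0 \<and> \<phi>x p = 0"
        proof -
          assume p: "p \<in> spacetime T"
          then have "fst p \<ge> s \<or> \<bar>snd p\<bar> \<ge> r"
            using False by (cases p) (auto simp: not_le abs_real_def)
          then show ?thesis using D(4)[of p] p by (auto simp: mem_Times_iff)
        qed
        then have Lp: "?L p = 0" by (auto simp: indicator_def)
        show ?thesis unfolding Lp using False by simp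
      qed
    qed
    show "AE p in lborel. norm (?F (n + N) p) \<le> (Bh * (C * B + L * B)) * indicator ?Q p" for n
    proof (rule AE_I2)
      fix p
      show "norm (?F (n + N) p) \<le> (Bh * (C * B + L * B)) * indicator ?Q p"
      proof (cases "p \<in> ?Q")
        case True
        then have p: "0 \<le> fst p" "fst p < T" using D(2) by (auto simp: mem_Times_iff)
        have "\<bar>R (n + N) p * \<phi>t p\<bar> \<le> C * B" "\<bar>Jn (n + N) p * \<phi>x p\<bar> \<le> L * B"
          unfolding abs_mult using R_bounds[of "n + N" p] Jn_bound[of "n + N" p] B(2)[OF p] c L by (intro mult_mono; simp)+
        then have "\<bar>R (n + N) p * \<phi>t p + Jn (n + N) p * \<phi>x p\<bar> \<le> C * B + L * B" by linarith
        then have "\<bar>h (Hn (n + N) p)\<bar> * \<bar>R (n + N) p * \<phi>t p + Jn (n + N) p * \<phi>x p\<bar> \<le> Bh * (C * B + L * B)"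
          using h(3) Bh0 by (intro mult_mono) auto
        then show ?thesis using True by (simp add: abs_mult)
      qed simp
    qed
  qed (use mL in simp)
  let ?Ini = "\<lambda>n x. indicator {-r..r} x * (K (Hn n (0, x)) * \<phi>x (0, x))"
  have c0: "continuous_on {-r..r} (\<lambda>x. f (0, x))" if "continuous_on ?Q f" for f :: "real \<times> real \<Rightarrow> real"
    by (rule continuous_on_compose2[OF that]) (use D(1) in \<open>auto intro: continuous_intros\<close>)
  have "bounded (K ` {- (C * r)..C * r})"
    by (intro compact_imp_bounded compact_continuous_image continuous_on_subset[OF Kc]) auto
  then obtain BK where BK: "BK > 0" "\<And>y. \<bar>y\<bar> \<le> C * r \<Longrightarrow> \<bar>K y\<bar> \<le> BK"
    unfolding bounded_pos by (auto simp: abs_le_iff)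
  have lim2: "(\<lambda>n. integral\<^sup>L lborel (?Ini (n + N))) \<longlonglongrightarrow> (\<integral>x. indicator {-r..r} x * (K (H (0, x)) * \<phi>x (0, x)) \<partial>lborel)"
  proof (rule integral_dominated_convergence[where w="\<lambda>x. (BK * B) * indicator {-r..r} x"])
    have "continuous_on {-r..r} (\<lambda>x. K (H (0, x)) * \<phi>x (0, x))"
      by (intro continuous_on_mult c0 c\<phi> continuous_on_compose2[OF Kc] H_continuous_x) auto
    from borel_measurable_continuous_on_indicator[OF _ this]
    show "(\<lambda>x. indicator {-r..r} x * (K (H (0, x)) * \<phi>x (0, x))) \<in> borel_measurable lborel" by simp
    show "?Ini (n + N) \<in> borel_measurable lborel" for n
    proof -
      have "continuous_on ?Q (\<lambda>p. K (Hn (n + N) p))"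
        by (rule continuous_on_compose2[OF Kc cHn]) auto
      then have "continuous_on {-r..r} (\<lambda>x. K (Hn (n + N) (0, x)) * \<phi>x (0, x))"
        by (intro continuous_on_mult c0 c\<phi>)
      from borel_measurable_continuous_on_indicator[OF _ this] show ?thesis by simp
    qed
    show "integrable lborel (\<lambda>x. (BK * B) * indicator {-r..r} x)"
      by (intro integrable_mult_right integrable_real_indicator) (auto simp: emeasure_lborel_Icc_eq)
    show "AE x in lborel. (\<lambda>n. ?Ini (n + N) x) \<longlonglongrightarrow> indicator {-r..r} x * (K (H (0, x)) * \<phi>x (0, x))"
    proof (rule AE_I2)
      fix x
      have "(\<lambda>n. Hn n (0, x)) \<longlonglongrightarrow> H (0, x)" using H_lim[of 0 x] T by simp
      then have "(\<lambda>n. K (Hn n (0, x))) \<longlonglongrightarrow> K (H (0, x))" using continuous_on_tendsto_compose[OF Kc] by auto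
      then have "(\<lambda>n. ?Ini n x) \<longlonglongrightarrow> indicator {-r..r} x * (K (H (0, x)) * \<phi>x (0, x))" by (intro tendsto_intros)
      then show "(\<lambda>n. ?Ini (n + N) x) \<longlonglongrightarrow> indicator {-r..r} x * (K (H (0, x)) * \<phi>x (0, x))"
        by (rule LIMSEQ_ignore_initial_segment)
    qed
    show "AE x in lborel. norm (?Ini (n + N) x) \<le> (BK * B) * indicator {-r..r} x" for n
    proof (rule AE_I2)
      fix x
      show "norm (?Ini (n + N) x) \<le> (BK * B) * indicator {-r..r} x"
      proof (cases "x \<in> {-r..r}")
        case True
        have "\<bar>Hn (n + N) (0, x)\<bar> \<le> C * \<bar>x\<bar>"
          using Hn_abs_le[of "n + N" 0 x] e(1,2)[of "n + N"] by simp
        also have "\<dots> \<le> C * r" using True C_pos by (intro mult_left_mono) auto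
        finally have "\<bar>K (Hn (n + N) (0, x))\<bar> \<le> BK" by (rule BK(2))
        then have "\<bar>K (Hn (n + N) (0, x))\<bar> * \<bar>\<phi>x (0, x)\<bar> \<le> BK * B"
          using B(2)[of "(0, x)"] BK(1) T by (intro mult_mono) auto
        then show ?thesis using True by (simp add: abs_mult)
      qed simp
    qed
  qed
  have "integral\<^sup>L lborel (?F (n + N)) = integral\<^sup>L lborel (?Ini (n + N))" for n
    by (rule smooth_green_identity[OF st h(1,2) K ev])
  with lim1 have "(\<lambda>n. integral\<^sup>L lborel (?Ini (n + N))) \<longlonglongrightarrow> integral\<^sup>L lborel ?L" by simp
  from LIMSEQ_unique[OF this lim2] show ?thesis .
qed

text \<open>
  Write \<open>K (z) = - \<integral> h(y) [z \<le> y] dy\<close> and exchange the integrals. The condition \<open>H (0, x) \<le> y\<close> means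
  \<open>x \<le> X (0, y)\<close>, and integrating \<open>\<phi>x (0, \<cdot>)\<close> over this half-line gives \<open>\<phi> (0, X (0, y))\<close>.
\<close>

lemma initial_trace_fubini:
  assumes st: "supported_test T s r \<phi> \<phi>t \<phi>x"
    and h: "continuous_on UNIV h" "\<And>y. \<bar>y\<bar> > M \<Longrightarrow> h y = 0"
    and K: "\<And>y. (K has_real_derivative h y) (at y)" "\<And>y. y \<ge> M \<Longrightarrow> K y = 0"
  shows "(\<integral>x. indicator {-r..r} x * (K (H (0, x)) * \<phi>x (0, x)) \<partial>lborel)
    = - (\<integral>y. h y * \<phi> (0, X (0, y)) \<partial>lborel)"
proof -
  note D = supported_test_D[OF st]
  obtain B where B: "B > 0" "\<And>p. 0 \<le> fst p \<Longrightarrow> fst p < T \<Longrightarrow> \<bar>\<phi> p\<bar> \<le> B \<and> \<bar>\<phi>t p\<bar> \<le> B \<and> \<bar>\<phi>x p\<bar> \<le> B"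
    using supported_test_bounded[OF st] by blast
  have supph: "z \<notin> cbox (- \<bar>M\<bar>) \<bar>M\<bar> \<Longrightarrow> h z = 0" for z using h(2)[of z] by auto
  obtain Bh where Bh: "Bh > 0" "\<And>y. \<bar>h y\<bar> \<le> Bh"
    using continuous_compact_support_bounded[OF h(1) supph] by blast
  define g where "g x = \<phi>x (0, x)" for x
  have gc: "continuous_on S g" for S
    unfolding g_def by (rule continuous_on_compose2[OF D(7)]) (use T in \<open>auto intro: continuous_intros\<close>)
  have g0: "g x = 0" if "\<bar>x\<bar> \<ge> r" for x using D(4)[of "(0, x)"] that T by (simp add: g_def)
  have gB: "\<bar>g x\<bar> \<le> B" for x using B(2)[of "(0, x)"] T by (simp add: g_def)
  have [measurable]: "h \<in> borel_measurable borel" "g \<in> borel_measurable borel"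
    using h(1) gc by (auto intro: borel_measurable_continuous_onI)
  define f where "f x y = g x * (h y * of_bool (H (0, x) \<le> y))" for x y
  have f_int: "integrable (lborel \<Otimes>\<^sub>M lborel) (\<lambda>(x, y). f x y)"
  proof -
    have "integrable lborel (\<lambda>p. f (fst p) (snd p))"
    proof (rule integrable_bounded_support[where K="B * Bh" and a="(-r, - \<bar>M\<bar>)" and b="(r, \<bar>M\<bar>)"])
      have [measurable]: "fst \<in> borel_measurable (borel :: (real \<times> real) measure)" "snd \<in> borel_measurable (borel :: (real \<times> real) measure)"
        by (intro borel_measurable_continuous_onI continuous_on_fst continuous_on_snd continuous_on_id)+
      show "(\<lambda>p. f (fst p) (snd p)) \<in> borel_measurable borel" unfolding f_def by measurable
      show "\<bar>f (fst p) (snd p)\<bar> \<le> B * Bh" for p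
      proof -
        have "\<bar>h (snd p) * of_bool (H (0, fst p) \<le> snd p)\<bar> \<le> Bh" using Bh by (auto simp: of_bool_def less_imp_le)
        then show ?thesis unfolding f_def abs_mult[of "g _"] using gB[of "fst p"] B(1) by (intro mult_mono) auto
      qed
      show "f (fst p) (snd p) = 0" if "p \<notin> cbox (- r, - \<bar>M\<bar>) (r, \<bar>M\<bar>)" for p
      proof (cases "\<bar>fst p\<bar> \<ge> r")
        case False
        then have "snd p \<notin> cbox (- \<bar>M\<bar>) \<bar>M\<bar>" using that by (cases p) (auto simp: cbox_Pair_eq)
        then show ?thesis using supph by (simp add: f_def)
      qed (simp add: f_def g0)
    qed
    then show ?thesis by (simp add: lborel_prod split_beta')
  qed
  have inner_y: "(\<integral>y. f x y \<partial>lborel) = - (indicator {-r..r} x * (K (H (0, x)) * \<phi>x (0, x)))" for x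
  proof -
    let ?z = "H (0, x)" and ?M = "max (H (0, x)) M"
    have "(\<integral>y. indicator {?z..?M} y *\<^sub>R h y \<partial>lborel) = K ?M - K ?z"
    proof (rule integral_FTC_atLeastAtMost)
      show "(K has_vector_derivative h y) (at y within {?z..?M})" for y
        using K(1)[of y] unfolding has_real_derivative_iff_has_vector_derivative by (rule has_vector_derivative_at_within)
    qed (auto intro: continuous_on_subset[OF h(1)])
    also have "\<dots> = - K ?z" by (simp add: K(2))
    finally have "(\<integral>y. indicator {?z..?M} y * h y \<partial>lborel) = - K ?z" by simp
    moreover have fy: "h y * of_bool (?z \<le> y) = indicator {?z..?M} y * h y" for y
    proof -
      have "h y = 0" if "y > ?M" using h(2)[of y] that by linarith
      then show ?thesis by (auto simp: indicator_def not_le)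
    qed
    ultimately have "(\<integral>y. f x y \<partial>lborel) = g x * - K ?z" unfolding f_def fy by simp
    moreover have "indicator {-r..r} x * g x = g x"
    proof -
      have "x \<notin> {-r..r} \<Longrightarrow> \<bar>x\<bar> \<ge> r" by auto
      then show ?thesis using g0[of x] by (auto simp: indicator_def)
    qed
    ultimately show ?thesis by (auto simp: g_def)
  qed
  have inner_x: "(\<integral>x. f x y \<partial>lborel) = h y * \<phi> (0, X (0, y))" for y
  proof -
    let ?z = "X (0, y)" and ?r = "- max r \<bar>X (0, y)\<bar>"
    have "(\<integral>x. indicator {?r..?z} x *\<^sub>R g x \<partial>lborel) = \<phi> (0, ?z) - \<phi> (0, ?r)"
    proof (rule integral_FTC_atLeastAtMost)
      show "((\<lambda>x. \<phi> (0, x)) has_vector_derivative g x) (at x within {?r..?z})" for x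
        using D(8)[of 0 x] T unfolding has_real_derivative_iff_has_vector_derivative g_def
        by (auto intro: has_vector_derivative_at_within)
    qed (auto intro: gc)
    also have "\<phi> (0, ?r) = 0" using D(4)[of "(0, ?r)"] T by auto
    finally have "(\<integral>x. indicator {?r..?z} x * g x \<partial>lborel) = \<phi> (0, ?z)" by simp
    moreover have "f x y = h y * (indicator {?r..?z} x * g x)" for x
    proof -
      have "H (0, x) \<le> y \<longleftrightarrow> x \<le> ?z" using X_less_iff(1)[of 0 y x] by (simp add: not_less[symmetric])
      moreover have "x < ?r \<Longrightarrow> g x = 0" using g0[of x] by auto
      ultimately show ?thesis by (auto simp: f_def indicator_def)
    qed
    ultimately show ?thesis by simp
  qed
  have "(\<integral>y. (\<integral>x. f x y \<partial>lborel) \<partial>lborel) = (\<integral>x. (\<integral>y. f x y \<partial>lborel) \<partial>lborel)"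
    by (rule lborel_pair.Fubini_integral[OF f_int])
  then show ?thesis unfolding inner_x inner_y by simp
qed

end

context transport
begin

text \<open>
  The weak form of \<open>d/dt \<phi> (t, X (t, y)) = (\<phi>t + b \<phi>x) (t, X (t, y))\<close>, integrated over time. The last claim is
  proved by testing with \<open>h = hat y0 y1 n\<close>: the change of variables, the limiting Green identity and
  \<open>initial_trace_fubini\<close> show that both sides have the same integral over every interval of \<open>y\<close>.
\<close>

lemma characteristic_identity:
  assumes st: "supported_test T s r \<phi> \<phi>t \<phi>x"
  defines "a \<equiv> \<lambda>p. indicator (spacetime T) p * (\<phi>t p + b p * \<phi>x p)"
  shows "a \<in> borel_measurable borel"
    and "\<exists>B M. \<forall>t y. \<bar>a (\<Psi> (t, y))\<bar> \<le> B * indicator {0..T} t * indicator {-M..M} y"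
    and "AE y in lborel. (\<integral>t. a (\<Psi> (t, y)) \<partial>lborel) = - \<phi> (0, X (0, y))"
proof -
  note D = supported_test_D[OF st]
  obtain B where B: "B > 0" "\<And>p. 0 \<le> fst p \<Longrightarrow> fst p < T \<Longrightarrow> \<bar>\<phi> p\<bar> \<le> B \<and> \<bar>\<phi>t p\<bar> \<le> B \<and> \<bar>\<phi>x p\<bar> \<le> B"
    using supported_test_bounded[OF st] by blast
  have ms: "(\<lambda>p. indicator (spacetime T) p * f p) \<in> borel_measurable borel"
    if "continuous_on (spacetime0 T) f" for f :: "real \<times> real \<Rightarrow> real"
  proof -
    have "continuous_on (spacetime T) f" by (rule continuous_on_subset[OF that]) auto
    from borel_measurable_continuous_on_indicator[OF strip_sets this] show ?thesis by simp
  qed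
  show a_meas: "a \<in> borel_measurable borel"
  proof -
    have "(\<lambda>p. indicator (spacetime T) p * \<phi>t p + b p * (indicator (spacetime T) p * \<phi>x p)) \<in> borel_measurable borel"
      using ms[OF D(6)] ms[OF D(7)] by measurable
    then show ?thesis unfolding a_def by (rule measurable_cong[THEN iffD1, rotated]) (simp add: algebra_simps)
  qed
  note [measurable] = a_meas
  define Ba where "Ba = B + L / c * B"
  have Ba0: "Ba \<ge> 0" using B(1) L c by (simp add: Ba_def)
  have a_bound: "\<bar>a p\<bar> \<le> Ba" for p
  proof (cases "p \<in> spacetime T")
    case True
    then have p: "0 \<le> fst p" "fst p < T" by (auto simp: mem_Times_iff)
    have "\<bar>b p * \<phi>x p\<bar> \<le> L / c * B"
      unfolding abs_mult using b_bound[of p] B(2)[OF p] L c by (intro mult_mono) auto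
    then have "\<bar>\<phi>t p + b p * \<phi>x p\<bar> \<le> Ba" using B(2)[OF p] unfolding Ba_def by linarith
    then show ?thesis using True by (simp add: a_def)
  qed (use Ba0 in \<open>simp add: a_def\<close>)
  define M where "M = L * T + C * r"
  have supp: "a p = 0" if "\<not> (0 < fst p \<and> fst p < s \<and> \<bar>snd p\<bar> < r)" for p
    using D(4)[of p] that by (cases "p \<in> spacetime T") (auto simp: a_def mem_Times_iff not_less)
  have big: "\<bar>X (t, y)\<bar> \<ge> r" if "\<bar>y\<bar> > M" "0 \<le> t" "t < T" for t y
  proof (rule ccontr)
    assume "\<not> \<bar>X (t, y)\<bar> \<ge> r"
    then have "C * \<bar>X (t, y)\<bar> \<le> C * r" using C_pos by (intro mult_left_mono) auto
    then show False using H_abs_le[OF that(2,3), of "X (t, y)"] that(1) by (simp add: M_def)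
  qed
  have f_supp: "a (\<Psi> (t, y)) = 0" if "t \<notin> {0..T} \<or> y \<notin> {-M..M}" for t y
  proof (rule supp, rule notI)
    assume "0 < fst (\<Psi> (t, y)) \<and> fst (\<Psi> (t, y)) < s \<and> \<bar>snd (\<Psi> (t, y))\<bar> < r"
    then have "0 < t" "t < T" "\<bar>X (t, y)\<bar> < r" using D(2) by (auto simp: \<Psi>_def)
    moreover from this have "\<not> \<bar>y\<bar> > M" using big[of y t] by auto
    ultimately show False using that by auto
  qed
  have f_bound: "\<bar>a (\<Psi> (t, y))\<bar> \<le> Ba * indicator {0..T} t * indicator {-M..M} y" for t y
  proof (cases "t \<notin> {0..T} \<or> y \<notin> {-M..M}")
    case True
    then show ?thesis using f_supp[OF True] by (auto simp: indicator_def)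
  qed (use a_bound in simp)
  then show "\<exists>B M. \<forall>t y. \<bar>a (\<Psi> (t, y))\<bar> \<le> B * indicator {0..T} t * indicator {-M..M} y" by blast
  have f_int: "integrable lborel (\<lambda>p. k (snd p) * a (\<Psi> p))"
    if [measurable]: "k \<in> borel_measurable borel" and k: "\<And>y. \<bar>k y\<bar> \<le> 1" for k :: "real \<Rightarrow> real"
  proof (rule integrable_bounded_support[where K=Ba and a="(0, -M)" and b="(T, M)"])
    have "(\<lambda>p. k (snd p)) \<in> borel_measurable (borel :: (real \<times> real) measure)"
      by (rule measurable_compose[OF _ that(1)]) (intro borel_measurable_continuous_onI continuous_on_snd continuous_on_id)
    then show "(\<lambda>p. k (snd p) * a (\<Psi> p)) \<in> borel_measurable borel" by measurable
    show "\<bar>k (snd p) * a (\<Psi> p)\<bar> \<le> Ba" for p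
      using mult_mono[OF k[of "snd p"] a_bound[of "\<Psi> p"]] by (simp add: abs_mult)
    show "k (snd p) * a (\<Psi> p) = 0" if "p \<notin> cbox (0, - M) (T, M)" for p
      using f_supp[of "fst p" "snd p"] that by (cases p) (auto simp: cbox_Pair_eq)
  qed
  have f_int': "integrable (lborel \<Otimes>\<^sub>M lborel) (\<lambda>(t, y). k y * a (\<Psi> (t, y)))"
    if "k \<in> borel_measurable borel" "\<And>y. \<bar>k y\<bar> \<le> 1" for k :: "real \<Rightarrow> real"
    using f_int[OF that] by (simp add: lborel_prod split_beta')
  define G where "G y = (\<integral>t. a (\<Psi> (t, y)) \<partial>lborel)" for y
  define p0 where "p0 y = \<phi> (0, X (0, y))" for y
  have G_int: "integrable lborel G"
    using lborel_pair.integrable_snd[OF f_int'[of "\<lambda>_. 1"]] by (simp add: G_def[abs_def])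
  have p0_cont: "continuous_on UNIV p0"
  proof -
    have "continuous_on UNIV (\<lambda>y. X (0, y))"
      by (rule continuous_on_compose2[OF X_continuous]) (use T in \<open>auto intro: continuous_intros\<close>)
    then have "continuous_on UNIV (\<lambda>y. (0::real, X (0, y)))" by (intro continuous_on_Pair continuous_on_const)
    then show ?thesis unfolding p0_def[abs_def]
      by (rule continuous_on_compose2[OF D(5)]) (use T in auto)
  qed
  then have [measurable]: "p0 \<in> borel_measurable borel" by (rule borel_measurable_continuous_onI)
  have p0_bound: "\<bar>p0 y\<bar> \<le> B" for y using B(2)[of "(0, X (0, y))"] T by (simp add: p0_def)
  have p0_supp: "p0 y = 0" if "y \<notin> cbox (-M) M" for y
    using D(4)[of "(0, X (0, y))"] big[of y 0] that T by (auto simp: p0_def)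
  have p0_int: "integrable lborel p0"
    by (rule integrable_bounded_support[OF _ p0_bound p0_supp]) measurable
  have key: "(\<integral>y. k y * G y \<partial>lborel) = (\<integral>p. \<rho> p * (k (H p) * a p) \<partial>lborel)"
    if [measurable]: "k \<in> borel_measurable borel" and k: "\<And>y. \<bar>k y\<bar> \<le> 1" for k :: "real \<Rightarrow> real"
  proof -
    have msnd: "(\<lambda>p. k (snd p)) \<in> borel_measurable (borel :: (real \<times> real) measure)"
      by (rule measurable_compose[OF _ that(1)]) (intro borel_measurable_continuous_onI continuous_on_snd continuous_on_id)
    have m: "(\<lambda>p. k (snd p) * a (\<Psi> p)) \<in> borel_measurable borel" using msnd by measurable
    have "(\<integral>p. \<rho> p * (k (H p) * a p) \<partial>lborel) = (\<integral>p. \<rho> p * (k (snd (\<Phi> p)) * a (\<Psi> (\<Phi> p))) \<partial>lborel)"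
      unfolding \<Phi>_\<Psi>(2) by (simp add: \<Phi>_def)
    also have "\<dots> = (\<integral>p. k (snd p) * a (\<Psi> p) \<partial>lborel)" by (rule change_of_variables(2)[OF m])
    also have "\<dots> = (\<integral>p. (case p of (t, y) \<Rightarrow> k y * a (\<Psi> (t, y))) \<partial>(lborel \<Otimes>\<^sub>M lborel))"
      by (simp add: lborel_prod split_beta')
    also have "\<dots> = (\<integral>y. (\<integral>t. k y * a (\<Psi> (t, y)) \<partial>lborel) \<partial>lborel)"
      by (rule lborel_pair.integral_snd[OF f_int'[OF that], symmetric])
    also have "\<dots> = (\<integral>y. k y * G y \<partial>lborel)" by (simp add: G_def)
    finally show ?thesis by simp
  qed
  have interval: "(\<integral>y. (G y + p0 y) * indicator {y0<..<y1} y \<partial>lborel) = 0" for y0 y1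
  proof (cases "y0 \<le> y1")
    case False
    then show ?thesis by simp
  next
    case True
    let ?h = "\<lambda>n. hat y0 y1 (real n)"
    have hm [measurable]: "?h n \<in> borel_measurable borel" for n
      by (intro borel_measurable_continuous_onI hat_continuous)
    have h1: "\<bar>?h n y\<bar> \<le> 1" for n y using hat_bounds[of "real n" y0 y1 y] by simp
    have zero: "(\<integral>y. ?h n y * G y \<partial>lborel) + (\<integral>y. ?h n y * p0 y \<partial>lborel) = 0" for n
    proof -
      let ?M = "max \<bar>y0\<bar> \<bar>y1\<bar>"
      have h0: "?h n y = 0" if "\<bar>y\<bar> > ?M" for y
      proof -
        have "y \<notin> {y0<..<y1}" using that by auto
        then show ?thesis using hat_outside(1)[OF True] by simp
      qed
      have h0': "?h n y = 0" if "y \<ge> ?M" for y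
      proof -
        have "y \<notin> {y0<..<y1}" using that by auto
        then show ?thesis using hat_outside(1)[OF True] by simp
      qed
      obtain K where K: "\<And>y. (K has_real_derivative ?h n y) (at y)" "\<And>y. y \<ge> ?M \<Longrightarrow> K y = 0"
        using antiderivative_vanishing_right[OF hat_continuous h0'] by blast
      have "(\<integral>y. ?h n y * G y \<partial>lborel) = (\<integral>p. \<rho> p * (?h n (H p) * a p) \<partial>lborel)"
        by (rule key[OF hm h1])
      also have "\<dots> = (\<integral>p. indicator (spacetime T) p * (\<rho> p * (?h n (H p) * (\<phi>t p + b p * \<phi>x p))) \<partial>lborel)"
        unfolding a_def by (simp add: mult_ac)
      also have "\<dots> = (\<integral>x. indicator {-r..r} x * (K (H (0, x)) * \<phi>x (0, x)) \<partial>lborel)"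
        by (rule limit_green_identity[OF st hat_has_derivative hat'_continuous h1 K(1)])
      also have "\<dots> = - (\<integral>y. ?h n y * p0 y \<partial>lborel)"
        unfolding p0_def by (rule initial_trace_fubini[OF st hat_continuous h0 K])
      finally show ?thesis by simp
    qed
    have hint: "integrable lborel (\<lambda>y. ?h n y * g y)" if "integrable lborel g" for g n
    proof (rule Bochner_Integration.integrable_bound[OF that])
      show "AE y in lborel. norm (?h n y * g y) \<le> norm (g y)"
      proof (rule AE_I2)
        fix y show "norm (?h n y * g y) \<le> norm (g y)"
          using mult_right_mono[OF h1[of n y], of "\<bar>g y\<bar>"] by (simp add: abs_mult)
      qed
    qed (use borel_measurable_integrable[OF that] in measurable)
    have "(\<integral>y. (G y + p0 y) * ?h n y \<partial>lborel) = 0" for n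
    proof -
      have "(\<integral>y. (G y + p0 y) * ?h n y \<partial>lborel) = (\<integral>y. ?h n y * G y + ?h n y * p0 y \<partial>lborel)"
        by (rule Bochner_Integration.integral_cong) (simp_all add: algebra_simps)
      then show ?thesis using zero[of n] hint[OF G_int, of n] hint[OF p0_int, of n]
        by (simp add: Bochner_Integration.integral_add)
    qed
    moreover have "(\<lambda>n. \<integral>y. (G y + p0 y) * ?h n y \<partial>lborel) \<longlonglongrightarrow> (\<integral>y. (G y + p0 y) * indicator {y0<..<y1} y \<partial>lborel)"
    proof (rule integral_dominated_convergence[where w="\<lambda>y. \<bar>G y + p0 y\<bar>"])
      have [measurable]: "G \<in> borel_measurable borel" using borel_measurable_integrable[OF G_int] by simp
      show "(\<lambda>y. (G y + p0 y) * ?h n y) \<in> borel_measurable lborel" for n by measurable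
      show "(\<lambda>y. (G y + p0 y) * indicator {y0<..<y1} y) \<in> borel_measurable lborel" by measurable
      show "integrable lborel (\<lambda>y. \<bar>G y + p0 y\<bar>)" using G_int p0_int by simp
      show "AE y in lborel. (\<lambda>n. (G y + p0 y) * ?h n y) \<longlonglongrightarrow> (G y + p0 y) * indicator {y0<..<y1} y"
        by (intro AE_I2 tendsto_mult tendsto_const hat_tendsto[OF True])
      show "AE y in lborel. norm ((G y + p0 y) * ?h n y) \<le> \<bar>G y + p0 y\<bar>" for n
      proof (rule AE_I2)
        fix y show "norm ((G y + p0 y) * ?h n y) \<le> \<bar>G y + p0 y\<bar>"
          using mult_left_mono[OF h1[of n y], of "\<bar>G y + p0 y\<bar>"] by (simp add: abs_mult)
      qed
    qed
    ultimately show ?thesis by (simp add: LIMSEQ_const_iff)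
  qed
  have D_int: "integrable lborel (\<lambda>y. G y + p0 y)" using G_int p0_int by simp
  have "AE y in lborel. G y + p0 y = 0"
  proof (rule AE_zero_if_indicator_integrals_zero[OF D_int])
    fix A :: "real set" assume "A \<in> sets lborel"
    then have A: "A \<in> sets borel" by simp
    show "(\<integral>y. (G y + p0 y) * indicator A y \<partial>lborel) = 0"
    proof (rule integral_indicator_zero_if_boxes[OF D_int _ _ A, of "\<lambda>y. y"])
      show "(\<integral>y. (G y + p0 y) * indicator (box y0 y1) y \<partial>lborel) = 0" for y0 y1
        using interval[of y0 y1] by (simp add: box_real)
    qed simp
  qed
  then show "AE y in lborel. (\<integral>t. a (\<Psi> (t, y)) \<partial>lborel) = - \<phi> (0, X (0, y))"
    by eventually_elim (simp add: G_def p0_def)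
qed

text \<open>
  \<open>H (0, \<cdot>)\<close> has a Lipschitz inverse, so the image of Lebesgue measure under it is absolutely continuous. With
  its density \<open>d\<close>, the function \<open>w = d \<cdot> (ubar \<circ> X (0, \<cdot>))\<close> has the required property. Building \<open>w\<close> from the
  image of Lebesgue measure avoids splitting \<open>ubar\<close> into positive and negative parts.
\<close>

lemma initial_density:
  fixes ubar :: "real \<Rightarrow> real"
  assumes [measurable]: "ubar \<in> borel_measurable borel"
  shows "\<exists>w. w \<in> borel_measurable borel \<and>
    (\<forall>F. F \<in> borel_measurable borel \<longrightarrow>
      integrable lborel (\<lambda>y. w y * F y) = integrable lborel (\<lambda>x. ubar x * F (H (0, x))) \<and>
      (\<integral>y. w y * F y \<partial>lborel) = (\<integral>x. ubar x * F (H (0, x)) \<partial>lborel))"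
proof -
  define H0 where "H0 x = H (0, x)" for x
  define X0 where "X0 y = X (0, y)" for y
  have HX: "H0 (X0 y) = y" "X0 (H0 x) = x" for x y by (simp_all add: H0_def X0_def)
  have [measurable]: "H0 \<in> borel_measurable borel"
    unfolding H0_def by (intro borel_measurable_continuous_onI H_continuous_x)
  have X0_lip: "\<bar>X0 y - X0 z\<bar> \<le> (1 / c) * \<bar>y - z\<bar>" for y z
    using X_lipschitz_y[of 0 y z] c(1) by (simp add: X0_def field_simps)
  have [measurable]: "X0 \<in> borel_measurable borel"
  proof (intro borel_measurable_continuous_onI lipschitz_on_continuous_on[where L="1 / c"] lipschitz_onI)
    show "dist (X0 y) (X0 z) \<le> 1 / c * dist y z" for y z using X0_lip by (simp add: dist_real_def)
  qed (use c in simp)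
  define \<nu> where "\<nu> = distr lborel borel H0"
  have ac: "absolutely_continuous lborel \<nu>"
    unfolding absolutely_continuous_def
  proof
    fix N :: "real set" assume N: "N \<in> null_sets lborel"
    then have Nb: "N \<in> sets borel" by (auto simp: null_sets_def)
    have "negligible N" using N by (simp add: negligible_iff_null_sets null_sets_completionI)
    then have "negligible (X0 ` N)"
    proof (rule negligible_locally_Lipschitz_image[rotated])
      fix y assume "y \<in> N"
      show "\<exists>T B. open T \<and> y \<in> T \<and> (\<forall>z\<in>N \<inter> T. norm (X0 z - X0 y) \<le> B * norm (z - y))"
        using X0_lip by (intro exI[of _ UNIV] exI[of _ "1 / c"]) auto
    qed simp
    moreover have "X0 ` N = H0 -` N"
    proof (intro equalityI subsetI)
      fix x assume "x \<in> H0 -` N"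
      then show "x \<in> X0 ` N" using HX(2)[of x] by (intro image_eqI[of _ _ "H0 x"]) auto
    qed (auto simp: HX)
    ultimately have "H0 -` N \<in> null_sets lebesgue" by (simp add: negligible_iff_null_sets)
    moreover have "H0 -` N \<in> sets borel" using measurable_sets_borel[of H0 borel N] Nb by simp
    ultimately have "emeasure lborel (H0 -` N) = 0"
      by (simp add: null_sets_def)
    then show "N \<in> null_sets \<nu>"
      unfolding \<nu>_def using Nb by (simp add: null_sets_def emeasure_distr)
  qed
  obtain f where f [measurable]: "f \<in> borel_measurable borel" and dens: "density lborel f = \<nu>"
    using sigma_finite_measure.Radon_Nikodym[OF sigma_finite_lborel ac] by (auto simp: \<nu>_def)
  have fin: "AE y in lborel. f y \<noteq> \<infinity>"
  proof -
    have "AE y in lborel. f y * indicator {-real n..real n} y \<noteq> \<infinity>" for n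
    proof (rule nn_integral_PInf_AE)
      have sub: "H0 -` {-real n..real n} \<subseteq> {X0 (-real n)..X0 (real n)}"
        using X_less_iff(1)[of 0] X_less_iff(2)[of _ 0] by (auto simp: H0_def X0_def not_less[symmetric])
      have "(\<integral>\<^sup>+y. f y * indicator {-real n..real n} y \<partial>lborel) = emeasure \<nu> {-real n..real n}"
        unfolding dens[symmetric] by (simp add: emeasure_density)
      also have "\<dots> = emeasure lborel (H0 -` {-real n..real n})"
        unfolding \<nu>_def by (simp add: emeasure_distr)
      also have "\<dots> \<le> emeasure lborel {X0 (-real n)..X0 (real n)}"
        by (rule emeasure_mono[OF sub]) simp
      also have "\<dots> < \<infinity>" by (simp add: emeasure_lborel_Icc_eq)
      finally show "(\<integral>\<^sup>+y. f y * indicator {-real n..real n} y \<partial>lborel) \<noteq> \<infinity>" by simp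
    qed measurable
    then have "AE y in lborel. \<forall>n. f y * indicator {-real n..real n} y \<noteq> \<infinity>" by (simp add: AE_all_countable)
    then show ?thesis
    proof eventually_elim
      case (elim y)
      obtain n :: nat where "\<bar>y\<bar> < real n" using reals_Archimedean2 by blast
      then have "y \<in> {-real n..real n}" by auto
      then show ?case using elim[rule_format, of n] by simp
    qed
  qed
  \<comment> \<open>legitimate because \<open>f\<close> is finite almost everywhere\<close>
  define d where "d y = enn2real (f y)" for y
  have [measurable]: "d \<in> borel_measurable borel" unfolding d_def by measurable
  have "AE y in lborel. f y = ennreal (d y)"
    using fin by eventually_elim (simp add: d_def less_top[symmetric])
  then have dens': "density lborel (\<lambda>y. ennreal (d y)) = \<nu>"
    unfolding dens[symmetric] by (intro density_cong) (auto elim: AE_mp)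
  have d0: "AE y in lborel. 0 \<le> d y" by (simp add: d_def)
  define w where "w y = d y * ubar (X0 y)" for y
  have "integrable lborel (\<lambda>y. w y * F y) = integrable lborel (\<lambda>x. ubar x * F (H0 x)) \<and>
      (\<integral>y. w y * F y \<partial>lborel) = (\<integral>x. ubar x * F (H0 x) \<partial>lborel)"
    if [measurable]: "F \<in> borel_measurable borel" for F
  proof
    let ?g = "\<lambda>y. ubar (X0 y) * F y"
    have wF: "w y * F y = d y *\<^sub>R ?g y" for y by (simp add: w_def)
    have "integrable lborel (\<lambda>y. w y * F y) = integrable \<nu> ?g"
      unfolding wF dens'[symmetric] using d0 by (subst integrable_density) auto
    also have "\<dots> = integrable lborel (\<lambda>x. ?g (H0 x))"
      unfolding \<nu>_def by (rule integrable_distr_eq) measurable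
    finally show "integrable lborel (\<lambda>y. w y * F y) = integrable lborel (\<lambda>x. ubar x * F (H0 x))" by (simp add: HX)
    have "(\<integral>y. w y * F y \<partial>lborel) = integral\<^sup>L \<nu> ?g"
      unfolding wF dens'[symmetric] using d0 by (subst integral_density) auto
    also have "\<dots> = (\<integral>x. ?g (H0 x) \<partial>lborel)"
      unfolding \<nu>_def by (rule integral_distr) measurable
    finally show "(\<integral>y. w y * F y \<partial>lborel) = (\<integral>x. ubar x * F (H0 x) \<partial>lborel)" by (simp add: HX)
  qed
  moreover have "w \<in> borel_measurable borel" unfolding w_def by measurable
  ultimately show ?thesis unfolding H0_def by blast
qed

text \<open>
  \<open>u = \<rho> w(H)\<close> is constant along characteristics relative to \<open>\<rho>\<close>. After the change of variables the weak
  equation is the integral of \<open>characteristic_identity\<close> against \<open>w\<close>.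
\<close>

lemma weak_solution_exists:
  fixes ubar :: "real \<Rightarrow> real"
  assumes [measurable]: "ubar \<in> borel_measurable borel"
    and loc: "\<And>r. integrable lborel (\<lambda>x. ubar x * indicator {-r..r} x)"
  shows "\<exists>u. u \<in> borel_measurable borel \<and>
    (\<forall>r. integrable lborel (\<lambda>p. u p * indicator ({0<..<T} \<times> {-r..r}) p)) \<and>
    (\<forall>\<phi> \<phi>t \<phi>x. C1_on (spacetime0 T) \<phi> \<phi>t \<phi>x \<and> compactly_supported_in (spacetime0 T) \<phi> \<longrightarrow>
       integrable lborel (\<lambda>p. indicator (spacetime T) p * (u p * (\<phi>t p + b p * \<phi>x p))) \<and>
       integrable lborel (\<lambda>x. ubar x * \<phi> (0, x)) \<and>
       (\<integral>p. indicator (spacetime T) p * (u p * (\<phi>t p + b p * \<phi>x p)) \<partial>lborel) + (\<integral>x. ubar x * \<phi> (0, x) \<partial>lborel) = 0)"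
proof -
  obtain w where w [measurable]: "w \<in> borel_measurable borel"
    and wF: "\<And>F. F \<in> borel_measurable borel \<Longrightarrow>
      integrable lborel (\<lambda>y. w y * F y) = integrable lborel (\<lambda>x. ubar x * F (H (0, x))) \<and>
      (\<integral>y. w y * F y \<partial>lborel) = (\<integral>x. ubar x * F (H (0, x)) \<partial>lborel)"
    using initial_density[OF assms(1)] by blast
  have [measurable]: "(\<lambda>x. H (0, x)) \<in> borel_measurable borel"
    by (intro borel_measurable_continuous_onI H_continuous_x)
  have w_loc: "integrable lborel (\<lambda>y. w y * indicator {-M..M} y)" for M
  proof -
    define r where "r = (M + L * T) / c"
    have "integrable lborel (\<lambda>x. ubar x * indicator {-M..M} (H (0, x)))"
    proof (rule Bochner_Integration.integrable_bound[OF loc[of r]])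
      show "AE x in lborel. norm (ubar x * indicator {-M..M} (H (0, x))) \<le> norm (ubar x * indicator {-r..r} x)"
      proof (rule AE_I2)
        fix x
        have "H (0, x) \<in> {-M..M} \<Longrightarrow> x \<in> {-r..r}"
          using H_large[of 0 M x] T by (force simp: r_def)
        then show "norm (ubar x * indicator {-M..M} (H (0, x))) \<le> norm (ubar x * indicator {-r..r} x)"
          by (auto simp: indicator_def)
      qed
    qed measurable
    then show ?thesis using wF[of "indicator {-M..M}"] by simp
  qed
  define u where "u p = \<rho> p * w (H p)" for p
  have u_meas [measurable]: "u \<in> borel_measurable borel" unfolding u_def by measurable
  have mw: "(\<lambda>p. w (snd p)) \<in> borel_measurable (borel :: (real \<times> real) measure)"
    by (rule measurable_compose[OF _ w]) (intro borel_measurable_continuous_onI continuous_on_snd continuous_on_id)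
  have tensor_int: "integrable (lborel \<Otimes>\<^sub>M lborel) (\<lambda>(t, y). (B * indicator {0..T} t) * (w y * indicator {-M..M} y))" for B M :: real
  proof (rule integrable_tensor(1)[OF _ w_loc])
    show "integrable lborel (\<lambda>t. B * indicator {0..T} t)"
      by (intro integrable_mult_right integrable_real_indicator) (auto simp: emeasure_lborel_Icc_eq)
  qed
  have comp_int: "integrable lborel (\<lambda>p. w (snd p) * g p)"
    if [measurable]: "g \<in> borel_measurable borel" and g: "\<And>t y. \<bar>g (t, y)\<bar> \<le> B * indicator {0..T} t * indicator {-M..M} y" for g B M
  proof (rule Bochner_Integration.integrable_bound)
    show "integrable lborel (\<lambda>p. case p of (t, y) \<Rightarrow> (B * indicator {0..T} t) * (w y * indicator {-M..M} y))"
      using tensor_int[of B M] by (simp add: lborel_prod)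
    show "AE p in lborel. norm (w (snd p) * g p) \<le> norm (case p of (t, y) \<Rightarrow> (B * indicator {0..T} t) * (w y * indicator {-M..M} y))"
    proof (rule AE_I2)
      fix p :: "real \<times> real"
      obtain t y where p: "p = (t, y)" by (cases p)
      have "\<bar>w y\<bar> * \<bar>g (t, y)\<bar> \<le> \<bar>w y\<bar> * (B * indicator {0..T} t * indicator {-M..M} y)"
        by (intro mult_left_mono g) simp
      also have "\<dots> \<le> \<bar>(B * indicator {0..T} t) * (w y * indicator {-M..M} y)\<bar>"
        by (auto simp: indicator_def abs_mult mult.commute[of "\<bar>w y\<bar>"] intro!: mult_right_mono)
      finally show "norm (w (snd p) * g p) \<le> norm (case p of (t, y) \<Rightarrow> (B * indicator {0..T} t) * (w y * indicator {-M..M} y))"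
        by (simp add: p abs_mult)
    qed
  qed (use mw in measurable)

  have part1: "integrable lborel (\<lambda>p. u p * indicator ({0<..<T} \<times> {-r..r}) p)" for r
  proof -
    let ?Q = "{0<..<T} \<times> {-r..r}"
    define M where "M = L * T + C * r"
    have Q [measurable]: "?Q \<in> sets borel" by (intro borel_Times) auto
    have gm: "(\<lambda>p. indicator ?Q (\<Psi> p) :: real) \<in> borel_measurable borel"
      by (rule measurable_compose[OF \<Psi>_measurable]) (simp add: Q)
    have gb: "\<bar>indicator ?Q (\<Psi> (t, y))\<bar> \<le> (1::real) * indicator {0..T} t * indicator {-M..M} y" for t y
    proof (cases "\<Psi> (t, y) \<in> ?Q")
      case True
      then have t: "0 < t" "t < T" "\<bar>X (t, y)\<bar> \<le> r" by (auto simp: \<Psi>_def)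
      then have "C * \<bar>X (t, y)\<bar> \<le> C * r" using C_pos by (intro mult_left_mono) auto
      then have "\<bar>y\<bar> \<le> M" using H_abs_le[of t "X (t, y)"] t by (simp add: M_def)
      then show ?thesis using t by (auto simp: indicator_def)
    qed simp
    have "integrable lborel (\<lambda>p. w (snd p) * indicator ?Q (\<Psi> p))" by (rule comp_int[OF gm gb])
    moreover have "(\<lambda>p. w (snd p) * indicator ?Q (\<Psi> p)) \<in> borel_measurable borel" using mw gm by measurable
    ultimately have "integrable lborel (\<lambda>p. \<rho> p * (w (snd (\<Phi> p)) * indicator ?Q (\<Psi> (\<Phi> p))))"
      using change_of_variables(1)[of "\<lambda>p. w (snd p) * indicator ?Q (\<Psi> p)"] by simp
    moreover have "\<rho> p * (w (snd (\<Phi> p)) * indicator ?Q (\<Psi> (\<Phi> p))) = u p * indicator ?Q p" for p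
      unfolding \<Phi>_\<Psi>(2) by (simp add: u_def \<Phi>_def)
    ultimately show ?thesis by (simp only:)
  qed
  have part2: "integrable lborel (\<lambda>p. indicator (spacetime T) p * (u p * (\<phi>t p + b p * \<phi>x p))) \<and>
       integrable lborel (\<lambda>x. ubar x * \<phi> (0, x)) \<and>
       (\<integral>p. indicator (spacetime T) p * (u p * (\<phi>t p + b p * \<phi>x p)) \<partial>lborel) + (\<integral>x. ubar x * \<phi> (0, x) \<partial>lborel) = 0"
    if C1: "C1_on (spacetime0 T) \<phi> \<phi>t \<phi>x" and cs: "compactly_supported_in (spacetime0 T) \<phi>" for \<phi> \<phi>t \<phi>x
  proof -
    obtain s r where st: "supported_test T s r \<phi> \<phi>t \<phi>x" using supported_test_exists[OF T C1 cs] by blast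
    note D = supported_test_D[OF st]
    define a where "a p = indicator (spacetime T) p * (\<phi>t p + b p * \<phi>x p)" for p
    note ch = characteristic_identity[OF st, folded a_def]
    note [measurable] = ch(1)
    obtain B M where BM: "\<And>t y. \<bar>a (\<Psi> (t, y))\<bar> \<le> B * indicator {0..T} t * indicator {-M..M} y" using ch(2) by blast
    have am: "(\<lambda>p. a (\<Psi> p)) \<in> borel_measurable borel" by measurable
    have fm: "(\<lambda>p. w (snd p) * a (\<Psi> p)) \<in> borel_measurable borel" using mw am by measurable
    have f_int: "integrable lborel (\<lambda>p. w (snd p) * a (\<Psi> p))" by (rule comp_int[OF am BM])
    have f_int': "integrable (lborel \<Otimes>\<^sub>M lborel) (\<lambda>(t, y). w y * a (\<Psi> (t, y)))"
      using f_int by (simp add: lborel_prod split_beta')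
    have ua: "\<rho> p * (w (snd (\<Phi> p)) * a (\<Psi> (\<Phi> p))) = indicator (spacetime T) p * (u p * (\<phi>t p + b p * \<phi>x p))" for p
      unfolding \<Phi>_\<Psi>(2) by (simp add: u_def a_def \<Phi>_def)
    have int1: "integrable lborel (\<lambda>p. indicator (spacetime T) p * (u p * (\<phi>t p + b p * \<phi>x p)))"
      using change_of_variables(1)[OF fm] f_int unfolding ua by simp
    have p0c: "continuous_on UNIV (\<lambda>x. \<phi> (0, x))"
      by (rule continuous_on_compose2[OF D(5)]) (use T in \<open>auto intro: continuous_intros\<close>)
    have p0m [measurable]: "(\<lambda>x. \<phi> (0, x)) \<in> borel_measurable borel"
      by (rule borel_measurable_continuous_onI[OF p0c])
    obtain B0 where B0: "B0 > 0" "\<And>p. 0 \<le> fst p \<Longrightarrow> fst p < T \<Longrightarrow> \<bar>\<phi> p\<bar> \<le> B0 \<and> \<bar>\<phi>t p\<bar> \<le> B0 \<and> \<bar>\<phi>x p\<bar> \<le> B0"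
      using supported_test_bounded[OF st] by blast
    have int2: "integrable lborel (\<lambda>x. ubar x * \<phi> (0, x))"
    proof (rule Bochner_Integration.integrable_bound[OF integrable_mult_right[OF loc[of r], of B0]])
      show "AE x in lborel. norm (ubar x * \<phi> (0, x)) \<le> norm (B0 * (ubar x * indicator {-r..r} x))"
      proof (rule AE_I2)
        fix x
        show "norm (ubar x * \<phi> (0, x)) \<le> norm (B0 * (ubar x * indicator {-r..r} x))"
        proof (cases "x \<in> {-r..r}")
          case True
          then show ?thesis
            using mult_right_mono[of "\<bar>\<phi> (0, x)\<bar>" B0 "\<bar>ubar x\<bar>"] B0(1) B0(2)[of "(0, x)"] T
            by (simp add: abs_mult mult.commute)
        next
          case False
          then have "\<phi> (0, x) = 0" using D(4)[of "(0, x)"] T by (auto simp: abs_if split: if_splits)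
          then show ?thesis by simp
        qed
      qed
    qed measurable
    have X0m: "(\<lambda>y. \<phi> (0, X (0, y))) \<in> borel_measurable borel"
    proof -
      have "continuous_on UNIV (\<lambda>y. X (0, y))"
        by (rule continuous_on_compose2[OF X_continuous]) (use T in \<open>auto intro: continuous_intros\<close>)
      then show ?thesis by (intro borel_measurable_continuous_onI continuous_on_compose2[OF p0c]) auto
    qed
    have "(\<integral>p. indicator (spacetime T) p * (u p * (\<phi>t p + b p * \<phi>x p)) \<partial>lborel) = (\<integral>p. w (snd p) * a (\<Psi> p) \<partial>lborel)"
      using change_of_variables(2)[OF fm] unfolding ua .
    also have "\<dots> = (\<integral>p. (case p of (t, y) \<Rightarrow> w y * a (\<Psi> (t, y))) \<partial>(lborel \<Otimes>\<^sub>M lborel))"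
      by (simp add: lborel_prod split_beta')
    also have "\<dots> = (\<integral>y. (\<integral>t. w y * a (\<Psi> (t, y)) \<partial>lborel) \<partial>lborel)"
      by (rule lborel_pair.integral_snd[OF f_int', symmetric])
    also have "\<dots> = (\<integral>y. w y * (\<integral>t. a (\<Psi> (t, y)) \<partial>lborel) \<partial>lborel)" by simp
    also have "\<dots> = (\<integral>y. w y * - \<phi> (0, X (0, y)) \<partial>lborel)"
    proof (rule integral_cong_AE)
      have "(\<lambda>(y, t). a (\<Psi> (t, y))) \<in> borel_measurable (lborel \<Otimes>\<^sub>M lborel)"
      proof -
        have "(\<lambda>p. (snd p, fst p)) \<in> borel_measurable (borel :: (real \<times> real) measure)"
          by (intro borel_measurable_continuous_onI continuous_intros)
        from measurable_compose[OF this am] show ?thesis by (simp add: lborel_prod split_beta')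
      qed
      then have "(\<lambda>y. \<integral>t. a (\<Psi> (t, y)) \<partial>lborel) \<in> borel_measurable lborel"
        by (rule lborel.borel_measurable_lebesgue_integral[of "\<lambda>y t. a (\<Psi> (t, y))" lborel])
      then show "(\<lambda>y. w y * (\<integral>t. a (\<Psi> (t, y)) \<partial>lborel)) \<in> borel_measurable lborel" by simp
      show "(\<lambda>y. w y * - \<phi> (0, X (0, y))) \<in> borel_measurable lborel" using X0m by simp
      show "AE y in lborel. w y * (\<integral>t. a (\<Psi> (t, y)) \<partial>lborel) = w y * - \<phi> (0, X (0, y))"
        using ch(3) by eventually_elim simp
    qed
    also have "\<dots> = - (\<integral>y. w y * \<phi> (0, X (0, y)) \<partial>lborel)" by simp
    also have "(\<integral>y. w y * \<phi> (0, X (0, y)) \<partial>lborel) = (\<integral>x. ubar x * \<phi> (0, x) \<partial>lborel)"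
      using wF[OF X0m] by simp
    finally show ?thesis using int1 int2 by simp
  qed
  show ?thesis using u_meas part1 part2 by blast
qed

end

section \<open>Borel representatives and conclusion\<close>

lemma AE_lebesgue_on_borel:
  fixes S :: "'a::euclidean_space set"
  assumes "S \<in> sets borel"
  shows "(AE p in lebesgue_on S. P p) \<longleftrightarrow> (AE p in lborel. p \<in> S \<longrightarrow> P p)"
  using assms by (subst AE_restrict_space_iff) (simp_all add: AE_completion_iff)

lemma borel_representative:
  fixes f :: "'a::euclidean_space \<Rightarrow> real"
  assumes S: "S \<in> sets borel" and f: "f \<in> borel_measurable (lebesgue_on S)"
  shows "\<exists>g. g \<in> borel_measurable borel \<and> (AE p in lborel. p \<in> S \<longrightarrow> f p = g p)"
proof -
  have "(\<lambda>p. indicator S p * f p) \<in> borel_measurable lebesgue"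
    using f S borel_measurable_restrict_space_iff[of S lebesgue f] by simp
  from completion_ex_borel_measurable_real[OF this] obtain g
    where g: "g \<in> borel_measurable lborel" "AE p in lborel. indicator S p * f p = g p" by blast
  have "AE p in lborel. p \<in> S \<longrightarrow> f p = g p"
    using g(2) by eventually_elim auto
  then show ?thesis using g(1) by auto
qed

lemma lebesgue_on_integral_borel:
  fixes f g :: "'a::euclidean_space \<Rightarrow> real"
  assumes S: "S \<in> sets borel" and f: "f \<in> borel_measurable (lebesgue_on S)"
    and g: "(\<lambda>p. indicator S p * g p) \<in> borel_measurable borel"
    and eq: "AE p in lborel. p \<in> S \<longrightarrow> f p = g p"
  shows "integrable (lebesgue_on S) f \<longleftrightarrow> integrable lborel (\<lambda>p. indicator S p * g p)"
    and "integral\<^sup>L (lebesgue_on S) f = (\<integral>p. indicator S p * g p \<partial>lborel)"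
proof -
  have mf: "(\<lambda>p. indicator S p * f p) \<in> borel_measurable lebesgue"
    using f S borel_measurable_restrict_space_iff[of S lebesgue f] by simp
  have mg: "(\<lambda>p. indicator S p * g p) \<in> borel_measurable lebesgue"
    using g by (intro measurable_completion) simp
  have AE_eq: "AE p in lebesgue. indicator S p * f p = indicator S p * g p"
    using AE_completion[OF eq] by eventually_elim (auto simp: indicator_def)
  have "integrable (lebesgue_on S) f \<longleftrightarrow> integrable lebesgue (\<lambda>p. indicator S p * f p)"
    using S by (subst integrable_restrict_space) simp_all
  also have "\<dots> \<longleftrightarrow> integrable lebesgue (\<lambda>p. indicator S p * g p)"
    by (rule integrable_cong_AE[OF mf mg AE_eq])
  also have "\<dots> \<longleftrightarrow> integrable lborel (\<lambda>p. indicator S p * g p)"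
    using g by (intro integrable_completion) simp
  finally show "integrable (lebesgue_on S) f \<longleftrightarrow> integrable lborel (\<lambda>p. indicator S p * g p)" .
  have "integral\<^sup>L (lebesgue_on S) f = (\<integral>p. indicator S p * f p \<partial>lebesgue)"
    using S by (subst integral_restrict_space) simp_all
  also have "\<dots> = (\<integral>p. indicator S p * g p \<partial>lebesgue)"
    by (rule integral_cong_AE[OF mf mg AE_eq])
  also have "\<dots> = (\<integral>p. indicator S p * g p \<partial>lborel)"
    using g by (intro integral_completion) simp
  finally show "integral\<^sup>L (lebesgue_on S) f = (\<integral>p. indicator S p * g p \<partial>lborel)" .
qed

lemma L1_loc_on_measurable:
  fixes f :: "'a::euclidean_space \<Rightarrow> real"
  assumes f: "L1_loc_on S f" and S: "S \<in> sets borel"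
    and K: "\<And>n::nat. compact (K n)" "\<And>n. K n \<subseteq> S" "\<And>p. p \<in> S \<Longrightarrow> \<forall>\<^sub>F n in sequentially. p \<in> K n"
  shows "f \<in> borel_measurable (lebesgue_on S)"
proof -
  have Kb: "K n \<in> sets borel" for n using K(1) by (simp add: borel_compact)
  have m: "(\<lambda>p. indicator (K n) p * f p) \<in> borel_measurable lebesgue" for n
  proof -
    have "integrable (lebesgue_on (K n)) f" using f K by (simp add: L1_loc_on_def)
    then have "f \<in> borel_measurable (lebesgue_on (K n))" by (rule borel_measurable_integrable)
    then show ?thesis using borel_measurable_restrict_space_iff[of "K n" lebesgue f] Kb by simp
  qed
  have "(\<lambda>p. indicator S p * f p) \<in> borel_measurable lebesgue"
  proof (rule borel_measurable_LIMSEQ_real[OF _ m])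
    fix p
    have "\<forall>\<^sub>F n in sequentially. indicator (K n) p * f p = indicator S p * f p"
    proof (cases "p \<in> S")
      case True
      show ?thesis using K(3)[OF True] by eventually_elim (simp add: True)
    next
      case False
      then have "p \<notin> K n" for n using K(2) by auto
      then show ?thesis using False by simp
    qed
    then show "(\<lambda>n. indicator (K n) p * f p) \<longlonglongrightarrow> indicator S p * f p" by (rule tendsto_eventually)
  qed
  then show ?thesis using S borel_measurable_restrict_space_iff[of S lebesgue f] by simp
qed

lemma lebesgue_on_UNIV: "lebesgue_on UNIV = lebesgue"
  by (rule measure_eqI) (simp_all add: sets_restrict_space emeasure_restrict_space)

lemma spacetime_borel: "spacetime T \<in> sets borel"
  by (intro borel_Times) auto

lemma L1_loc_on_spacetime_measurable:
  assumes "L1_loc_on (spacetime T) f" "T > 0"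
  shows "f \<in> borel_measurable (lebesgue_on (spacetime T))"
proof (rule L1_loc_on_measurable[OF assms(1) spacetime_borel])
  define d where "d n = T / (real n + 3)" for n
  let ?K = "\<lambda>n. {d n..T - d n} \<times> {- real n..real n}"
  show "compact (?K n)" for n by (intro compact_Times compact_Icc)
  have d: "d n > 0" for n using assms(2) by (simp add: d_def)
  show "?K n \<subseteq> spacetime T" for n using d[of n] by auto
  fix p :: "real \<times> real" assume p: "p \<in> spacetime T"
  have "d \<longlonglongrightarrow> 0" unfolding d_def[abs_def]
  proof (rule tendsto_divide_0[OF tendsto_const filterlim_at_top_imp_at_infinity])
    show "filterlim (\<lambda>n. real n + 3) at_top sequentially"
      using filterlim_tendsto_add_at_top[OF tendsto_const[of 3] filterlim_real_sequentially] by (simp add: add.commute)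
  qed
  then have "\<forall>\<^sub>F n in sequentially. d n < min (fst p) (T - fst p)"
    using p by (intro order_tendstoD(2)[where y="0::real"]) (auto simp: mem_Times_iff)
  moreover have "\<forall>\<^sub>F n in sequentially. real n > \<bar>snd p\<bar>"
    using filterlim_real_sequentially by (simp add: filterlim_at_top_dense)
  ultimately show "\<forall>\<^sub>F n in sequentially. p \<in> ?K n"
    by eventually_elim (auto simp: mem_Times_iff)
qed

text \<open>
  The conditions on \<open>q\<close> place the translated support of the kernel inside the open strip, so that the kernel
  is an admissible test function for the distributional equation.
\<close>

lemma bump_kernel_test_function:
  assumes D: "smooth_bump a b D" and q: "0 < a + fst q" "b + fst q < T"
  defines "k \<equiv> \<lambda>i j p. tensor (D i) (D j) (p - q)"
  shows "C_infty_on (spacetime T) (k 0 0)" "compactly_supported_in (spacetime T) (k 0 0)"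
    "C1_on (spacetime T) (k 0 0) (k 1 0) (k 0 1)" "\<And>i j p. p \<notin> spacetime T \<Longrightarrow> k i j p = 0"
    "\<And>i j. continuous_on UNIV (k i j)"
proof -
  note DD = smooth_bump_D[OF D]
  have d: "(k i j has_derivative (\<lambda>h. k (Suc i) j p * fst h + k i (Suc j) p * snd h)) (at p)" for i j p
  proof -
    have 1: "((\<lambda>p. p - q) has_derivative (\<lambda>h. h)) (at p)" by (auto intro!: derivative_eq_intros)
    show ?thesis
      unfolding k_def
      using diff_chain_at[OF 1 tensor_has_derivative[OF DD(1)[of i "fst (p - q)"] DD(1)[of j "snd (p - q)"]]]
      by (simp add: o_def tensor_def)
  qed
  show cont: "continuous_on UNIV (k i j)" for i j
    using d by (meson continuous_at_imp_continuous_on has_derivative_continuous)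
  have C1: "C1_on (spacetime T) (k i j) (k (Suc i) j) (k i (Suc j))" for i j
    unfolding C1_on_def
    by (intro conjI ballI continuous_on_subset[OF cont] subset_UNIV) (rule has_derivative_at_withinI[OF d])
  then show "C_infty_on (spacetime T) (k 0 0)" "C1_on (spacetime T) (k 0 0) (k 1 0) (k 0 1)"
    unfolding C_infty_on_def by (auto intro!: exI[of _ k])
  have supp: "p \<in> {a + fst q..b + fst q} \<times> {a + snd q..b + snd q}" if "k i j p \<noteq> 0" for i j p
  proof -
    have "D i (fst p - fst q) \<noteq> 0" "D j (snd p - snd q) \<noteq> 0" using that by (auto simp: k_def tensor_def)
    then have "fst p - fst q \<in> {a..b}" "snd p - snd q \<in> {a..b}" using DD(2) by blast+
    then show ?thesis by (auto simp: mem_Times_iff)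
  qed
  have sub: "{a + fst q..b + fst q} \<times> {a + snd q..b + snd q} \<subseteq> spacetime T" using q by auto
  then show "k i j p = 0" if "p \<notin> spacetime T" for i j p using supp[of i j p] that by blast
  have S: "support_on (spacetime T) (k 0 0) \<subseteq> {a + fst q..b + fst q} \<times> {a + snd q..b + snd q}"
    using supp by (auto simp: support_on_def)
  have cl: "closure (support_on (spacetime T) (k 0 0)) \<subseteq> {a + fst q..b + fst q} \<times> {a + snd q..b + snd q}"
    by (rule closure_minimal[OF S]) (intro closed_Times closed_atLeastAtMost)
  have "compact ({a + fst q..b + fst q} \<times> {a + snd q..b + snd q} \<inter> closure (support_on (spacetime T) (k 0 0)))"
    by (intro compact_Int_closed compact_Times compact_Icc closed_closure)
  then show "compactly_supported_in (spacetime T) (k 0 0)"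
    unfolding compactly_supported_in_def Int_absorb1[OF cl] using cl sub by (meson order_trans)
qed

text \<open>
  Borel representatives of \<open>\<rho>\<close> and \<open>b\<close> are clipped to their essential bounds, which makes the bounds hold at
  every point and hence survive mollification.
\<close>

lemma transport_setup:
  assumes T: "T > 0" and b: "L_infty_on (spacetime T) b" and ni: "nearly_incompressible T b"
  shows "\<exists>c C L \<rho>' J e R Jn Rt Rx Jt Jx Hn H b'.
    transport T c C L \<rho>' J e R Jn Rt Rx Jt Jx Hn H b' \<and> (AE p in lborel. p \<in> spacetime T \<longrightarrow> b p = b' p)"
proof -
  note Sb = spacetime_borel[of T]
  obtain \<rho> C0 where \<rho>m: "\<rho> \<in> borel_measurable (lebesgue_on (spacetime T))" and C0: "C0 > 0"
    "AE p in lebesgue_on (spacetime T). 1 / C0 \<le> \<rho> p \<and> \<rho> p \<le> C0" and dist: "distributional_continuity_eq T b \<rho>"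
    using ni unfolding nearly_incompressible_def nearly_incompressible_with_def by blast
  obtain M0 where bm: "b \<in> borel_measurable (lebesgue_on (spacetime T))" and M0: "AE p in lebesgue_on (spacetime T). \<bar>b p\<bar> \<le> M0"
    using b unfolding L_infty_on_def by blast
  obtain g where g [measurable]: "g \<in> borel_measurable borel" and g_eq: "AE p in lborel. p \<in> spacetime T \<longrightarrow> \<rho> p = g p"
    using borel_representative[OF Sb \<rho>m] by blast
  obtain f where f [measurable]: "f \<in> borel_measurable borel" and f_eq: "AE p in lborel. p \<in> spacetime T \<longrightarrow> b p = f p"
    using borel_representative[OF Sb bm] by blast
  define C where "C = max C0 1"
  define c where "c = 1 / C"
  define M where "M = max M0 0"
  have C: "C \<ge> 1" "C0 \<le> C" and M: "M \<ge> 0" "M0 \<le> M" by (auto simp: C_def M_def)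
  have c1: "0 < c" "c \<le> 1" using C by (auto simp: c_def)
  have "1 / C \<le> 1 / C0" using C C0(1) by (intro frac_le) auto
  then have c: "0 < c" "c \<le> 1" "c \<le> C" "c \<le> 1 / C0" using c1 C(1) by (auto simp: c_def[symmetric])
  define \<rho>' where "\<rho>' p = (if p \<in> spacetime T then max c (min C (g p)) else 1)" for p
  define b' where "b' p = (if p \<in> spacetime T then max (- M) (min M (f p)) else 0)" for p
  define J where "J p = \<rho>' p * b' p" for p
  define L where "L = C * M"
  have \<rho>'_meas [measurable]: "\<rho>' \<in> borel_measurable borel"
    unfolding \<rho>'_def by (intro measurable_If_set) (use Sb in auto)
  have b'_meas [measurable]: "b' \<in> borel_measurable borel"
    unfolding b'_def by (intro measurable_If_set) (use Sb in auto)
  have J_meas [measurable]: "J \<in> borel_measurable borel" unfolding J_def by measurable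
  have \<rho>'_bounds: "c \<le> \<rho>' p" "\<rho>' p \<le> C" for p using c C by (auto simp: \<rho>'_def)
  have b'_bound: "\<bar>b' p\<bar> \<le> M" for p using M by (auto simp: b'_def)
  have J_bound: "\<bar>J p\<bar> \<le> L" for p
    unfolding J_def L_def abs_mult using \<rho>'_bounds[of p] b'_bound[of p] c(1) C by (intro mult_mono) auto
  have \<rho>_eq: "AE p in lborel. p \<in> spacetime T \<longrightarrow> \<rho> p = \<rho>' p"
    using g_eq C0(2)[unfolded AE_lebesgue_on_borel[OF Sb]]
  proof eventually_elim
    case (elim p)
    then show ?case using c(4) C(2) by (auto simp: \<rho>'_def)
  qed
  have b_eq: "AE p in lborel. p \<in> spacetime T \<longrightarrow> b p = b' p"
    using f_eq M0[unfolded AE_lebesgue_on_borel[OF Sb]]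
  proof eventually_elim
    case (elim p)
    then show ?case using M by (auto simp: b'_def)
  qed
  have weak: "mollify (tensor (D (Suc 0)) (D 0)) \<rho>' q + mollify (tensor (D 0) (D (Suc 0))) J q = 0"
    if D: "smooth_bump l u D" and q: "0 < l + fst q" "u + fst q < T" for D l u q
  proof -
    note DD = smooth_bump_D[OF D]
    note tf = bump_kernel_test_function[OF D q]
    let ?t = "\<lambda>p. tensor (D 1) (D 0) (p - q)" and ?x = "\<lambda>p. tensor (D 0) (D 1) (p - q)"
    have [measurable]: "?t \<in> borel_measurable borel" "?x \<in> borel_measurable borel"
      by (intro borel_measurable_continuous_onI tf(5))+
    have tm: "?t \<in> borel_measurable (lebesgue_on (spacetime T))" "?x \<in> borel_measurable (lebesgue_on (spacetime T))"
      by (intro continuous_imp_measurable_on_sets_lebesgue continuous_on_subset[OF tf(5)]; use Sb in simp)+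
    have fm: "(\<lambda>p. \<rho> p * (?t p + b p * ?x p)) \<in> borel_measurable (lebesgue_on (spacetime T))"
      using \<rho>m bm tm by measurable
    have gm: "(\<lambda>p. indicator (spacetime T) p * (\<rho>' p * (?t p + b' p * ?x p))) \<in> borel_measurable borel"
      using borel_measurable_indicator[OF Sb] by measurable
    have eq: "AE p in lborel. p \<in> spacetime T \<longrightarrow> \<rho> p * (?t p + b p * ?x p) = \<rho>' p * (?t p + b' p * ?x p)"
      using \<rho>_eq b_eq by eventually_elim auto
    have "(LINT p|lebesgue_on (spacetime T). \<rho> p * (?t p + b p * ?x p)) = 0"
      using dist tf(1-3) unfolding distributional_continuity_eq_def by blast
    then have "(\<integral>p. indicator (spacetime T) p * (\<rho>' p * (?t p + b' p * ?x p)) \<partial>lborel) = 0"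
      using lebesgue_on_integral_borel(2)[OF Sb fm gm eq] by simp
    also have "(\<integral>p. indicator (spacetime T) p * (\<rho>' p * (?t p + b' p * ?x p)) \<partial>lborel)
        = (\<integral>p. \<rho>' p * ?t p + J p * ?x p \<partial>lborel)"
    proof (rule Bochner_Integration.integral_cong[OF refl])
      fix p
      show "indicator (spacetime T) p * (\<rho>' p * (?t p + b' p * ?x p)) = \<rho>' p * ?t p + J p * ?x p"
        using tf(4)[of p 1 0] tf(4)[of p 0 1] by (cases "p \<in> spacetime T") (simp_all add: J_def algebra_simps)
    qed
    also have "\<dots> = (\<integral>p. \<rho>' p * ?t p \<partial>lborel) + (\<integral>p. J p * ?x p \<partial>lborel)"
    proof (rule Bochner_Integration.integral_add)
      have zero: "tensor (D i) (D j) (p - q) = 0" if "p \<notin> cbox ((l, l) + q) ((u, u) + q)" for i j p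
      proof (rule tensor_support[OF DD(2) DD(2)])
        show "p - q \<notin> cbox (l, l) (u, u)"
          using that by (auto simp: cbox_def Basis_prod_def inner_prod_def algebra_simps)
      qed
      have bnd: "\<exists>K. \<forall>p. \<bar>tensor (D i) (D j) (p - q)\<bar> \<le> K" for i j
      proof -
        have "\<exists>K>0. \<forall>p. \<bar>tensor (D i) (D j) (p - q)\<bar> \<le> K"
          by (rule continuous_compact_support_bounded[OF tf(5) zero])
        then show ?thesis by blast
      qed
      have int: "integrable lborel (\<lambda>p. h p * tensor (D i) (D j) (p - q))"
        if [measurable]: "h \<in> borel_measurable borel" and hB: "\<And>p. \<bar>h p\<bar> \<le> B" for h B i j
      proof -
        obtain K where K: "\<And>p. \<bar>tensor (D i) (D j) (p - q)\<bar> \<le> K" using bnd by blast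
        have B0: "B \<ge> 0" using hB[of 0] by linarith
        have [measurable]: "(\<lambda>p. tensor (D i) (D j) (p - q)) \<in> borel_measurable borel"
          by (intro borel_measurable_continuous_onI tf(5))
        show ?thesis
        proof (rule integrable_bounded_support[where K="B * K" and a="(l, l) + q" and b="(u, u) + q"])
          show "\<bar>h p * tensor (D i) (D j) (p - q)\<bar> \<le> B * K" for p
            unfolding abs_mult using hB K B0 by (intro mult_mono) auto
          show "h p * tensor (D i) (D j) (p - q) = 0" if "p \<notin> cbox ((l, l) + q) ((u, u) + q)" for p
            using zero[OF that] by simp
        qed measurable
      qed
      have "\<bar>\<rho>' p\<bar> \<le> C" for p using \<rho>'_bounds[of p] c(1) by linarith
      then show "integrable lborel (\<lambda>p. \<rho>' p * ?t p)" by (rule int[OF \<rho>'_meas])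
      show "integrable lborel (\<lambda>p. J p * ?x p)" by (rule int[OF J_meas J_bound])
    qed
    finally show ?thesis by (simp add: mollify_def)
  qed
  have L0: "L \<ge> 0" using C M by (simp add: L_def)
  have "\<exists>e R Jn Rt Rx Jt Jx Hn. smooth_potentials T c C L \<rho>' J e R Jn Rt Rx Jt Jx Hn"
    by (rule smooth_potentials_exist[OF T c(1,3) L0 \<rho>'_meas J_meas \<rho>'_bounds J_bound]) (rule weak)
  then obtain e R Jn Rt Rx Jt Jx Hn where sp: "smooth_potentials T c C L \<rho>' J e R Jn Rt Rx Jt Jx Hn"
    by (elim exE)
  then interpret sp: smooth_potentials T c C L \<rho>' J e R Jn Rt Rx Jt Jx Hn .
  obtain r where r: "strict_mono r" and conv: "\<And>t x. 0 \<le> t \<Longrightarrow> t < T \<Longrightarrow> convergent (\<lambda>n. Hn (r n) (t, x))"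
    using sp.convergent_subsequence by blast
  \<comment> \<open>off the strip the convention of the locale \<open>potential\<close> is used\<close>
  define H where "H p = (if 0 \<le> fst p \<and> fst p < T then lim (\<lambda>n. Hn (r n) p) else snd p)" for p
  have "transport T c C L \<rho>' J (e \<circ> r) (R \<circ> r) (Jn \<circ> r) (Rt \<circ> r) (Rx \<circ> r) (Jt \<circ> r) (Jx \<circ> r) (Hn \<circ> r) H b'"
  proof (intro transport.intro potential.intro sp.subsequence[OF r] potential_axioms.intro transport_axioms.intro)
    show "(\<lambda>n. (Hn \<circ> r) n (t, x)) \<longlonglongrightarrow> H (t, x)" if "0 \<le> t" "t < T" for t x
      using conv[OF that] that by (simp add: H_def convergent_LIMSEQ_iff)
    show "H (t, x) = x" if "t \<notin> {0..<T}" for t x using that by (auto simp: H_def)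
    show "\<rho>' (t, x) = 1" if "t \<notin> {0<..<T}" for t x using that by (auto simp: \<rho>'_def)
    show "b' \<in> borel_measurable borel" by measurable
    show "J p = \<rho>' p * b' p" for p by (simp add: J_def)
  qed
  then show ?thesis using b_eq by blast
qed

lemma C1_on_spacetime0_measurable:
  assumes "C1_on (spacetime0 T) \<phi> \<phi>t \<phi>x"
  shows "\<phi>t \<in> borel_measurable (lebesgue_on (spacetime T))" "\<phi>x \<in> borel_measurable (lebesgue_on (spacetime T))"
    "(\<lambda>p. indicator (spacetime T) p * \<phi>t p) \<in> borel_measurable borel"
    "(\<lambda>p. indicator (spacetime T) p * \<phi>x p) \<in> borel_measurable borel"
proof -
  have c: "continuous_on (spacetime T) \<phi>t" "continuous_on (spacetime T) \<phi>x"
    using assms unfolding C1_on_def by (auto intro: continuous_on_subset)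
  show "\<phi>t \<in> borel_measurable (lebesgue_on (spacetime T))" "\<phi>x \<in> borel_measurable (lebesgue_on (spacetime T))"
    by (intro continuous_imp_measurable_on_sets_lebesgue c; use spacetime_borel in simp)+
  show "(\<lambda>p. indicator (spacetime T) p * \<phi>t p) \<in> borel_measurable borel"
    "(\<lambda>p. indicator (spacetime T) p * \<phi>x p) \<in> borel_measurable borel"
    using borel_measurable_continuous_on_indicator[OF spacetime_borel c(1)]
      borel_measurable_continuous_on_indicator[OF spacetime_borel c(2)] by simp_all
qed

text \<open>
  The weak formulation only sees \<open>b\<close> and \<open>v\<close> up to null sets, so it may be read with Borel representatives
  and the Borel measure.
\<close>

lemma weak_integrand_borel:
  assumes bm: "b \<in> borel_measurable (lebesgue_on (spacetime T))" and b': "b' \<in> borel_measurable borel"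
    and b_eq: "AE p in lborel. p \<in> spacetime T \<longrightarrow> b p = b' p"
    and vm: "v \<in> borel_measurable (lebesgue_on (spacetime T))" and v': "v' \<in> borel_measurable borel"
    and v_eq: "AE p in lborel. p \<in> spacetime T \<longrightarrow> v p = v' p"
    and C1: "C1_on (spacetime0 T) \<phi> \<phi>t \<phi>x"
  shows "integrable (lebesgue_on (spacetime T)) (\<lambda>p. v p * (\<phi>t p + b p * \<phi>x p)) \<longleftrightarrow>
      integrable lborel (\<lambda>p. indicator (spacetime T) p * (v' p * (\<phi>t p + b' p * \<phi>x p)))"
    and "(LINT p|lebesgue_on (spacetime T). v p * (\<phi>t p + b p * \<phi>x p)) =
      (\<integral>p. indicator (spacetime T) p * (v' p * (\<phi>t p + b' p * \<phi>x p)) \<partial>lborel)"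
proof -
  note [measurable] = b' v'
  note m = C1_on_spacetime0_measurable[OF C1]
  have fm: "(\<lambda>p. v p * (\<phi>t p + b p * \<phi>x p)) \<in> borel_measurable (lebesgue_on (spacetime T))"
    using vm bm m(1,2) by measurable
  have "(\<lambda>p. v' p * (indicator (spacetime T) p * \<phi>t p + b' p * (indicator (spacetime T) p * \<phi>x p))) \<in> borel_measurable borel"
    using m(3,4) by measurable
  then have gm: "(\<lambda>p. indicator (spacetime T) p * (v' p * (\<phi>t p + b' p * \<phi>x p))) \<in> borel_measurable borel"
    by (simp add: algebra_simps)
  have eq: "AE p in lborel. p \<in> spacetime T \<longrightarrow> v p * (\<phi>t p + b p * \<phi>x p) = v' p * (\<phi>t p + b' p * \<phi>x p)"
    using b_eq v_eq by eventually_elim auto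
  show "integrable (lebesgue_on (spacetime T)) (\<lambda>p. v p * (\<phi>t p + b p * \<phi>x p)) \<longleftrightarrow>
      integrable lborel (\<lambda>p. indicator (spacetime T) p * (v' p * (\<phi>t p + b' p * \<phi>x p)))"
    and "(LINT p|lebesgue_on (spacetime T). v p * (\<phi>t p + b p * \<phi>x p)) =
      (\<integral>p. indicator (spacetime T) p * (v' p * (\<phi>t p + b' p * \<phi>x p)) \<partial>lborel)"
    by (rule lebesgue_on_integral_borel[OF spacetime_borel fm gm eq])+
qed

theorem mainTheorem1:
  fixes T :: real and b :: "real \<times> real \<Rightarrow> real" and ubar :: "real \<Rightarrow> real"
  assumes "T > 0"
    and "L_infty_on (spacetime T) b"
    and "nearly_incompressible T b"
    and "L1_loc_on UNIV ubar"
  shows "\<exists>u. weak_solution T b ubar u \<and>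
           (\<forall>v. weak_solution T b ubar v \<longrightarrow>
              (AE p in lebesgue_on (spacetime T). v p = u p))"
proof -
  note Sb = spacetime_borel[of T]
  obtain c C L \<rho>' J e R Jn Rt Rx Jt Jx Hn H b' where
    tr: "transport T c C L \<rho>' J e R Jn Rt Rx Jt Jx Hn H b'" and b_eq: "AE p in lborel. p \<in> spacetime T \<longrightarrow> b p = b' p"
    using transport_setup[OF assms(1-3)] by blast
  interpret transport T c C L \<rho>' J e R Jn Rt Rx Jt Jx Hn H b' by (rule tr)
  have bm: "b \<in> borel_measurable (lebesgue_on (spacetime T))" using assms(2) by (simp add: L_infty_on_def)
  have ubar_lebesgue_on: "ubar \<in> borel_measurable (lebesgue_on UNIV)"
  proof (rule L1_loc_on_measurable[OF assms(4), of "\<lambda>n. {- real n..real n}"])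
    show "\<forall>\<^sub>F n in sequentially. x \<in> {- real n..real n}" for x
    proof -
      have "\<forall>\<^sub>F n in sequentially. real n > \<bar>x\<bar>"
        using filterlim_real_sequentially by (simp add: filterlim_at_top_dense)
      then show ?thesis by eventually_elim auto
    qed
  qed auto
  then obtain ub where ub [measurable]: "ub \<in> borel_measurable borel" and ub_eq: "AE x in lborel. x \<in> UNIV \<longrightarrow> ubar x = ub x"
    using borel_representative[of UNIV ubar] by auto
  have ubar_lebesgue: "ubar \<in> borel_measurable lebesgue" using ubar_lebesgue_on by (simp add: lebesgue_on_UNIV)
  have ub_loc: "integrable lborel (\<lambda>x. ub x * indicator {-r..r} x)" for r
  proof -
    have i: "integrable (lebesgue_on {-r..r}) ubar" using assms(4) by (simp add: L1_loc_on_def)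
    have "AE x in lborel. x \<in> {-r..r} \<longrightarrow> ubar x = ub x" using ub_eq by eventually_elim simp
    from lebesgue_on_integral_borel(1)[OF _ borel_measurable_integrable[OF i] _ this] i
    show ?thesis by (simp add: mult.commute)
  qed
  obtain u where u [measurable]: "u \<in> borel_measurable borel"
    and u_loc: "\<And>r. integrable lborel (\<lambda>p. u p * indicator ({0<..<T} \<times> {-r..r}) p)"
    and u_weak: "\<And>\<phi> \<phi>t \<phi>x. C1_on (spacetime0 T) \<phi> \<phi>t \<phi>x \<Longrightarrow> compactly_supported_in (spacetime0 T) \<phi> \<Longrightarrow>
       integrable lborel (\<lambda>p. indicator (spacetime T) p * (u p * (\<phi>t p + b' p * \<phi>x p))) \<and>
       integrable lborel (\<lambda>x. ub x * \<phi> (0, x)) \<and>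
       (\<integral>p. indicator (spacetime T) p * (u p * (\<phi>t p + b' p * \<phi>x p)) \<partial>lborel) + (\<integral>x. ub x * \<phi> (0, x) \<partial>lborel) = 0"
    using weak_solution_exists[OF ub ub_loc] by blast
  have um: "u \<in> borel_measurable (lebesgue_on S)" for S
  proof -
    have "u \<in> borel_measurable lebesgue" by (intro measurable_completion) simp
    then show ?thesis by (rule measurable_restrict_space1)
  qed
  have u_sol: "weak_solution T b ubar u"
    unfolding weak_solution_def
  proof (intro conjI allI impI)
    show "L1_loc_on (spacetime T) u"
      unfolding L1_loc_on_def
    proof (intro allI impI)
      fix K :: "(real \<times> real) set" assume K: "compact K \<and> K \<subseteq> spacetime T"
      then obtain r where r: "r > 0" "\<And>p. p \<in> K \<Longrightarrow> norm p < r"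
        using compact_imp_bounded bounded_pos_less by metis
      have sub: "K \<subseteq> {0<..<T} \<times> {-r..r}"
      proof
        fix p assume p: "p \<in> K"
        then have "\<bar>snd p\<bar> < r" using r(2)[OF p] norm_snd_le[of "snd p" "fst p"] by simp
        then show "p \<in> {0<..<T} \<times> {-r..r}" using K p by (auto simp: mem_Times_iff)
      qed
      have Kb: "K \<in> sets borel" using K by (simp add: borel_compact)
      have gm: "(\<lambda>p. indicator K p * u p) \<in> borel_measurable borel"
        using borel_measurable_indicator[OF Kb] by measurable
      have "integrable lborel (\<lambda>p. indicator K p * u p)"
        by (rule Bochner_Integration.integrable_bound[OF u_loc[of r]])
          (use gm sub in \<open>auto simp: indicator_def\<close>)
      then show "integrable (lebesgue_on K) u"
        using lebesgue_on_integral_borel(1)[OF Kb um gm] by simp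
    qed
  next
    fix \<phi> \<phi>t \<phi>x assume a: "C1_on (spacetime0 T) \<phi> \<phi>t \<phi>x \<and> compactly_supported_in (spacetime0 T) \<phi>"
    then have C1: "C1_on (spacetime0 T) \<phi> \<phi>t \<phi>x" by blast
    note w = u_weak[OF C1 conjunct2[OF a]]
    have u_eq: "AE p in lborel. p \<in> spacetime T \<longrightarrow> u p = u p" by simp
    note conv = weak_integrand_borel[OF bm b_meas b_eq um u u_eq C1]
    show "integrable (lebesgue_on (spacetime T)) (\<lambda>p. u p * (\<phi>t p + b p * \<phi>x p))"
      using w conv(1) by simp
    have pm: "(\<lambda>x. \<phi> (0, x)) \<in> borel_measurable borel"
    proof -
      have "continuous_on (spacetime0 T) \<phi>"
      proof (unfold continuous_on_eq_continuous_within, rule ballI)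
        fix p assume "p \<in> spacetime0 T"
        with C1 have "(\<phi> has_derivative (\<lambda>h. \<phi>t p * fst h + \<phi>x p * snd h)) (at p within spacetime0 T)"
          unfolding C1_on_def by blast
        then show "continuous (at p within spacetime0 T) \<phi>" by (rule has_derivative_continuous)
      qed
      then have "continuous_on UNIV (\<lambda>x. \<phi> (0, x))"
        by (rule continuous_on_compose2) (use T in \<open>auto intro: continuous_intros\<close>)
      then show ?thesis by (rule borel_measurable_continuous_onI)
    qed
    have pl: "(\<lambda>x. \<phi> (0, x)) \<in> borel_measurable lebesgue" using pm by (intro measurable_completion) simp
    have fm: "(\<lambda>x. ubar x * \<phi> (0, x)) \<in> borel_measurable (lebesgue_on UNIV)"
      using ubar_lebesgue pl by (simp add: lebesgue_on_UNIV)
    have gm: "(\<lambda>x. indicator UNIV x * (ub x * \<phi> (0, x))) \<in> borel_measurable borel"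
      using pm by simp
    have eq: "AE x in lborel. x \<in> UNIV \<longrightarrow> ubar x * \<phi> (0, x) = ub x * \<phi> (0, x)"
      using ub_eq by eventually_elim simp
    note conv0 = lebesgue_on_integral_borel[OF _ fm gm eq, simplified]
    show "integrable lebesgue (\<lambda>x. ubar x * \<phi> (0, x))"
      using w conv0(1) by (simp add: lebesgue_on_UNIV)
    show "(LINT p|lebesgue_on (spacetime T). u p * (\<phi>t p + b p * \<phi>x p)) + (LINT x|lebesgue. ubar x * \<phi> (0, x)) = 0"
      using w conv(2) conv0(2) by (simp add: lebesgue_on_UNIV)
  qed
  have unique: "AE p in lebesgue_on (spacetime T). v p = u p" if v: "weak_solution T b ubar v" for v
  proof -
    have vm: "v \<in> borel_measurable (lebesgue_on (spacetime T))"
      using v T by (intro L1_loc_on_spacetime_measurable) (auto simp: weak_solution_def)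
    obtain v' where v' [measurable]: "v' \<in> borel_measurable borel" and v_eq: "AE p in lborel. p \<in> spacetime T \<longrightarrow> v p = v' p"
      using borel_representative[OF Sb vm] by blast
    have "vanishing_weak_solution (\<lambda>p. v' p - u p)"
      unfolding vanishing_weak_solution_def
    proof (intro conjI allI impI)
      show "(\<lambda>p. v' p - u p) \<in> borel_measurable borel" by measurable
      fix \<phi> \<phi>t \<phi>x assume a: "C1_on (spacetime0 T) \<phi> \<phi>t \<phi>x \<and> compactly_supported_in (spacetime0 T) \<phi>"
      then have C1: "C1_on (spacetime0 T) \<phi> \<phi>t \<phi>x" by blast
      have u_eq: "AE p in lborel. p \<in> spacetime T \<longrightarrow> u p = u p" by simp
      note cu = weak_integrand_borel[OF bm b_meas b_eq um u u_eq C1]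
      note cv = weak_integrand_borel[OF bm b_meas b_eq vm v' v_eq C1]
      note su = u_sol[unfolded weak_solution_def, THEN conjunct2, rule_format, OF a]
      note sv = v[unfolded weak_solution_def, THEN conjunct2, rule_format, OF a]
      have iu: "integrable lborel (\<lambda>p. indicator (spacetime T) p * (u p * (\<phi>t p + b' p * \<phi>x p)))" using su cu(1) by blast
      have iv: "integrable lborel (\<lambda>p. indicator (spacetime T) p * (v' p * (\<phi>t p + b' p * \<phi>x p)))" using sv cv(1) by blast
      have *: "indicator (spacetime T) p * ((v' p - u p) * (\<phi>t p + b' p * \<phi>x p))
          = indicator (spacetime T) p * (v' p * (\<phi>t p + b' p * \<phi>x p)) - indicator (spacetime T) p * (u p * (\<phi>t p + b' p * \<phi>x p))" for p
        by (simp add: algebra_simps)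
      show "integrable lborel (\<lambda>p. indicator (spacetime T) p * ((v' p - u p) * (\<phi>t p + b' p * \<phi>x p)))"
        unfolding * by (rule Bochner_Integration.integrable_diff[OF iv iu])
      have "(\<integral>p. indicator (spacetime T) p * (v' p * (\<phi>t p + b' p * \<phi>x p)) \<partial>lborel)
          = (\<integral>p. indicator (spacetime T) p * (u p * (\<phi>t p + b' p * \<phi>x p)) \<partial>lborel)"
        using su sv cu(2) cv(2) by simp
      then show "(\<integral>p. indicator (spacetime T) p * ((v' p - u p) * (\<phi>t p + b' p * \<phi>x p)) \<partial>lborel) = 0"
        unfolding * Bochner_Integration.integral_diff[OF iv iu] by simp
    qed
    from vanishing_weak_solution_zero[OF this]
    show ?thesis
      unfolding AE_lebesgue_on_borel[OF Sb] using v_eq by eventually_elim auto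
  qed
  show ?thesis using u_sol unique by blast
qed

end
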